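(* Let $C$ be a compact Riemann surface of genus $g\ge2$ with a chosen projective coordinate system subordinating its complex structure and a fixed theta characteristic $K_C^{1/2}$, and let $r\ge2$. For $\mathbf{q}\in B=\bigoplus_{\ell=2}^r H^0(C,K_C^{\otimes\ell})$ let $(E_0,\phi(\mathbf{q}))$ be the corresponding point of the Hitchin section and $(E_\hbar,\nabla^\hbar(\mathbf{q}))$ the associated family of opers. Let $\mathcal{E}(\mathbf{q})$ denote the Rees $\mathcal{D}$-module $\big(E_\hbar,\hbar\nabla^\hbar(\mathbf{q})\big)$ on $C$. Then the semi-classical limit of $\mathcal{E}(\mathbf{q})$ is the spectral curve $\sigma^*\Sigma\subset T^*C$ of $-\phi(\mathbf{q})$ defined by the characteristic equation $\det(\eta+\phi(\mathbf{q}))=0$, where $\Sigma$ is the spectral curve $\det(\eta-\phi(\mathbf{q}))=0$ of $\phi(\mathbf{q})$, $\eta$ is the tautological $1$-form on $T^*C$, and $\sigma$ is the involution of $\overline{T^*C}=\mathbb{P}(K_C\oplus\mathcal{O}_C)$ given by fiberwise multiplication by $-1$.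
   Context: Projective coordinate system: a covering of $C$ by simply connected coordinate neighborhoods $U_\alpha$ with coordinates $x_\alpha$ related on overlaps by Möbius transformations $x_\alpha=\frac{a_{\alpha\beta}x_\beta+b_{\alpha\beta}}{c_{\alpha\beta}x_\beta+d_{\alpha\beta}}$ with matrix in $\mathrm{SL}(2,\mathbb{C})$. The theta characteristic $K_C^{1/2}$ has cocycle $\xi_{\alpha\beta}=\pm(c_{\alpha\beta}x_\beta+d_{\alpha\beta})$, $\xi_{\alpha\beta}^2=dx_\beta/dx_\alpha$. With $s_i=i(r-i)$: $X_-=[\sqrt{s_{i-1}}\,\delta_{i-1,j}]_{i,j=1,\dots,r}$, $X_+=X_-^t$, $H=[X_+,X_-]=\mathrm{diag}(r-1,r-3,\dots,-(r-1))$. $E_0=\bigoplus_{i=1}^r(K_C^{1/2})^{\otimes(r-2i+1)}$, $\phi(\mathbf{q})=X_-+\sum_{\ell=2}^r q_\ell X_+^{\ell-1}$. $E_\hbar$ is the bundle with transition functions $f_{\alpha\beta}^\hbar=\exp(H\log\xi_{\alpha\beta})\exp(\hbar\,\partial_\beta\log\xi_{\alpha\beta}X_+)$, and $\nabla^\hbar(\mathbf{q})$ is the connection in $E_\hbar$ given on $U_\alpha$ by $d+\frac1\hbar\phi_\alpha(\mathbf{q})dx_\alpha$, where $\phi_\alpha(\mathbf{q})=X_-+\sum_\ell (q_\ell)_\alpha X_+^{\ell-1}$ and $q_\ell=(q_\ell)_\alpha dx_\alpha^\ell$. Rees ring: $\widetilde{\mathcal{D}_C}=\bigoplus_{m\ge0}\hbar^mF_m\mathcal{D}_C\subset\mathbb{C}[[\hbar]]\otimes\mathcal{D}_C$,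 where $F_m\mathcal{D}_C$ is the filtration of the sheaf of differential operators by order; its local sections can be written $P(x,\hbar)=\sum_{\ell=0}^r a_\ell(x,\hbar)(\hbar\frac{d}{dx})^{r-\ell}$. A vector bundle with an $\hbar$-connection, such as $\hbar\nabla^\hbar(\mathbf{q})$, is a Rees $\mathcal{D}$-module. Local generator: on $U_\alpha$ write a flat section $\Psi=(\psi_{r-1},\dots,\psi_1,\psi)^t$ of $E_\hbar$, $(\hbar d+\phi_\alpha(\mathbf{q})dx_\alpha)\Psi=0$. Eliminating $\psi_1,\dots,\psi_{r-1}$ turns this system into a single equation $P_\alpha\psi=0$, with $P_\alpha$ a monic order-$r$ operator in $\hbar\frac{d}{dx_\alpha}$ whose coefficients are polynomial in $\hbar$, acting on $\psi$, a local section of $K_C^{-\frac{r-1}{2}}$; the Rees $\mathcal{D}$-module is locally $\widetilde{\mathcal{D}_C}/\widetilde{\mathcal{D}_C}P_\alpha$. Semi-classical limit: if a Rees $\widetilde{\mathcal{D}_C}$-module is on each coordinate neighborhood $U$ of the form $\widetilde{\mathcal{D}_C}(U)/\widetilde{\mathcal{D}_C}(U)P_U$ with $P_U=\sum_{\ell=0}^ra_\ell(x,\hbar)(\hbar\frac{d}{dx})^{r-\ell}$, put $p_U(x,y)=\sum_{\ell=0}^r a_\ell(x,0)y^{r-\ell}$, with $y$ the fiber coordinate of $T^*C|_U$ for which $\eta=y\,dx$. If the divisors of zeros $(p_U)_0$ glue together to a spectral curve in $\overline{T^*C}$ (a divisor finite of degree $r$ over $C$), this curve is called the semi-classical limit of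 the module. *)

theory Defs
  imports
    "HOL-Complex_Analysis.Complex_Analysis"
    "HOL-Homology.Homology"
    "HOL-Algebra.Module"
    "HOL-Algebra.AbelCoset"
    "Jordan_Normal_Form.Determinant"
begin

section \<open>Compact Riemann surfaces, projective coordinates, theta characteristics\<close>

definition complex_chart :: "'a topology \<Rightarrow> 'a set \<Rightarrow> ('a \<Rightarrow> complex) \<Rightarrow> bool" where
  "complex_chart X U z \<longleftrightarrow>
     openin X U \<and> open (z ` U) \<and>
     homeomorphic_map (subtopology X U) (top_of_set (z ` U)) z"

definition holo_compatible ::
  "'a set \<Rightarrow> ('a \<Rightarrow> complex) \<Rightarrow> 'a set \<Rightarrow> ('a \<Rightarrow> complex) \<Rightarrow> bool" where
  "holo_compatible U z V w \<longleftrightarrow>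
     (w \<circ> inv_into U z) holomorphic_on (z ` (U \<inter> V)) \<and>
     (z \<circ> inv_into V w) holomorphic_on (w ` (U \<inter> V))"

definition complex_atlas :: "'a topology \<Rightarrow> ('a set \<times> ('a \<Rightarrow> complex)) set \<Rightarrow> bool" where
  "complex_atlas X \<A> \<longleftrightarrow>
     (\<forall>(U, z) \<in> \<A>. complex_chart X U z) \<and>
     (\<forall>(U, z) \<in> \<A>. \<forall>(V, w) \<in> \<A>. holo_compatible U z V w) \<and>
     (\<Union>(U, z) \<in> \<A>. U) = topspace X"

definition compact_riemann_surface ::
  "'a topology \<Rightarrow> ('a set \<times> ('a \<Rightarrow> complex)) set \<Rightarrow> bool" where
  "compact_riemann_surface X \<A> \<longleftrightarrow>
     compact_space X \<and> connected_space X \<and> Hausdorff_space X \<and> complex_atlas X \<A>"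

definition has_genus :: "'a topology \<Rightarrow> nat \<Rightarrow> bool" where
  "has_genus X g \<longleftrightarrow> homology_group 1 X \<cong> free_Abelian_group {..<2 * g}"

record ('a, 'i) coord_system =
  Idx :: "'i set"
  Nbhd :: "'i \<Rightarrow> 'a set"
  Coord :: "'i \<Rightarrow> 'a \<Rightarrow> complex"
  Moebius :: "'i \<Rightarrow> 'i \<Rightarrow> complex mat"

definition pt :: "('a, 'i) coord_system \<Rightarrow> 'i \<Rightarrow> complex \<Rightarrow> 'a" where
  "pt S \<alpha> = inv_into (Nbhd S \<alpha>) (Coord S \<alpha>)"

definition projective_coord_system ::
  "'a topology \<Rightarrow> ('a set \<times> ('a \<Rightarrow> complex)) set \<Rightarrow> ('a, 'i) coord_system \<Rightarrow> bool" where
  "projective_coord_system X \<A> S \<longleftrightarrow>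
     (\<forall>\<alpha> \<in> Idx S. complex_chart X (Nbhd S \<alpha>) (Coord S \<alpha>) \<and> Nbhd S \<alpha> \<noteq> {} \<and>
        simply_connected (Coord S \<alpha> ` Nbhd S \<alpha>) \<and>
        (\<forall>(V, w) \<in> \<A>. holo_compatible (Nbhd S \<alpha>) (Coord S \<alpha>) V w)) \<and>
     (\<Union>\<alpha> \<in> Idx S. Nbhd S \<alpha>) = topspace X \<and>
     (\<forall>\<alpha> \<in> Idx S. \<forall>\<beta> \<in> Idx S.
        Moebius S \<alpha> \<beta> \<in> carrier_mat 2 2 \<and> Determinant.det (Moebius S \<alpha> \<beta>) = 1 \<and>
        (\<forall>p \<in> Nbhd S \<alpha> \<inter> Nbhd S \<beta>.
           Moebius S \<alpha> \<beta> $$ (1, 0) * Coord S \<beta> p + Moebius S \<alpha> \<beta> $$ (1, 1) \<noteq> 0 \<and>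
           Coord S \<alpha> p =
             (Moebius S \<alpha> \<beta> $$ (0, 0) * Coord S \<beta> p + Moebius S \<alpha> \<beta> $$ (0, 1)) /
             (Moebius S \<alpha> \<beta> $$ (1, 0) * Coord S \<beta> p + Moebius S \<alpha> \<beta> $$ (1, 1))))"

text \<open>The sign is a function on the overlap, locally constant because \<^term>\<open>\<xi> \<alpha> \<beta>\<close> is required to be
  holomorphic.\<close>

definition theta_characteristic ::
  "('a, 'i) coord_system \<Rightarrow> ('i \<Rightarrow> 'i \<Rightarrow> 'a \<Rightarrow> complex) \<Rightarrow> bool" where
  "theta_characteristic S \<xi> \<longleftrightarrow>
     (\<forall>\<alpha> \<in> Idx S. \<forall>\<beta> \<in> Idx S.
        (\<xi> \<alpha> \<beta> \<circ> pt S \<beta>) holomorphic_on (Coord S \<beta> ` (Nbhd S \<alpha> \<inter> Nbhd S \<beta>)) \<and>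
        (\<forall>p \<in> Nbhd S \<alpha> \<inter> Nbhd S \<beta>.
           \<xi> \<alpha> \<beta> p = Moebius S \<alpha> \<beta> $$ (1, 0) * Coord S \<beta> p + Moebius S \<alpha> \<beta> $$ (1, 1) \<or>
           \<xi> \<alpha> \<beta> p = - (Moebius S \<alpha> \<beta> $$ (1, 0) * Coord S \<beta> p + Moebius S \<alpha> \<beta> $$ (1, 1)))) \<and>
     (\<forall>\<alpha> \<in> Idx S. \<forall>\<beta> \<in> Idx S. \<forall>\<gamma> \<in> Idx S.
        \<forall>p \<in> Nbhd S \<alpha> \<inter> Nbhd S \<beta> \<inter> Nbhd S \<gamma>. \<xi> \<alpha> \<beta> p * \<xi> \<beta> \<gamma> p = \<xi> \<alpha> \<gamma> p)"

section \<open>Holomorphic functions and pluricanonical forms\<close>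

text \<open>Functions on an open subset are total functions that vanish outside of it.\<close>

definition holfun :: "('a, 'i) coord_system \<Rightarrow> 'a set \<Rightarrow> ('a \<Rightarrow> complex) set" where
  "holfun S W = {f. (\<forall>p. p \<notin> W \<longrightarrow> f p = 0) \<and>
     (\<forall>\<alpha> \<in> Idx S. (f \<circ> pt S \<alpha>) holomorphic_on (Coord S \<alpha> ` (W \<inter> Nbhd S \<alpha>)))}"

text \<open>\<open>\<O>(W)[\<hbar>]\<close>; the second argument of a function is the value of \<open>\<hbar>\<close>.\<close>

definition holfun_hbar :: "('a, 'i) coord_system \<Rightarrow> 'a set \<Rightarrow> ('a \<Rightarrow> complex \<Rightarrow> complex) set" where
  "holfun_hbar S W =
     {u. \<exists>n c. (\<forall>k\<le>n. c k \<in> holfun S W) \<and> u = (\<lambda>p h. \<Sum>k\<le>n. c k p * h ^ k)}"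

definition ddx :: "('a, 'i) coord_system \<Rightarrow> 'i \<Rightarrow> ('a \<Rightarrow> complex) \<Rightarrow> 'a \<Rightarrow> complex" where
  "ddx S \<alpha> f p = (if p \<in> Nbhd S \<alpha> then deriv (f \<circ> pt S \<alpha>) (Coord S \<alpha> p) else 0)"

text \<open>\<open>dcoord S \<alpha> \<beta>\<close> is \<open>dx\<^sub>\<alpha> / dx\<^sub>\<beta>\<close>.\<close>

definition dcoord :: "('a, 'i) coord_system \<Rightarrow> 'i \<Rightarrow> 'i \<Rightarrow> 'a \<Rightarrow> complex" where
  "dcoord S \<alpha> \<beta> = ddx S \<beta> (Coord S \<alpha>)"

text \<open>\<open>H\<^sup>0(C, K\<^sup>\<ell>)\<close>: \<open>\<omega> = \<omega>\<^sub>\<alpha> dx\<^sub>\<alpha>\<^sup>\<ell>\<close>.\<close>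

definition pluricanonical ::
  "('a, 'i) coord_system \<Rightarrow> nat \<Rightarrow> ('i \<Rightarrow> 'a \<Rightarrow> complex) set" where
  "pluricanonical S l = {\<omega>.
     (\<forall>\<alpha> \<in> Idx S. \<omega> \<alpha> \<in> holfun S (Nbhd S \<alpha>)) \<and>
     (\<forall>\<alpha> \<in> Idx S. \<forall>\<beta> \<in> Idx S. \<forall>p \<in> Nbhd S \<alpha> \<inter> Nbhd S \<beta>.
        \<omega> \<alpha> p = dcoord S \<beta> \<alpha> p ^ l * \<omega> \<beta> p)}"

section \<open>The Hitchin section and the family of opers\<close>

text \<open>Matrix and vector indices start at 0 instead of 1.\<close>

definition Xminus :: "nat \<Rightarrow> complex mat" where
  "Xminus r = Matrix.mat r r (\<lambda>(i, j).
     if i = Suc j then complex_of_real (sqrt (real (i * (r - i)))) else 0)"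

definition Xplus :: "nat \<Rightarrow> complex mat" where
  "Xplus r = transpose_mat (Xminus r)"

definition Hmat :: "nat \<Rightarrow> complex mat" where
  "Hmat r = Xplus r * Xminus r - Xminus r * Xplus r"

definition mat_exp :: "complex mat \<Rightarrow> complex mat" where
  "mat_exp A = Matrix.mat (dim_row A) (dim_row A) (\<lambda>(i, j). suminf (\<lambda>k. (A ^\<^sub>m k) $$ (i, j) / fact k))"

type_synonym ('a, 'i) transition = "'i \<Rightarrow> 'i \<Rightarrow> 'a \<Rightarrow> complex mat"
type_synonym ('a, 'i) matrix_form = "'i \<Rightarrow> 'a \<Rightarrow> complex mat"

definition hitchin_bundle ::
  "('i \<Rightarrow> 'i \<Rightarrow> 'a \<Rightarrow> complex) \<Rightarrow> nat \<Rightarrow> ('a, 'i) transition" where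
  "hitchin_bundle \<xi> r \<alpha> \<beta> p = Matrix.mat r r (\<lambda>(i, j).
     if i = j then \<xi> \<alpha> \<beta> p powi (int r - 2 * int (Suc i) + 1) else 0)"

definition higgs_field :: "nat \<Rightarrow> (nat \<Rightarrow> 'i \<Rightarrow> 'a \<Rightarrow> complex) \<Rightarrow> ('a, 'i) matrix_form" where
  "higgs_field r q \<alpha> p = Xminus r + Matrix.mat r r (\<lambda>(i, j).
     \<Sum>l\<in>{2..r}. q l \<alpha> p * (Xplus r ^\<^sub>m (l - 1)) $$ (i, j))"

definition hitchin_section ::
  "('i \<Rightarrow> 'i \<Rightarrow> 'a \<Rightarrow> complex) \<Rightarrow> nat \<Rightarrow> (nat \<Rightarrow> 'i \<Rightarrow> 'a \<Rightarrow> complex) \<Rightarrow>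
   ('a, 'i) transition \<times> ('a, 'i) matrix_form" where
  "hitchin_section \<xi> r q = (hitchin_bundle \<xi> r, higgs_field r q)"

text \<open>\<open>\<partial>\<^sub>\<beta> log \<xi>\<^sub>\<alpha>\<^sub>\<beta>\<close> is the logarithmic derivative. Since the eigenvalues of \<open>H\<close> are integers,
  \<open>exp (H log \<xi>)\<close> does not depend on the branch of the logarithm.\<close>

definition oper_bundle ::
  "('a, 'i) coord_system \<Rightarrow> ('i \<Rightarrow> 'i \<Rightarrow> 'a \<Rightarrow> complex) \<Rightarrow> nat \<Rightarrow> complex \<Rightarrow> ('a, 'i) transition" where
  "oper_bundle S \<xi> r h \<alpha> \<beta> p =
     mat_exp (Ln (\<xi> \<alpha> \<beta> p) \<cdot>\<^sub>m Hmat r) *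
     mat_exp ((h * (ddx S \<beta> (\<xi> \<alpha> \<beta>) p / \<xi> \<alpha> \<beta> p)) \<cdot>\<^sub>m Xplus r)"

text \<open>Connection matrices with respect to \<open>dx\<^sub>\<alpha>\<close>; \<open>\<hbar>\<nabla>\<^sup>\<hbar>\<close> is extended to \<open>\<hbar> = 0\<close>, where division by
  zero would give the wrong value.\<close>

definition oper_connection ::
  "nat \<Rightarrow> (nat \<Rightarrow> 'i \<Rightarrow> 'a \<Rightarrow> complex) \<Rightarrow> complex \<Rightarrow> ('a, 'i) matrix_form" where
  "oper_connection r q h \<alpha> p = (1 / h) \<cdot>\<^sub>m higgs_field r q \<alpha> p"

definition oper_hbar_connection ::
  "nat \<Rightarrow> (nat \<Rightarrow> 'i \<Rightarrow> 'a \<Rightarrow> complex) \<Rightarrow> complex \<Rightarrow> ('a, 'i) matrix_form" where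
  "oper_hbar_connection r q h \<alpha> p =
     (if h = 0 then higgs_field r q \<alpha> p else h \<cdot>\<^sub>m oper_connection r q h \<alpha> p)"

section \<open>The Rees ring and its modules\<close>

definition diffops ::
  "('a, 'i) coord_system \<Rightarrow> 'i \<Rightarrow> nat \<Rightarrow> (('a \<Rightarrow> complex) \<Rightarrow> 'a \<Rightarrow> complex) set" where
  "diffops S \<alpha> m = {Q. \<exists>a. (\<forall>k\<le>m. a k \<in> holfun S (Nbhd S \<alpha>)) \<and>
     Q = (\<lambda>f. if f \<in> holfun S (Nbhd S \<alpha>) then (\<lambda>p. \<Sum>k\<le>m. a k p * (ddx S \<alpha> ^^ k) f p)
              else (\<lambda>p. 0))}"

type_synonym 'a hbar_op = "('a \<Rightarrow> complex \<Rightarrow> complex) \<Rightarrow> 'a \<Rightarrow> complex \<Rightarrow> complex"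

text \<open>Sections over the coordinate neighborhood \<open>U\<^sub>\<alpha>\<close>. The element \<open>\<Sum>\<^sub>m \<hbar>\<^sup>m Q\<^sub>m\<close> is represented by the
  \<open>\<complex>[\<hbar>]\<close>-linear operator that it induces on \<open>\<O>(U\<^sub>\<alpha>)[\<hbar>]\<close>, which determines all \<open>Q\<^sub>m\<close>.\<close>

definition rees_ring :: "('a, 'i) coord_system \<Rightarrow> 'i \<Rightarrow> 'a hbar_op ring" where
  "rees_ring S \<alpha> =
     \<lparr>carrier = {T. \<exists>N Q. (\<forall>m\<le>N. Q m \<in> diffops S \<alpha> m) \<and>
        T = (\<lambda>u. if u \<in> holfun_hbar S (Nbhd S \<alpha>)
                 then (\<lambda>p h. \<Sum>m\<le>N. h ^ m * Q m (\<lambda>p'. u p' h) p) else (\<lambda>p h. 0))},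
      monoid.mult = (\<lambda>T T'. T \<circ> T'),
      one = (\<lambda>u. if u \<in> holfun_hbar S (Nbhd S \<alpha>) then u else (\<lambda>p h. 0)),
      zero = (\<lambda>u p h. 0),
      add = (\<lambda>T T' u p h. T u p h + T' u p h)\<rparr>"

definition hbar_ddx :: "('a, 'i) coord_system \<Rightarrow> 'i \<Rightarrow> 'a hbar_op" where
  "hbar_ddx S \<alpha> u = (\<lambda>p h. h * ddx S \<alpha> (\<lambda>p'. u p' h) p)"

text \<open>\<open>\<Sum>\<^sub>\<ell> a\<^sub>\<ell>(x, \<hbar>) (\<hbar> d/dx\<^sub>\<alpha>)\<^sup>n\<^sup>-\<^sup>\<ell>\<close>\<close>

definition rees_op ::
  "('a, 'i) coord_system \<Rightarrow> 'i \<Rightarrow> nat \<Rightarrow> (nat \<Rightarrow> 'a \<Rightarrow> complex \<Rightarrow> complex) \<Rightarrow> 'a hbar_op" where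
  "rees_op S \<alpha> n a =
     (\<lambda>u. if u \<in> holfun_hbar S (Nbhd S \<alpha>)
          then (\<lambda>p h. \<Sum>l\<le>n. a l p h * (hbar_ddx S \<alpha> ^^ (n - l)) u p h) else (\<lambda>p h. 0))"

text \<open>The library locale for modules covers commutative rings only; its record type is used for left
  modules, where the multiplicative part is irrelevant.\<close>

definition left_ideal :: "('b, 'c) ring_scheme \<Rightarrow> 'b \<Rightarrow> 'b set" where
  "left_ideal R P = {T \<otimes>\<^bsub>R\<^esub> P | T. T \<in> carrier R}"

definition left_quotient :: "('b, 'c) ring_scheme \<Rightarrow> 'b \<Rightarrow> ('b, 'b set) module" where
  "left_quotient R P =
     \<lparr>carrier = a_rcosets\<^bsub>R\<^esub> (left_ideal R P),
      monoid.mult = undefined, one = undefined,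
      zero = left_ideal R P,
      add = (\<lambda>A B. A <+>\<^bsub>R\<^esub> B),
      smult = (\<lambda>T A. \<Union>Q\<in>A. left_ideal R P +>\<^bsub>R\<^esub> (T \<otimes>\<^bsub>R\<^esub> Q))\<rparr>"

definition left_module_iso ::
  "('b, 'c) ring_scheme \<Rightarrow> ('b, 'm) module \<Rightarrow> ('b, 'n) module \<Rightarrow> bool" where
  "left_module_iso R M N \<longleftrightarrow> (\<exists>F. bij_betw F (carrier M) (carrier N) \<and>
     (\<forall>x \<in> carrier M. \<forall>y \<in> carrier M. F (x \<oplus>\<^bsub>M\<^esub> y) = F x \<oplus>\<^bsub>N\<^esub> F y) \<and>
     (\<forall>T \<in> carrier R. \<forall>x \<in> carrier M. F (T \<odot>\<^bsub>M\<^esub> x) = T \<odot>\<^bsub>N\<^esub> F x))"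

text \<open>The Rees module of a rank \<open>r\<close> bundle with transition functions \<open>f\<^sup>\<hbar>\<^sub>\<alpha>\<^sub>\<beta>\<close> and \<open>\<hbar>\<close>-connection
  \<open>\<hbar> d + B\<^sup>\<hbar>\<^sub>\<alpha> dx\<^sub>\<alpha>\<close> is the module of the linear system \<open>(\<hbar> d + B\<^sup>\<hbar>\<^sub>\<alpha> dx\<^sub>\<alpha>) \<Psi>\<^sub>\<alpha> = 0\<close>: it is generated by
  the components of an indeterminate flat section \<open>\<Psi>\<close>, the relations being the equations of the
  system. Its elements are the expressions \<open>\<lambda>\<^sub>\<alpha> \<Psi>\<^sub>\<alpha>\<close> with a row vector \<open>\<lambda>\<^sub>\<alpha>\<close> over \<open>\<O>[\<hbar>]\<close>. From
  \<open>\<Psi>\<^sub>\<alpha> = f\<^sup>\<hbar>\<^sub>\<alpha>\<^sub>\<beta> \<Psi>\<^sub>\<beta>\<close> one gets \<open>\<lambda>\<^sub>\<beta> = \<lambda>\<^sub>\<alpha> f\<^sup>\<hbar>\<^sub>\<alpha>\<^sub>\<beta>\<close>, and \<open>\<hbar> d (\<lambda>\<^sub>\<beta> \<Psi>\<^sub>\<beta>) = (\<hbar> d\<lambda>\<^sub>\<beta> - \<lambda>\<^sub>\<beta> B\<^sup>\<hbar>\<^sub>\<beta> dx\<^sub>\<beta>) \<Psi>\<^sub>\<beta>\<close>. An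
  operator \<open>P\<close> annihilates the generator \<open>\<psi>\<close>, the last component of \<open>\<Psi>\<close>, iff \<open>P \<psi> = 0\<close> is a
  consequence of the system. (Letting \<open>\<hbar> d/dx\<close> act by \<open>\<hbar>\<nabla>\<close> on sections of the bundle itself would
  give the dual module.)\<close>

type_synonym ('a, 'i) covector = "'i \<Rightarrow> 'a \<Rightarrow> complex \<Rightarrow> complex vec"

definition covector_sections ::
  "('a, 'i) coord_system \<Rightarrow> nat \<Rightarrow> (complex \<Rightarrow> ('a, 'i) transition) \<Rightarrow> 'a set \<Rightarrow>
   ('a, 'i) covector set" where
  "covector_sections S r f W = {v.
     (\<forall>\<beta> p h. v \<beta> p h \<in> carrier_vec r) \<and>
     (\<forall>\<beta> p h. \<beta> \<notin> Idx S \<longrightarrow> v \<beta> p h = 0\<^sub>v r) \<and>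
     (\<forall>\<beta> \<in> Idx S. \<forall>j<r. (\<lambda>p h. vec_index (v \<beta> p h) j) \<in> holfun_hbar S (W \<inter> Nbhd S \<beta>)) \<and>
     (\<forall>\<beta> \<in> Idx S. \<forall>\<gamma> \<in> Idx S. \<forall>p \<in> W \<inter> Nbhd S \<beta> \<inter> Nbhd S \<gamma>. \<forall>h.
        v \<gamma> p h = transpose_mat (f h \<beta> \<gamma> p) *\<^sub>v v \<beta> p h)}"

text \<open>The action of \<open>\<hbar> d/dx\<^sub>\<alpha>\<close> over \<open>U\<^sub>\<alpha>\<close>, where \<open>d/dx\<^sub>\<alpha> = (dx\<^sub>\<beta> / dx\<^sub>\<alpha>) d/dx\<^sub>\<beta>\<close>.\<close>

definition hbar_nabla ::
  "('a, 'i) coord_system \<Rightarrow> nat \<Rightarrow> (complex \<Rightarrow> ('a, 'i) matrix_form) \<Rightarrow> 'i \<Rightarrow>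
   ('a, 'i) covector \<Rightarrow> ('a, 'i) covector" where
  "hbar_nabla S r B \<alpha> v = (\<lambda>\<beta> p h.
     if \<beta> \<in> Idx S \<and> p \<in> Nbhd S \<alpha> \<inter> Nbhd S \<beta> then
       dcoord S \<beta> \<alpha> p \<cdot>\<^sub>v
         (h \<cdot>\<^sub>v Matrix.vec r (\<lambda>j. ddx S \<beta> (\<lambda>p'. vec_index (v \<beta> p' h) j) p)
          - transpose_mat (B h \<beta> p) *\<^sub>v v \<beta> p h)
     else 0\<^sub>v r)"

definition rees_module ::
  "('a, 'i) coord_system \<Rightarrow> nat \<Rightarrow> (complex \<Rightarrow> ('a, 'i) transition) \<Rightarrow>
   (complex \<Rightarrow> ('a, 'i) matrix_form) \<Rightarrow> 'i \<Rightarrow> ('a hbar_op, ('a, 'i) covector) module" where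
  "rees_module S r f B \<alpha> =
     \<lparr>carrier = covector_sections S r f (Nbhd S \<alpha>),
      monoid.mult = undefined, one = undefined,
      zero = (\<lambda>\<beta> p h. 0\<^sub>v r),
      add = (\<lambda>v w \<beta> p h. v \<beta> p h + w \<beta> p h),
      smult = (\<lambda>T v. THE w. \<exists>n a. (\<forall>l\<le>n. a l \<in> holfun_hbar S (Nbhd S \<alpha>)) \<and>
        T = rees_op S \<alpha> n a \<and>
        w = (\<lambda>\<beta> p h. Matrix.vec r (\<lambda>j. \<Sum>l\<le>n. a l p h *
               vec_index ((hbar_nabla S r B \<alpha> ^^ (n - l)) v \<beta> p h) j)))\<rparr>"

section \<open>The compactified cotangent bundle and its divisors\<close>

text \<open>A cotangent vector at \<open>p\<close> is the family of its components \<open>y\<^sub>\<alpha>\<close> with respect to \<open>dx\<^sub>\<alpha>\<close>, extended by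
  zero to the indices of coordinates not defined at \<open>p\<close>. In a point \<open>(p, Some y)\<close> or \<open>(p, None)\<close> of
  \<open>\<P>(K \<oplus> \<O>)\<close> the second component stands for the line through \<open>(y, 1)\<close> resp. for the line \<open>K\<^sub>p\<close>.\<close>

type_synonym ('a, 'i) tpoint = "'a \<times> ('i \<Rightarrow> complex) option"

definition cotangent_space :: "('a, 'i) coord_system \<Rightarrow> 'a \<Rightarrow> ('i \<Rightarrow> complex) set" where
  "cotangent_space S p = {y.
     (\<forall>\<alpha>. \<not> (\<alpha> \<in> Idx S \<and> p \<in> Nbhd S \<alpha>) \<longrightarrow> y \<alpha> = 0) \<and>
     (\<forall>\<alpha> \<in> Idx S. \<forall>\<beta> \<in> Idx S. p \<in> Nbhd S \<alpha> \<inter> Nbhd S \<beta> \<longrightarrow> y \<alpha> = dcoord S \<beta> \<alpha> p * y \<beta>)}"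

definition cotangent_bundle :: "('a, 'i) coord_system \<Rightarrow> ('a, 'i) tpoint set" where
  "cotangent_bundle S =
     {(p, Some y) | p y. p \<in> (\<Union>\<alpha> \<in> Idx S. Nbhd S \<alpha>) \<and> y \<in> cotangent_space S p}"

definition compact_cotangent_bundle :: "('a, 'i) coord_system \<Rightarrow> ('a, 'i) tpoint set" where
  "compact_cotangent_bundle S =
     cotangent_bundle S \<union> {(p, None) | p. p \<in> (\<Union>\<alpha> \<in> Idx S. Nbhd S \<alpha>)}"

definition covec :: "('a, 'i) coord_system \<Rightarrow> 'i \<Rightarrow> 'a \<Rightarrow> complex \<Rightarrow> 'i \<Rightarrow> complex" where
  "covec S \<alpha> p t = (\<lambda>\<beta>. if \<beta> \<in> Idx S \<and> p \<in> Nbhd S \<beta> then t * dcoord S \<alpha> \<beta> p else 0)"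

text \<open>Two parametrizations over each \<open>U\<^sub>\<alpha>\<close>: by \<open>(x, y)\<close> with \<open>\<eta> = y dx\<close>, and by \<open>(x, w)\<close> with
  \<open>w = 1 / y\<close> near infinity.\<close>

definition tparam ::
  "('a, 'i) coord_system \<Rightarrow> 'i \<Rightarrow> bool \<Rightarrow> complex \<times> complex \<Rightarrow> ('a, 'i) tpoint" where
  "tparam S \<alpha> at_inf = (\<lambda>(x, t).
     (pt S \<alpha> x,
      if at_inf then (if t = 0 then None else Some (covec S \<alpha> (pt S \<alpha> x) (1 / t)))
      else Some (covec S \<alpha> (pt S \<alpha> x) t)))"

definition tparam_preimage ::
  "('a, 'i) coord_system \<Rightarrow> 'i \<Rightarrow> bool \<Rightarrow> ('a, 'i) tpoint set \<Rightarrow> (complex \<times> complex) set" where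
  "tparam_preimage S \<alpha> b W = {z \<in> (Coord S \<alpha> ` Nbhd S \<alpha>) \<times> UNIV. tparam S \<alpha> b z \<in> W}"

definition topen :: "('a, 'i) coord_system \<Rightarrow> ('a, 'i) tpoint set \<Rightarrow> bool" where
  "topen S W \<longleftrightarrow> W \<subseteq> compact_cotangent_bundle S \<and>
     (\<forall>\<alpha> \<in> Idx S. \<forall>b. open (tparam_preimage S \<alpha> b W))"

definition holomorphic2_on :: "(complex \<times> complex \<Rightarrow> complex) \<Rightarrow> (complex \<times> complex) set \<Rightarrow> bool" where
  "holomorphic2_on f W \<longleftrightarrow>
     (\<forall>z \<in> W. \<exists>A B. (f has_derivative (\<lambda>(s, t). A * s + B * t)) (at z))"

definition tholo ::
  "('a, 'i) coord_system \<Rightarrow> ('a, 'i) tpoint set \<Rightarrow> (('a, 'i) tpoint \<Rightarrow> complex) \<Rightarrow> bool" where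
  "tholo S W g \<longleftrightarrow> topen S W \<and>
     (\<forall>\<alpha> \<in> Idx S. \<forall>b. holomorphic2_on (g \<circ> tparam S \<alpha> b) (tparam_preimage S \<alpha> b W))"

definition holo_at :: "('a, 'i) coord_system \<Rightarrow> ('a, 'i) tpoint \<Rightarrow> (('a, 'i) tpoint \<Rightarrow> complex) \<Rightarrow> bool" where
  "holo_at S P g \<longleftrightarrow> (\<exists>W. P \<in> W \<and> tholo S W g)"

definition dvd_at ::
  "('a, 'i) coord_system \<Rightarrow> ('a, 'i) tpoint \<Rightarrow> (('a, 'i) tpoint \<Rightarrow> complex) \<Rightarrow>
   (('a, 'i) tpoint \<Rightarrow> complex) \<Rightarrow> bool" where
  "dvd_at S P f g \<longleftrightarrow> (\<exists>W k. P \<in> W \<and> tholo S W k \<and> (\<forall>Q \<in> W. g Q = f Q * k Q))"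

definition coprime_at ::
  "('a, 'i) coord_system \<Rightarrow> ('a, 'i) tpoint \<Rightarrow> (('a, 'i) tpoint \<Rightarrow> complex) \<Rightarrow>
   (('a, 'i) tpoint \<Rightarrow> complex) \<Rightarrow> bool" where
  "coprime_at S P f g \<longleftrightarrow>
     (\<forall>d. holo_at S P d \<and> dvd_at S P d f \<and> dvd_at S P d g \<longrightarrow> d P \<noteq> 0)"

text \<open>A divisor is given by the stalks of its ideal sheaf; germs are represented by functions.\<close>

type_synonym ('a, 'i) tdivisor = "('a, 'i) tpoint \<Rightarrow> (('a, 'i) tpoint \<Rightarrow> complex) set"

definition principal_stalk ::
  "('a, 'i) coord_system \<Rightarrow> (('a, 'i) tpoint \<Rightarrow> complex) \<Rightarrow> ('a, 'i) tdivisor" where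
  "principal_stalk S f P = {k. holo_at S P k \<and> dvd_at S P f k}"

definition effective_divisor :: "('a, 'i) coord_system \<Rightarrow> ('a, 'i) tdivisor \<Rightarrow> bool" where
  "effective_divisor S D \<longleftrightarrow>
     (\<forall>P. P \<notin> compact_cotangent_bundle S \<longrightarrow> D P = {}) \<and>
     (\<forall>P \<in> compact_cotangent_bundle S. \<exists>W f. P \<in> W \<and> tholo S W f \<and>
        (\<forall>V \<subseteq> W. topen S V \<and> V \<noteq> {} \<longrightarrow> (\<exists>Q \<in> V. f Q \<noteq> 0)) \<and>
        (\<forall>Q \<in> W. D Q = principal_stalk S f Q))"

text \<open>The stalk at \<open>P\<close> of the divisor of zeros of a meromorphic function \<open>f\<close> given on the cotangent
  bundle: it is generated by the numerator of \<open>f = g / d\<close> in lowest terms.\<close>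

definition zero_divisor ::
  "('a, 'i) coord_system \<Rightarrow> (('a, 'i) tpoint \<Rightarrow> complex) \<Rightarrow> ('a, 'i) tdivisor" where
  "zero_divisor S f P = {k. \<exists>g d. holo_at S P g \<and> holo_at S P d \<and> coprime_at S P g d \<and>
     (\<exists>W. P \<in> W \<and> topen S W \<and> (\<forall>Q \<in> W \<inter> cotangent_bundle S. d Q * f Q = g Q)) \<and>
     k \<in> principal_stalk S g P}"

definition support :: "('a, 'i) coord_system \<Rightarrow> ('a, 'i) tdivisor \<Rightarrow> ('a, 'i) tpoint set" where
  "support S D = {P \<in> compact_cotangent_bundle S. \<forall>k \<in> D P. k P = 0}"

text \<open>Along the fiber through \<open>P\<close>, some germ in the ideal of \<open>D\<close> has nonvanishing \<open>n\<close>-th derivative at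
  \<open>P\<close>. The least such \<open>n\<close> is the intersection multiplicity of \<open>D\<close> with the fiber at \<open>P\<close>.\<close>

definition fiber_nonvanishing ::
  "('a, 'i) coord_system \<Rightarrow> ('a, 'i) tdivisor \<Rightarrow> ('a, 'i) tpoint \<Rightarrow> nat \<Rightarrow> bool" where
  "fiber_nonvanishing S D P n \<longleftrightarrow>
     (\<exists>k \<in> D P. \<exists>\<alpha> \<in> Idx S. \<exists>b. \<exists>x \<in> Coord S \<alpha> ` Nbhd S \<alpha>. \<exists>t.
        P = tparam S \<alpha> b (x, t) \<and> (deriv ^^ n) (\<lambda>s. k (tparam S \<alpha> b (x, s))) t \<noteq> 0)"

definition fiber_multiplicity ::
  "('a, 'i) coord_system \<Rightarrow> ('a, 'i) tdivisor \<Rightarrow> ('a, 'i) tpoint \<Rightarrow> nat" where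
  "fiber_multiplicity S D P = (LEAST n. fiber_nonvanishing S D P n)"

text \<open>Finiteness over the base is finiteness of the fibers, since \<open>\<P>(K \<oplus> \<O>)\<close> is proper over it.\<close>

definition spectral_curve :: "('a, 'i) coord_system \<Rightarrow> nat \<Rightarrow> ('a, 'i) tdivisor \<Rightarrow> bool" where
  "spectral_curve S r D \<longleftrightarrow> effective_divisor S D \<and>
     (\<forall>P \<in> compact_cotangent_bundle S. \<exists>n. fiber_nonvanishing S D P n) \<and>
     (\<forall>p \<in> (\<Union>\<alpha> \<in> Idx S. Nbhd S \<alpha>).
        finite {P \<in> support S D. fst P = p} \<and>
        (\<Sum>P \<in> {P \<in> support S D. fst P = p}. fiber_multiplicity S D P) = r)"

definition fiber_neg :: "('a, 'i) tpoint \<Rightarrow> ('a, 'i) tpoint" where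
  "fiber_neg = (\<lambda>(p, y). (p, map_option (\<lambda>v \<alpha>. - v \<alpha>) y))"

text \<open>Pullback under the involution above, which is its own inverse.\<close>

definition neg_pullback :: "('a, 'i) tdivisor \<Rightarrow> ('a, 'i) tdivisor" where
  "neg_pullback D P = {k. k \<circ> fiber_neg \<in> D (fiber_neg P)}"

text \<open>\<open>det (\<eta> - \<phi>)\<close> is a section of the pullback of \<open>K\<^sup>r\<close>; over \<open>U\<^sub>\<alpha>\<close> it is \<open>det (y - \<phi>\<^sub>\<alpha>) dx\<^sub>\<alpha>\<^sup>r\<close>.\<close>

definition char_function ::
  "nat \<Rightarrow> ('a, 'i) matrix_form \<Rightarrow> 'i \<Rightarrow> ('a, 'i) tpoint \<Rightarrow> complex" where
  "char_function r \<phi> \<alpha> = (\<lambda>(p, y). Determinant.det (the y \<alpha> \<cdot>\<^sub>m 1\<^sub>m r - \<phi> \<alpha> p))"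

definition spectral_divisor ::
  "('a, 'i) coord_system \<Rightarrow> nat \<Rightarrow> ('a, 'i) transition \<times> ('a, 'i) matrix_form \<Rightarrow>
   ('a, 'i) tdivisor" where
  "spectral_divisor S r = (\<lambda>(E, \<phi>) P.
     {k. \<exists>\<alpha> \<in> Idx S. fst P \<in> Nbhd S \<alpha> \<and> k \<in> zero_divisor S (char_function r \<phi> \<alpha>) P})"

section \<open>Semi-classical limit\<close>

definition symbol_function ::
  "nat \<Rightarrow> (nat \<Rightarrow> 'a \<Rightarrow> complex \<Rightarrow> complex) \<Rightarrow> 'i \<Rightarrow> ('a, 'i) tpoint \<Rightarrow> complex" where
  "symbol_function r a \<alpha> = (\<lambda>(p, y). \<Sum>l\<le>r. a l p 0 * the y \<alpha> ^ (r - l))"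

definition is_semiclassical_limit ::
  "('a, 'i) coord_system \<Rightarrow> nat \<Rightarrow> ('i \<Rightarrow> ('a hbar_op, 'm) module) \<Rightarrow>
   ('a, 'i) tdivisor \<Rightarrow> bool" where
  "is_semiclassical_limit S r M D \<longleftrightarrow> spectral_curve S r D \<and>
     (\<exists>a. \<forall>\<alpha> \<in> Idx S.
        (\<forall>l\<le>r. a \<alpha> l \<in> holfun_hbar S (Nbhd S \<alpha>)) \<and>
        left_module_iso (rees_ring S \<alpha>)
          (left_quotient (rees_ring S \<alpha>) (rees_op S \<alpha> r (a \<alpha>))) (M \<alpha>) \<and>
        (\<forall>P \<in> compact_cotangent_bundle S. fst P \<in> Nbhd S \<alpha> \<longrightarrow>
           D P = zero_divisor S (symbol_function r (a \<alpha>) \<alpha>) P))"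

end

theory Submission
  imports Defs "HOL-Library.Function_Algebras" "HOL-Computational_Algebra.Fundamental_Theorem_Algebra"
begin

text \<open>
  In a projective coordinate the derivative of \<open>\<xi>\<^sub>\<alpha>\<^sub>\<beta>\<close> is constant. With \<open>z = \<xi>\<^sub>\<alpha>\<^sub>\<beta>\<close> and \<open>\<kappa> = \<partial>\<^sub>\<beta>\<xi>\<^sub>\<alpha>\<^sub>\<beta>\<close>, the
  transition matrix of \<open>E\<^sub>\<hbar>\<close> has the entries \<open>z\<^sup>r\<^sup>-\<^sup>1\<^sup>-\<^sup>i\<^sup>-\<^sup>j (\<hbar>\<kappa>)\<^sup>j\<^sup>-\<^sup>i w\<^sub>i\<^sub>j / (j - i)!\<close>, where \<open>w\<^sub>i\<^sub>j\<close> is the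
  entry of \<open>X\<^sub>+\<^sup>j\<^sup>-\<^sup>i\<close>. From this one reads off the cocycle condition (the binomial theorem) and the
  gauge transformation law of the connections, so over \<open>U\<^sub>\<alpha>\<close> the Rees module is the free module of row
  vectors over \<open>\<O>[\<hbar>]\<close> on which \<open>\<hbar> d/dx\<close> acts by \<open>\<lambda> \<mapsto> \<hbar>\<lambda>' - \<lambda>\<phi>\<close>. Since \<open>\<phi>\<close> is upper Hessenberg with constant
  nonzero subdiagonal, the last basis vector \<open>e\<close> is cyclic: \<open>e, \<nabla>e, \<dots>, \<nabla>\<^sup>r\<^sup>-\<^sup>1e\<close> is a basis. Expressing
  \<open>\<nabla>\<^sup>re\<close> in it gives the monic operator \<open>P\<^sub>\<alpha>\<close>, and division with remainder by \<open>P\<^sub>\<alpha>\<close> identifies the module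
  with the quotient by the left ideal of \<open>P\<^sub>\<alpha>\<close>. At \<open>\<hbar> = 0\<close> the operator \<open>\<nabla>\<close> is multiplication by \<open>-\<phi>\<close>,
  whose matrix in this basis is the companion matrix of the symbol; hence the symbol is \<open>det (y + \<phi>)\<close>.
  Being monic in \<open>y\<close>, it has a pole along infinity and its zeros form a curve of degree \<open>r\<close> over the base.
\<close>

section \<open>Differential operators acting on a module with connection\<close>

text \<open>A section of the Rees ring is a function on O(U)[hbar], and scalar multiplication, both
  in the quotient and in the Rees module, is given through representatives. Nothing is well defined
  until such a function is known to determine its coefficients. Testing it at p on powers of x -
  x(p) recovers them only up to a power of hbar; their values at hbar = 0, the ones that enter the
  symbol, then follow by continuity in hbar. Operators are therefore handled as coefficient
  sequences over an abstract differential ring, which covers the action on functions and the action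
  on the module at once. As functions on U are extended by zero, the unit of O(U)[hbar] is the
  indicator of U and not the constant 1; this is the separate unit \<open>e\<close>. The sign in xi
  = +-(c x + d) is never determined: what is needed of xi is deduced from xi^2 = (c x + d)^2 and the
  cocycle condition. Since divisors live on the compactified bundle while the equations are given on
  the cotangent bundle, the points at infinity need their own coordinate w = 1/y throughout.\<close>

locale differential_ring =
  fixes R :: "'f::comm_ring_1 set" and e :: 'f and \<delta> :: "'f \<Rightarrow> 'f"
  assumes R_zero: "0 \<in> R"
    and R_unit: "e \<in> R"
    and R_add: "\<And>a b. a \<in> R \<Longrightarrow> b \<in> R \<Longrightarrow> a + b \<in> R"
    and R_uminus: "\<And>a. a \<in> R \<Longrightarrow> - a \<in> R"
    and R_mult: "\<And>a b. a \<in> R \<Longrightarrow> b \<in> R \<Longrightarrow> a * b \<in> R"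
    and unit_mult: "\<And>a. a \<in> R \<Longrightarrow> e * a = a"
    and R_deriv: "\<And>a. a \<in> R \<Longrightarrow> \<delta> a \<in> R"
    and deriv_add: "\<And>a b. a \<in> R \<Longrightarrow> b \<in> R \<Longrightarrow> \<delta> (a + b) = \<delta> a + \<delta> b"
    and deriv_mult: "\<And>a b. a \<in> R \<Longrightarrow> b \<in> R \<Longrightarrow> \<delta> (a * b) = \<delta> a * b + a * \<delta> b"
begin

lemma R_sum: "(\<And>i. i \<in> A \<Longrightarrow> f i \<in> R) \<Longrightarrow> (\<Sum>i\<in>A. f i) \<in> R"
  by (induction A rule: infinite_finite_induct) (auto intro: R_zero R_add)

lemma R_minus: "a \<in> R \<Longrightarrow> b \<in> R \<Longrightarrow> a - b \<in> R"
  using R_add[OF _ R_uminus, of a b] by simp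

lemma deriv_zero: "\<delta> 0 = 0"
  using deriv_add[OF R_zero R_zero] by simp

text \<open>Such a sequence stands for the sum of b_k nabla^k over k < n, so \<open>n\<close> is a
  strict bound for the order. The meaning of nabla is left open: the same sequence acts on functions
  and on any module with a connection.\<close>

definition coefs :: "nat \<Rightarrow> (nat \<Rightarrow> 'f) set" where
  "coefs n = {b. (\<forall>k. b k \<in> R) \<and> (\<forall>k\<ge>n. b k = 0)}"

text \<open>Coefficients of nabla composed with the operator of \<open>b\<close>. By nabla b_k =
  (\<delta> b_k) + b_k nabla each term is differentiated in place and also moves up by one.\<close>

definition shift :: "(nat \<Rightarrow> 'f) \<Rightarrow> nat \<Rightarrow> 'f" where
  "shift b k = \<delta> (b k) + (if k = 0 then 0 else b (k - 1))"

text \<open>Coefficients of the product of two operators, \<open>b\<close> on the left; each nabla^i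
  is carried past the coefficients of \<open>c\<close> by \<open>shift\<close>.\<close>

definition comp :: "nat \<Rightarrow> (nat \<Rightarrow> 'f) \<Rightarrow> (nat \<Rightarrow> 'f) \<Rightarrow> nat \<Rightarrow> 'f" where
  "comp n b c k = (\<Sum>i<n. b i * (shift ^^ i) c k)"

lemma coefs_in: "b \<in> coefs n \<Longrightarrow> b k \<in> R"
  by (simp add: coefs_def)

lemma coefs_zero: "b \<in> coefs n \<Longrightarrow> n \<le> k \<Longrightarrow> b k = 0"
  by (simp add: coefs_def)

lemma coefs_mono: "b \<in> coefs n \<Longrightarrow> n \<le> m \<Longrightarrow> b \<in> coefs m"
  by (auto simp: coefs_def)

lemma coefs_add: "b \<in> coefs n \<Longrightarrow> c \<in> coefs n \<Longrightarrow> (\<lambda>k. b k + c k) \<in> coefs n"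
  by (auto simp: coefs_def R_add)

lemma coefs_diff: "b \<in> coefs n \<Longrightarrow> c \<in> coefs n \<Longrightarrow> (\<lambda>k. b k - c k) \<in> coefs n"
  by (auto simp: coefs_def R_minus)

lemma coefs_0: "(\<lambda>k. 0) \<in> coefs n"
  by (auto simp: coefs_def R_zero)

lemma coefs_monom: "a \<in> R \<Longrightarrow> (\<lambda>k. if k = i then a else 0) \<in> coefs (Suc i)"
  by (auto simp: coefs_def R_zero)

lemma shift_coefs: "b \<in> coefs n \<Longrightarrow> shift b \<in> coefs (Suc n)"
  by (auto simp: coefs_def shift_def deriv_zero intro!: R_add R_deriv R_zero)

lemma shift_pow_coefs: "b \<in> coefs n \<Longrightarrow> (shift ^^ i) b \<in> coefs (n + i)"
  by (induction i) (auto intro: shift_coefs)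

text \<open>Nothing is multiplied on the way up, and the derivative only meets the entry above the
  top, which is 0. So a monic operator stays monic after left multiplication by nabla^i.\<close>

lemma shift_pow_top: "b \<in> coefs (Suc n) \<Longrightarrow> b n = e \<Longrightarrow> (shift ^^ i) b (n + i) = e"
proof (induction i)
  case (Suc i)
  have "(shift ^^ i) b (n + Suc i) = 0"
    using coefs_zero[OF shift_pow_coefs[OF Suc.prems(1), of i]] by simp
  with Suc show ?case by (simp add: shift_def[of _ "Suc (n + i)"] deriv_zero)
qed simp

lemma comp_coefs:
  assumes "b \<in> coefs n" "c \<in> coefs m"
  shows "comp n b c \<in> coefs (n + m)"
proof -
  have "comp n b c k \<in> R" for k
    unfolding comp_def using assms coefs_in[OF shift_pow_coefs]
    by (auto intro!: R_sum R_mult coefs_in[OF assms(1)])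
  moreover have "comp n b c k = 0" if "k \<ge> n + m" for k
    unfolding comp_def using that coefs_zero[OF shift_pow_coefs[OF assms(2)]]
    by (intro sum.neutral) auto
  ultimately show ?thesis by (auto simp: coefs_def)
qed

lemma comp_add: "comp n (\<lambda>k. b k + b' k) c k = comp n b c k + comp n b' c k"
  by (simp add: comp_def algebra_simps sum.distrib)

lemma comp_extend: "b \<in> coefs n \<Longrightarrow> n \<le> m \<Longrightarrow> comp m b c = comp n b c"
  unfolding comp_def by (rule ext, rule sum.mono_neutral_right) (auto simp: coefs_def)

lemma comp_monom: "comp (Suc i) (\<lambda>k. if k = i then a else 0) c k = a * (shift ^^ i) c k"
  by (simp add: comp_def if_distrib cong: if_cong)

text \<open>Euclid's algorithm with quotients on the left: T_n nabla^(n-r) P has the same top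
  coefficient as T because P is monic, so subtracting it lowers the order without any inversion in
  the ring.\<close>

lemma division_monic:
  assumes P: "P \<in> coefs (Suc r)" "P r = e" and T: "T \<in> coefs n"
  shows "\<exists>N U Q. U \<in> coefs N \<and> Q \<in> coefs r \<and> T = (\<lambda>k. comp N U P k + Q k)"
  using T
proof (induction n arbitrary: T)
  case 0
  then have "T \<in> coefs r" by (rule coefs_mono) simp
  then show ?case
    by (intro exI[of _ 0] exI[of _ "\<lambda>k. 0"] exI[of _ T]) (auto simp: coefs_0 comp_def)
next
  case (Suc n)
  show ?case
  proof (cases "Suc n \<le> r")
    case True
    then have "T \<in> coefs r" using Suc.prems coefs_mono by blast
    then show ?thesis
      by (intro exI[of _ 0] exI[of _ "\<lambda>k. 0"] exI[of _ T]) (auto simp: coefs_0 comp_def)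
  next
    case False
    define i where "i = n - r"
    have n: "n = r + i" using False by (simp add: i_def)
    define V where "V = (\<lambda>k. if k = i then T n else 0)"
    have V: "V \<in> coefs (Suc i)"
      unfolding V_def by (rule coefs_monom) (rule coefs_in[OF Suc.prems])
    \<comment> \<open>\<open>comp_coefs\<close> gives only the strict bound n + 2; the monomial form
      of \<open>V\<close> sharpens it to n + 1.\<close>
    have W: "comp (Suc i) V P \<in> coefs (Suc n)"
    proof -
      have "comp (Suc i) V P k \<in> R" for k
        using coefs_in[OF comp_coefs[OF V P(1)]] .
      moreover have "comp (Suc i) V P k = 0" if "k \<ge> Suc n" for k
        using coefs_zero[OF shift_pow_coefs[OF P(1), of i], of k] that
        by (simp add: V_def comp_monom n)
      ultimately show ?thesis by (simp add: coefs_def)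
    qed
    have top: "comp (Suc i) V P n = T n"
      using shift_pow_top[OF P, of i] unit_mult[OF coefs_in[OF Suc.prems, of n]]
      by (simp add: V_def comp_monom n mult.commute)
    define T' where "T' = (\<lambda>k. T k - comp (Suc i) V P k)"
    have T'n: "T' \<in> coefs (Suc n)" unfolding T'_def by (rule coefs_diff[OF Suc.prems W])
    have "T' k = 0" if "k \<ge> n" for k
    proof (cases "k = n")
      case True
      then show ?thesis by (simp add: T'_def top)
    next
      case False
      then show ?thesis using coefs_zero[OF T'n, of k] that by simp
    qed
    with T'n have "T' \<in> coefs n" by (simp add: coefs_def)
    from Suc.IH[OF this] obtain N U Q where
      U: "U \<in> coefs N" "Q \<in> coefs r" "T' = (\<lambda>k. comp N U P k + Q k)" by blast
    define L where "L = max N (Suc i)"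
    have L: "U \<in> coefs L" "V \<in> coefs L"
      using coefs_mono[OF U(1), of L] coefs_mono[OF V, of L] by (auto simp: L_def)
    have "T k = comp L (\<lambda>k. U k + V k) P k + Q k" for k
    proof -
      have "T k = T' k + comp (Suc i) V P k" by (simp add: T'_def)
      also have "\<dots> = comp L U P k + comp L V P k + Q k"
        using comp_extend[OF U(1), of L P] comp_extend[OF V, of L P] U(3) by (simp add: L_def)
      finally show ?thesis by (simp add: comp_add)
    qed
    with coefs_add[OF L] U(2) show ?thesis by blast
  qed
qed

end

text \<open>The bilinear scalar laws are asked for all ambient elements, so that sums can be
  rearranged without membership conditions; membership is required only where closure, the unit or
  the connection is involved.\<close>

locale differential_module = differential_ring R e \<delta>
  for R :: "'f::comm_ring_1 set" and e \<delta> +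
  fixes M :: "'m::ab_group_add set" and sm :: "'f \<Rightarrow> 'm \<Rightarrow> 'm" and nab :: "'m \<Rightarrow> 'm"
  assumes M_zero: "0 \<in> M"
    and M_add: "\<And>v w. v \<in> M \<Longrightarrow> w \<in> M \<Longrightarrow> v + w \<in> M"
    and M_smult: "\<And>a v. a \<in> R \<Longrightarrow> v \<in> M \<Longrightarrow> sm a v \<in> M"
    and sm_add_left: "\<And>a b v. sm (a + b) v = sm a v + sm b v"
    and sm_add_right: "\<And>a v w. sm a (v + w) = sm a v + sm a w"
    and sm_mult: "\<And>a b v. sm (a * b) v = sm a (sm b v)"
    and sm_unit: "\<And>v. v \<in> M \<Longrightarrow> sm e v = v"
    and nab_closed: "\<And>v. v \<in> M \<Longrightarrow> nab v \<in> M"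
    and nab_add: "\<And>v w. v \<in> M \<Longrightarrow> w \<in> M \<Longrightarrow> nab (v + w) = nab v + nab w"
    and nab_smult: "\<And>a v. a \<in> R \<Longrightarrow> v \<in> M \<Longrightarrow> nab (sm a v) = sm (\<delta> a) v + sm a (nab v)"
begin

definition act :: "nat \<Rightarrow> (nat \<Rightarrow> 'f) \<Rightarrow> 'm \<Rightarrow> 'm" where
  "act n b v = (\<Sum>k<n. sm (b k) ((nab ^^ k) v))"

lemma sm_zero_left [simp]: "sm 0 v = 0"
  using sm_add_left[of 0 0 v] by simp

lemma sm_zero_right [simp]: "sm a 0 = 0"
  using sm_add_right[of a 0 0] by simp

lemma sm_minus_left: "sm (- a) v = - sm a v"
  using sm_add_left[of a "- a" v] minus_unique[of "sm a v" "sm (- a) v"] by simp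

lemma sm_diff_left: "sm (a - b) v = sm a v - sm b v"
  using sm_add_left[of a "- b" v] by (simp add: sm_minus_left)

lemma sm_sum_left: "sm (\<Sum>i\<in>A. f i) v = (\<Sum>i\<in>A. sm (f i) v)"
  by (induction A rule: infinite_finite_induct) (auto simp: sm_add_left)

lemma sm_sum_right: "sm a (\<Sum>i\<in>A. f i) = (\<Sum>i\<in>A. sm a (f i))"
  by (induction A rule: infinite_finite_induct) (auto simp: sm_add_right)

lemma nab_zero: "nab 0 = 0"
  using nab_add[OF M_zero M_zero] by simp

lemma M_sum: "(\<And>i. i \<in> A \<Longrightarrow> f i \<in> M) \<Longrightarrow> (\<Sum>i\<in>A. f i) \<in> M"
  by (induction A rule: infinite_finite_induct) (auto intro: M_zero M_add)

lemma nab_sum: "(\<And>i. i \<in> A \<Longrightarrow> f i \<in> M) \<Longrightarrow> nab (\<Sum>i\<in>A. f i) = (\<Sum>i\<in>A. nab (f i))"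
  by (induction A rule: infinite_finite_induct) (auto simp: nab_zero nab_add M_sum)

lemma nab_pow_closed: "v \<in> M \<Longrightarrow> (nab ^^ k) v \<in> M"
  by (induction k) (auto intro: nab_closed)

lemma nab_pow_add: "v \<in> M \<Longrightarrow> w \<in> M \<Longrightarrow> (nab ^^ k) (v + w) = (nab ^^ k) v + (nab ^^ k) w"
  by (induction k) (auto simp: nab_add nab_pow_closed)

lemma act_closed: "b \<in> coefs n \<Longrightarrow> v \<in> M \<Longrightarrow> act n b v \<in> M"
  unfolding act_def by (intro M_sum M_smult nab_pow_closed) (auto intro: coefs_in)

lemma act_add_vec: "v \<in> M \<Longrightarrow> w \<in> M \<Longrightarrow> act n b (v + w) = act n b v + act n b w"
  by (simp add: act_def nab_pow_add sm_add_right sum.distrib)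

lemma act_zero_vec: "act n b 0 = 0"
  using act_add_vec[OF M_zero M_zero, of n b] by simp

lemma act_add: "act n (\<lambda>k. b k + c k) v = act n b v + act n c v"
  by (simp add: act_def sm_add_left sum.distrib)

lemma act_diff: "act n (\<lambda>k. b k - c k) v = act n b v - act n c v"
  by (simp add: act_def sm_diff_left sum_subtractf)

lemma act_scale: "act n (\<lambda>k. a * b k) v = sm a (act n b v)"
  by (simp add: act_def sm_mult sm_sum_right)

lemma act_sum: "act n (\<lambda>k. \<Sum>i\<in>A. b i k) v = (\<Sum>i\<in>A. act n (b i) v)"
  unfolding act_def by (simp add: sm_sum_left) (rule sum.swap)

lemma act_extend: "b \<in> coefs n \<Longrightarrow> n \<le> m \<Longrightarrow> act m b v = act n b v"
  unfolding act_def by (rule sum.mono_neutral_right) (auto simp: coefs_def)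

text \<open>The Leibniz rule produces from each term exactly the two summands of
  \<open>shift\<close>.\<close>

lemma nab_act:
  assumes b: "b \<in> coefs n" and v: "v \<in> M"
  shows "nab (act n b v) = act (Suc n) (shift b) v"
proof -
  have "nab (act n b v) = (\<Sum>k<n. nab (sm (b k) ((nab ^^ k) v)))"
    unfolding act_def by (rule nab_sum) (intro M_smult nab_pow_closed v coefs_in[OF b])
  also have "\<dots> = (\<Sum>k<n. sm (\<delta> (b k)) ((nab ^^ k) v) + sm (b k) ((nab ^^ Suc k) v))"
    by (rule sum.cong) (simp_all add: nab_smult[OF coefs_in[OF b] nab_pow_closed[OF v]])
  also have "\<dots> = act n (\<lambda>k. \<delta> (b k)) v + (\<Sum>k<n. sm (b k) ((nab ^^ Suc k) v))"
    by (simp add: sum.distrib act_def)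
  also have "act n (\<lambda>k. \<delta> (b k)) v = act (Suc n) (\<lambda>k. \<delta> (b k)) v"
    using coefs_zero[OF b, of n] by (simp add: act_def deriv_zero)
  also have "(\<Sum>k<n. sm (b k) ((nab ^^ Suc k) v)) = act (Suc n) (\<lambda>k. if k = 0 then 0 else b (k - 1)) v"
    unfolding act_def by (subst sum.lessThan_Suc_shift) simp
  finally show ?thesis
    by (simp add: shift_def[abs_def] act_add)
qed

lemma nab_pow_act:
  assumes b: "b \<in> coefs n" and v: "v \<in> M"
  shows "(nab ^^ i) (act n b v) = act (n + i) ((shift ^^ i) b) v"
proof (induction i)
  case (Suc i)
  then show ?case using nab_act[OF shift_pow_coefs[OF b, of i] v] by simp
qed simp

text \<open>This makes the action a module structure over the operators: \<open>comp\<close> is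
  computed from coefficients alone, so one product serves every module.\<close>

lemma act_comp:
  assumes b: "b \<in> coefs n" and c: "c \<in> coefs m" and v: "v \<in> M"
  shows "act (n + m) (comp n b c) v = act n b (act m c v)"
proof -
  have "act n b (act m c v) = (\<Sum>i<n. sm (b i) (act (m + i) ((shift ^^ i) c) v))"
    unfolding act_def[of n] by (simp add: nab_pow_act[OF c v])
  also have "\<dots> = (\<Sum>i<n. sm (b i) (act (n + m) ((shift ^^ i) c) v))"
  proof (rule sum.cong)
    fix i assume "i \<in> {..<n}"
    then show "sm (b i) (act (m + i) ((shift ^^ i) c) v) = sm (b i) (act (n + m) ((shift ^^ i) c) v)"
      using act_extend[OF shift_pow_coefs[OF c, of i], of "n + m"] by simp
  qed simp
  also have "\<dots> = act (n + m) (comp n b c) v"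
    by (simp add: comp_def[abs_def] act_sum act_scale)
  finally show ?thesis ..
qed

end

text \<open>Operators of the Rees ring act on functions, which is the case of the regular module
  with the derivation as connection; the instance \<open>reg\<close> makes the preceding lemmas
  available for it.\<close>

sublocale differential_ring \<subseteq> reg: differential_module R e \<delta> R "(*)" \<delta>
proof (unfold_locales, goal_cases)
  case 4 show ?case by (rule distrib_right)
next
  case 5 show ?case by (rule distrib_left)
next
  case 6 show ?case by (rule mult.assoc)
qed (fact R_zero R_add R_mult unit_mult R_deriv deriv_add deriv_mult)+

context differential_ring
begin

text \<open>Outside R the value is 0, as in \<open>rees_ring\<close>, so an operator is determined
  by its values on R.\<close>

definition op :: "nat \<Rightarrow> (nat \<Rightarrow> 'f) \<Rightarrow> 'f \<Rightarrow> 'f" where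
  "op n b u = (if u \<in> R then reg.act n b u else 0)"

text \<open>Shaped like \<open>rees_ring\<close>, with which it is identified in
  \<open>rees_ring_eq\<close>; here the elements come from coefficient sequences instead of graded
  pieces.\<close>

definition opring :: "('f \<Rightarrow> 'f) ring" where
  "opring = \<lparr>carrier = {op n b | n b. b \<in> coefs n}, monoid.mult = (\<lambda>T T'. T \<circ> T'),
     one = (\<lambda>u. if u \<in> R then u else 0), zero = (\<lambda>u. 0), add = (\<lambda>T T' u. T u + T' u)\<rparr>"

lemma opring_simps:
  "carrier opring = {op n b | n b. b \<in> coefs n}"
  "T \<otimes>\<^bsub>opring\<^esub> T' = T \<circ> T'"
  "T \<oplus>\<^bsub>opring\<^esub> T' = (\<lambda>u. T u + T' u)"
  by (simp_all add: opring_def)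

lemma op_comp:
  assumes b: "b \<in> coefs n" and c: "c \<in> coefs m"
  shows "op n b \<circ> op m c = op (n + m) (comp n b c)"
  using reg.act_comp[OF b c] reg.act_closed[OF c] reg.act_zero_vec R_zero
  by (auto simp: op_def fun_eq_iff)

lemma op_extend: "b \<in> coefs n \<Longrightarrow> n \<le> m \<Longrightarrow> op m b = op n b"
  using reg.act_extend[of b n m] by (simp add: op_def fun_eq_iff)

lemma op_add: "(\<lambda>u. op n b u + op n c u) = op n (\<lambda>k. b k + c k)"
  by (auto simp: op_def fun_eq_iff reg.act_add)



end

text \<open>Division with remainder by \<open>P\<close> shows that the module is the quotient by the left ideal of \<open>P\<close>.\<close>

locale cyclic_differential_module = differential_module R e \<delta> M sm nab
  for R :: "'f::comm_ring_1 set" and e \<delta> and M :: "'m::ab_group_add set" and sm nab +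
  fixes g :: 'm and r :: nat and P :: "nat \<Rightarrow> 'f"
  assumes faithful: "\<And>n b. b \<in> coefs n \<Longrightarrow> (\<And>u. u \<in> R \<Longrightarrow> reg.act n b u = 0) \<Longrightarrow> b = (\<lambda>k. 0)"
    and g_in: "g \<in> M"
    and generates: "\<And>v. v \<in> M \<Longrightarrow> \<exists>b \<in> coefs r. v = act r b g"
    and independent: "\<And>b. b \<in> coefs r \<Longrightarrow> act r b g = 0 \<Longrightarrow> b = (\<lambda>k. 0)"
    and P_coefs: "P \<in> coefs (Suc r)"
    and P_monic: "P r = e"
    and P_annihilates: "act (Suc r) P g = 0"
begin

abbreviation Pop :: "'f \<Rightarrow> 'f" where "Pop \<equiv> op (Suc r) P"
abbreviation I :: "('f \<Rightarrow> 'f) set" where "I \<equiv> left_ideal opring Pop"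

text \<open>The hinge between operators as functions and operators as coefficient sequences: after
  padding to a common bound, faithfulness on R turns equality of functions into equality of
  coefficients, hence into equal actions on M.\<close>

lemma op_eq_imp_act_eq:
  assumes b: "b \<in> coefs n" and c: "c \<in> coefs m" and eq: "op n b = op m c"
  shows "act n b v = act m c v"
proof -
  define N where "N = max n m"
  have bN: "b \<in> coefs N" and cN: "c \<in> coefs N"
    using coefs_mono[OF b, of N] coefs_mono[OF c, of N] by (auto simp: N_def)
  have "op N b = op N c" using op_extend[OF b, of N] op_extend[OF c, of N] eq by (simp add: N_def)
  then have "reg.act N (\<lambda>k. b k - c k) u = 0" if "u \<in> R" for u
    using that by (auto simp: op_def fun_eq_iff reg.act_diff split: if_splits)
  from faithful[OF coefs_diff[OF bN cN] this] have "b = c" by (auto simp: fun_eq_iff)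
  then show ?thesis using act_extend[OF b, of N] act_extend[OF c, of N] by (simp add: N_def)
qed

text \<open>The bound \<open>n\<close> is decoupled from the bound \<open>N + Suc r\<close> of the
  product, so that an operator can be tested for membership in any of its representations.\<close>

lemma I_altdef: "I = {op n (comp N U P) | n N U. U \<in> coefs N \<and> comp N U P \<in> coefs n}"
proof (intro equalityI subsetI)
  fix T assume "T \<in> I"
  then obtain N U where U: "U \<in> coefs N" "T = op N U \<circ> Pop"
    unfolding left_ideal_def opring_simps by blast
  then have "T = op (N + Suc r) (comp N U P)" "comp N U P \<in> coefs (N + Suc r)"
    using op_comp[OF U(1) P_coefs] comp_coefs[OF U(1) P_coefs] by simp_all
  with U(1) show "T \<in> {op n (comp N U P) | n N U. U \<in> coefs N \<and> comp N U P \<in> coefs n}" by blast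
next
  fix T assume "T \<in> {op n (comp N U P) | n N U. U \<in> coefs N \<and> comp N U P \<in> coefs n}"
  then obtain n N U where U: "U \<in> coefs N" "comp N U P \<in> coefs n" "T = op n (comp N U P)" by blast
  define L where "L = max n (N + Suc r)"
  have "T = op L (comp N U P)" using op_extend[OF U(2), of L] U(3) by (simp add: L_def)
  also have "\<dots> = op (N + Suc r) (comp N U P)"
    using op_extend[OF comp_coefs[OF U(1) P_coefs], of L] by (simp add: L_def)
  also have "\<dots> = op N U \<circ> Pop" by (rule op_comp[OF U(1) P_coefs, symmetric])
  finally show "T \<in> I" using U(1) unfolding left_ideal_def opring_simps by blast
qed

lemma act_comp_P: "U \<in> coefs N \<Longrightarrow> comp N U P \<in> coefs n \<Longrightarrow> act n (comp N U P) g = 0"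
proof -
  assume U: "U \<in> coefs N" "comp N U P \<in> coefs n"
  define L where "L = max n (N + Suc r)"
  have "act n (comp N U P) g = act L (comp N U P) g"
    using act_extend[OF U(2), of L] by (simp add: L_def)
  also have "\<dots> = act (N + Suc r) (comp N U P) g"
    using act_extend[OF comp_coefs[OF U(1) P_coefs], of L] by (simp add: L_def)
  also have "\<dots> = 0"
    by (simp only: act_comp[OF U(1) P_coefs g_in] P_annihilates act_zero_vec)
  finally show ?thesis .
qed

text \<open>The ideal is the annihilator of \<open>g\<close>: after division by P only a remainder
  of order less than r acts on \<open>g\<close>, and the independence of g, nabla g, ...,
  nabla^(r-1) g forces it to be 0.\<close>

lemma act_eq_0_iff:
  assumes b: "b \<in> coefs n"
  shows "act n b g = 0 \<longleftrightarrow> op n b \<in> I"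
proof
  assume 0: "act n b g = 0"
  obtain N U Q where U: "U \<in> coefs N" and Q: "Q \<in> coefs r" and bQ: "b = (\<lambda>k. comp N U P k + Q k)"
    using division_monic[OF P_coefs P_monic b] by blast
  define L where "L = max n (max r (N + Suc r))"
  have C: "comp N U P \<in> coefs L" using coefs_mono[OF comp_coefs[OF U P_coefs], of L] by (simp add: L_def)
  have "0 = act L b g" using 0 act_extend[OF b, of L] by (simp add: L_def)
  also have "\<dots> = act L (comp N U P) g + act L Q g" by (simp add: bQ act_add)
  also have "\<dots> = act r Q g" using act_comp_P[OF U C] act_extend[OF Q, of L] by (simp add: L_def)
  finally have "Q = (\<lambda>k. 0)" using independent[OF Q] by simp
  with bQ have "b = comp N U P" by (simp add: fun_eq_iff)
  with U b show "op n b \<in> I" by (auto simp: I_altdef)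
next
  assume "op n b \<in> I"
  then obtain m N U where U: "U \<in> coefs N" "comp N U P \<in> coefs m" "op n b = op m (comp N U P)"
    by (auto simp: I_altdef)
  then show "act n b g = 0" using op_eq_imp_act_eq[OF b U(2,3)] act_comp_P[OF U(1,2)] by simp
qed

definition cls :: "('f \<Rightarrow> 'f) \<Rightarrow> ('f \<Rightarrow> 'f) set" where
  "cls T = I +>\<^bsub>opring\<^esub> T"

lemma cls_coset: "cls T = {\<lambda>u. i u + T u | i. i \<in> I}"
proof -
  have "I +>\<^bsub>opring\<^esub> T = (\<Union>i\<in>I. {i \<oplus>\<^bsub>opring\<^esub> T})"
    by (simp add: a_r_coset_def r_coset_def)
  then show ?thesis unfolding cls_def opring_simps by blast
qed

text \<open>Cosets are the fibers of evaluation at \<open>g\<close>, so computations in the quotient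
  reduce to comparing values at \<open>g\<close>.\<close>

lemma cls_altdef:
  assumes b: "b \<in> coefs n"
  shows "cls (op n b) = {op m c | m c. c \<in> coefs m \<and> act m c g = act n b g}"
proof (intro equalityI subsetI)
  fix T assume "T \<in> cls (op n b)"
  then obtain i where i: "i \<in> I" "T = (\<lambda>u. i u + op n b u)"
    unfolding cls_coset by blast
  then obtain m c where c: "c \<in> coefs m" "i = op m c"
    by (auto simp: I_altdef)
  define L where "L = max m n"
  have "T = op L (\<lambda>k. c k + b k)"
    using op_extend[OF c(1), of L] op_extend[OF b, of L] i c(2) op_add[of L c b] by (simp add: L_def)
  moreover have "(\<lambda>k. c k + b k) \<in> coefs L"
    using coefs_mono[OF c(1), of L] coefs_mono[OF b, of L] by (intro coefs_add) (auto simp: L_def)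
  moreover have "act L (\<lambda>k. c k + b k) g = act n b g"
    using act_extend[OF c(1), of L] act_extend[OF b, of L] i c act_eq_0_iff[OF c(1)]
    by (simp add: L_def act_add)
  ultimately show "T \<in> {op m c | m c. c \<in> coefs m \<and> act m c g = act n b g}" by blast
next
  fix T assume "T \<in> {op m c | m c. c \<in> coefs m \<and> act m c g = act n b g}"
  then obtain m c where c: "c \<in> coefs m" "act m c g = act n b g" "T = op m c" by blast
  define L where "L = max m n"
  have cL: "c \<in> coefs L" and bL: "b \<in> coefs L"
    using coefs_mono[OF c(1), of L] coefs_mono[OF b, of L] by (auto simp: L_def)
  have "act L (\<lambda>k. c k - b k) g = 0"
    using act_extend[OF c(1), of L] act_extend[OF b, of L] c by (simp add: L_def act_diff)
  then have "op L (\<lambda>k. c k - b k) \<in> I" using act_eq_0_iff[OF coefs_diff[OF cL bL]] by simp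
  moreover have "T = (\<lambda>u. op L (\<lambda>k. c k - b k) u + op n b u)"
    using op_extend[OF c(1), of L] op_extend[OF b, of L] c op_add[of L "\<lambda>k. c k - b k" b]
    by (simp add: L_def)
  ultimately show "T \<in> cls (op n b)" unfolding cls_coset by blast
qed

lemma cls_self:
  assumes "b \<in> coefs n"
  shows "op n b \<in> cls (op n b)"
  unfolding cls_altdef[OF assms] using assms by (intro CollectI exI[of _ n] exI[of _ b]) simp

lemma quotient_carrier: "carrier (left_quotient opring Pop) = {cls (op n b) | n b. b \<in> coefs n}"
proof -
  have "carrier (left_quotient opring Pop) = (\<Union>T\<in>carrier opring. {cls T})"
    by (simp add: left_quotient_def A_RCOSETS_def RCOSETS_def cls_def a_r_coset_def)
  then show ?thesis unfolding opring_simps by blast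
qed

lemma quotient_add_set:
  "A \<oplus>\<^bsub>left_quotient opring Pop\<^esub> B = {\<lambda>u. a u + b u | a b. a \<in> A \<and> b \<in> B}"
proof -
  have "A \<oplus>\<^bsub>left_quotient opring Pop\<^esub> B = (\<Union>a\<in>A. \<Union>b\<in>B. {a \<oplus>\<^bsub>opring\<^esub> b})"
    by (simp add: left_quotient_def set_add_def set_mult_def)
  then show ?thesis unfolding opring_simps by blast
qed

lemma quotient_add:
  assumes b: "b \<in> coefs n" and c: "c \<in> coefs n"
  shows "cls (op n b) \<oplus>\<^bsub>left_quotient opring Pop\<^esub> cls (op n c) = cls (op n (\<lambda>k. b k + c k))"
proof (intro equalityI subsetI)
  fix T assume "T \<in> cls (op n b) \<oplus>\<^bsub>left_quotient opring Pop\<^esub> cls (op n c)"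
  then obtain A B where AB: "A \<in> cls (op n b)" "B \<in> cls (op n c)" "T = (\<lambda>u. A u + B u)"
    unfolding quotient_add_set by blast
  obtain m b' where b': "b' \<in> coefs m" "A = op m b'" "act m b' g = act n b g"
    using AB(1) by (auto simp: cls_altdef[OF b])
  obtain l c' where c': "c' \<in> coefs l" "B = op l c'" "act l c' g = act n c g"
    using AB(2) by (auto simp: cls_altdef[OF c])
  define L where "L = max l m"
  have "T = op L (\<lambda>k. b' k + c' k)"
    using op_extend[OF b'(1), of L] op_extend[OF c'(1), of L] AB b' c' op_add[of L b' c']
    by (simp add: L_def)
  moreover have "(\<lambda>k. b' k + c' k) \<in> coefs L"
    using coefs_mono[OF b'(1), of L] coefs_mono[OF c'(1), of L]
    by (intro coefs_add) (auto simp: L_def)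
  moreover have "act L (\<lambda>k. b' k + c' k) g = act n (\<lambda>k. b k + c k) g"
    using act_extend[OF b'(1), of L] act_extend[OF c'(1), of L] b' c' by (simp add: L_def act_add)
  ultimately show "T \<in> cls (op n (\<lambda>k. b k + c k))"
    unfolding cls_altdef[OF coefs_add[OF b c]] by blast
next
  fix T assume "T \<in> cls (op n (\<lambda>k. b k + c k))"
  then obtain m d where d: "d \<in> coefs m" "T = op m d" "act m d g = act n b g + act n c g"
    by (auto simp: cls_altdef[OF coefs_add[OF b c]] act_add)
  define L where "L = max n m"
  have dL: "d \<in> coefs L" and cL: "c \<in> coefs L"
    using coefs_mono[OF d(1), of L] coefs_mono[OF c, of L] by (auto simp: L_def)
  \<comment> \<open>Splits d as (d - c) + c, with \<open>c\<close> serving as the representative of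
    the second class.\<close>
  have "act L (\<lambda>k. d k - c k) g = act n b g"
    using act_extend[OF d(1), of L] act_extend[OF c, of L] d by (simp add: L_def act_diff)
  then have "op L (\<lambda>k. d k - c k) \<in> cls (op n b)"
    unfolding cls_altdef[OF b] using coefs_diff[OF dL cL] by blast
  moreover have "T = (\<lambda>u. op L (\<lambda>k. d k - c k) u + op n c u)"
    using op_extend[OF d(1), of L] op_extend[OF c, of L] d op_add[of L "\<lambda>k. d k - c k" c]
    by (simp add: L_def)
  ultimately show "T \<in> cls (op n b) \<oplus>\<^bsub>left_quotient opring Pop\<^esub> cls (op n c)"
    unfolding quotient_add_set using cls_self[OF c] by blast
qed

text \<open>The scalar multiple in \<open>left_quotient\<close> is a union over all representatives;
  each of them contributes the same coset, because the value at \<open>g\<close> determines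
  it.\<close>

lemma quotient_smult:
  assumes t: "t \<in> coefs m" and b: "b \<in> coefs n"
  shows "op m t \<odot>\<^bsub>left_quotient opring Pop\<^esub> cls (op n b) = cls (op (m + n) (comp m t b))"
proof -
  have "cls (op m t \<circ> Q) = cls (op (m + n) (comp m t b))" if "Q \<in> cls (op n b)" for Q
  proof -
    obtain l c where c: "c \<in> coefs l" "Q = op l c" "act l c g = act n b g"
      using \<open>Q \<in> cls (op n b)\<close> by (auto simp: cls_altdef[OF b])
    have "act (m + l) (comp m t c) g = act (m + n) (comp m t b) g"
      using act_comp[OF t c(1) g_in] act_comp[OF t b g_in] c(3) by simp
    then show ?thesis
      using c(2) op_comp[OF t c(1)] cls_altdef[OF comp_coefs[OF t c(1)]]
        cls_altdef[OF comp_coefs[OF t b]] by simp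
  qed
  then have "(\<Union>Q\<in>cls (op n b). cls (op m t \<circ> Q)) = cls (op (m + n) (comp m t b))"
    using cls_self[OF b] by auto
  moreover have "op m t \<odot>\<^bsub>left_quotient opring Pop\<^esub> cls (op n b) =
      (\<Union>Q\<in>cls (op n b). cls (op m t \<otimes>\<^bsub>opring\<^esub> Q))"
    by (simp add: left_quotient_def cls_def)
  ultimately show ?thesis by (simp add: opring_simps)
qed

text \<open>The map is evaluation at \<open>g\<close>: injective because cosets are its fibers, onto
  because \<open>g\<close> generates, and linear over the operators by
  \<open>act_comp\<close>.\<close>

theorem cyclic_quotient_iso:
  "\<exists>F. bij_betw F (carrier (left_quotient opring Pop)) M \<and>
     (\<forall>A \<in> carrier (left_quotient opring Pop). \<forall>B \<in> carrier (left_quotient opring Pop).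
        F (A \<oplus>\<^bsub>left_quotient opring Pop\<^esub> B) = F A + F B) \<and>
     (\<forall>m t. t \<in> coefs m \<longrightarrow> (\<forall>A \<in> carrier (left_quotient opring Pop).
        F (op m t \<odot>\<^bsub>left_quotient opring Pop\<^esub> A) = act m t (F A)))"
proof -
  define F where "F A = (THE v. \<exists>n b. b \<in> coefs n \<and> A = cls (op n b) \<and> v = act n b g)" for A
  have F: "F (cls (op n b)) = act n b g" if b: "b \<in> coefs n" for n b
    unfolding F_def
  proof (rule the_equality)
    fix v assume "\<exists>n' b'. b' \<in> coefs n' \<and> cls (op n b) = cls (op n' b') \<and> v = act n' b' g"
    then obtain n' b' where b': "b' \<in> coefs n'" "cls (op n b) = cls (op n' b')" "v = act n' b' g"
      by blast
    then have "op n b \<in> cls (op n' b')" using cls_self[OF b] by simp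
    then show "v = act n b g"
      using b' op_eq_imp_act_eq[OF b] by (auto simp: cls_altdef[OF b'(1)])
  qed (use b in blast)
  have "bij_betw F (carrier (left_quotient opring Pop)) M"
    unfolding bij_betw_def
  proof
    show "inj_on F (carrier (left_quotient opring Pop))"
    proof (rule inj_onI)
      fix A B assume "A \<in> carrier (left_quotient opring Pop)"
        "B \<in> carrier (left_quotient opring Pop)" and eq: "F A = F B"
      then obtain n b m c where b: "b \<in> coefs n" "A = cls (op n b)"
        and c: "c \<in> coefs m" "B = cls (op m c)" unfolding quotient_carrier by blast
      have "act n b g = act m c g" using eq F[OF b(1)] F[OF c(1)] b(2) c(2) by simp
      then show "A = B" unfolding b(2) c(2) cls_altdef[OF b(1)] cls_altdef[OF c(1)] by simp
    qed
    show "F ` carrier (left_quotient opring Pop) = M"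
    proof (intro equalityI subsetI)
      fix v assume "v \<in> F ` carrier (left_quotient opring Pop)"
      then show "v \<in> M" by (auto simp: quotient_carrier F act_closed g_in)
    next
      fix v assume "v \<in> M"
      then obtain b where "b \<in> coefs r" "v = act r b g" using generates by blast
      then show "v \<in> F ` carrier (left_quotient opring Pop)"
        unfolding quotient_carrier using F[of b r] by (intro image_eqI[of _ _ "cls (op r b)"]) auto
    qed
  qed
  moreover have "F (A \<oplus>\<^bsub>left_quotient opring Pop\<^esub> B) = F A + F B"
    if A: "A \<in> carrier (left_quotient opring Pop)" and B: "B \<in> carrier (left_quotient opring Pop)" for A B
  proof -
    obtain n b where b: "b \<in> coefs n" "A = cls (op n b)" using A by (auto simp: quotient_carrier)
    obtain m c where c: "c \<in> coefs m" "B = cls (op m c)" using B by (auto simp: quotient_carrier)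
    define L where "L = max n m"
    have L: "b \<in> coefs L" "c \<in> coefs L" "A = cls (op L b)" "B = cls (op L c)"
      using coefs_mono[OF b(1), of L] coefs_mono[OF c(1), of L] op_extend[OF b(1), of L]
        op_extend[OF c(1), of L] b c by (auto simp: L_def)
    show ?thesis
      unfolding L(3,4) quotient_add[OF L(1,2)] F[OF L(1)] F[OF L(2)] F[OF coefs_add[OF L(1,2)]]
      by (rule act_add)
  qed
  moreover have "F (op m t \<odot>\<^bsub>left_quotient opring Pop\<^esub> A) = act m t (F A)"
    if t: "t \<in> coefs m" and A: "A \<in> carrier (left_quotient opring Pop)" for m t A
  proof -
    obtain n b where b: "b \<in> coefs n" "A = cls (op n b)" using A by (auto simp: quotient_carrier)
    then show ?thesis
      using quotient_smult[OF t b(1)] F[OF comp_coefs[OF t b(1)]] F[OF b(1)]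
        act_comp[OF t b(1) g_in] by simp
  qed
  ultimately show ?thesis by blast
qed

end

section \<open>Coordinates and holomorphic functions\<close>

lemma det_two:
  assumes A: "A \<in> carrier_mat 2 2"
  shows "Determinant.det A = A $$ (0, 0) * A $$ (1, 1) - A $$ (0, 1) * A $$ (1, 0)"
proof -
  have "Determinant.det A = (\<Sum>j<2. A $$ (0, j) * cofactor A 0 j)"
    by (rule laplace_expansion_row[OF A, symmetric, of 0, symmetric]) simp
  moreover have "cofactor A 0 0 = A $$ (1, 1)" "cofactor A 0 1 = - A $$ (1, 0)"
    using A by (simp_all add: cofactor_def det_single mat_delete_def)
  ultimately show ?thesis by (simp add: numeral_2_eq_2)
qed

locale projective_structure =
  fixes X :: "'a topology" and \<A> :: "('a set \<times> ('a \<Rightarrow> complex)) set" and S :: "('a, 'i) coord_system"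
  assumes psys: "projective_coord_system X \<A> S"
begin

text \<open>The denominator c x_\<beta> + d of the Moebius transformation, equal to \<xi> up to
  sign.\<close>

definition cz :: "'i \<Rightarrow> 'i \<Rightarrow> 'a \<Rightarrow> complex" where
  "cz \<alpha> \<beta> p = Moebius S \<alpha> \<beta> $$ (1, 0) * Coord S \<beta> p + Moebius S \<alpha> \<beta> $$ (1, 1)"

lemma chart: "\<alpha> \<in> Idx S \<Longrightarrow> complex_chart X (Nbhd S \<alpha>) (Coord S \<alpha>)"
  using psys by (auto simp: projective_coord_system_def)

lemma openin_Nbhd: "\<alpha> \<in> Idx S \<Longrightarrow> openin X (Nbhd S \<alpha>)"
  using chart by (auto simp: complex_chart_def)

lemma inj_Coord: "\<alpha> \<in> Idx S \<Longrightarrow> inj_on (Coord S \<alpha>) (Nbhd S \<alpha>)"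
proof -
  assume "\<alpha> \<in> Idx S"
  then have "homeomorphic_map (subtopology X (Nbhd S \<alpha>)) (top_of_set (Coord S \<alpha> ` Nbhd S \<alpha>)) (Coord S \<alpha>)"
    and N: "Nbhd S \<alpha> \<subseteq> topspace X"
    using chart[of \<alpha>] openin_subset[OF openin_Nbhd[of \<alpha>]] by (auto simp: complex_chart_def)
  from homeomorphic_imp_injective_map[OF this(1)] N show ?thesis
    by (simp add: topspace_subtopology Int_absorb1)
qed

lemma pt_Coord: "\<alpha> \<in> Idx S \<Longrightarrow> p \<in> Nbhd S \<alpha> \<Longrightarrow> pt S \<alpha> (Coord S \<alpha> p) = p"
  unfolding pt_def by (rule inv_into_f_f[OF inj_Coord])

lemma Coord_pt: "x \<in> Coord S \<alpha> ` Nbhd S \<alpha> \<Longrightarrow> Coord S \<alpha> (pt S \<alpha> x) = x"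
  unfolding pt_def by (rule f_inv_into_f)

lemma pt_in: "x \<in> Coord S \<alpha> ` Nbhd S \<alpha> \<Longrightarrow> pt S \<alpha> x \<in> Nbhd S \<alpha>"
  unfolding pt_def by (rule inv_into_into)

lemma open_Coord_image:
  assumes "\<alpha> \<in> Idx S" "openin X W"
  shows "open (Coord S \<alpha> ` (W \<inter> Nbhd S \<alpha>))"
proof -
  have hm: "homeomorphic_map (subtopology X (Nbhd S \<alpha>)) (top_of_set (Coord S \<alpha> ` Nbhd S \<alpha>)) (Coord S \<alpha>)"
    and o: "open (Coord S \<alpha> ` Nbhd S \<alpha>)"
    using chart[OF assms(1)] by (auto simp: complex_chart_def)
  have "openin (subtopology X (Nbhd S \<alpha>)) (W \<inter> Nbhd S \<alpha>)"
    using assms(2) by (auto simp: openin_subtopology)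
  then have "openin (top_of_set (Coord S \<alpha> ` Nbhd S \<alpha>)) (Coord S \<alpha> ` (W \<inter> Nbhd S \<alpha>))"
    using homeomorphic_imp_open_map[OF hm] by (auto simp: open_map_def)
  then show ?thesis using o openin_open_trans by blast
qed

lemma open_Coord_Nbhd: "\<alpha> \<in> Idx S \<Longrightarrow> open (Coord S \<alpha> ` Nbhd S \<alpha>)"
  using chart by (auto simp: complex_chart_def)

lemma moebius_det:
  assumes "\<alpha> \<in> Idx S" "\<beta> \<in> Idx S"
  shows "Moebius S \<alpha> \<beta> $$ (0, 0) * Moebius S \<alpha> \<beta> $$ (1, 1)
       - Moebius S \<alpha> \<beta> $$ (0, 1) * Moebius S \<alpha> \<beta> $$ (1, 0) = 1"
proof -
  have "Moebius S \<alpha> \<beta> \<in> carrier_mat 2 2" "Determinant.det (Moebius S \<alpha> \<beta>) = 1"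
    using psys assms by (auto simp: projective_coord_system_def)
  then show ?thesis using det_two[of "Moebius S \<alpha> \<beta>"] by simp
qed

lemma moebius_eq:
  assumes "\<alpha> \<in> Idx S" "\<beta> \<in> Idx S" "p \<in> Nbhd S \<alpha>" "p \<in> Nbhd S \<beta>"
  shows "cz \<alpha> \<beta> p \<noteq> 0"
    and "Coord S \<alpha> p = (Moebius S \<alpha> \<beta> $$ (0, 0) * Coord S \<beta> p + Moebius S \<alpha> \<beta> $$ (0, 1)) / cz \<alpha> \<beta> p"
proof -
  have "\<forall>p \<in> Nbhd S \<alpha> \<inter> Nbhd S \<beta>. cz \<alpha> \<beta> p \<noteq> 0 \<and> Coord S \<alpha> p =
      (Moebius S \<alpha> \<beta> $$ (0, 0) * Coord S \<beta> p + Moebius S \<alpha> \<beta> $$ (0, 1)) / cz \<alpha> \<beta> p"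
    using psys assms(1,2) unfolding projective_coord_system_def cz_def by blast
  with assms show "cz \<alpha> \<beta> p \<noteq> 0"
    and "Coord S \<alpha> p = (Moebius S \<alpha> \<beta> $$ (0, 0) * Coord S \<beta> p + Moebius S \<alpha> \<beta> $$ (0, 1)) / cz \<alpha> \<beta> p"
    by blast+
qed

text \<open>The numerator left by the quotient rule is the determinant a d - b c = 1.\<close>

lemma transition_deriv:
  assumes "\<alpha> \<in> Idx S" "\<beta> \<in> Idx S" "p \<in> Nbhd S \<alpha>" "p \<in> Nbhd S \<beta>"
  shows "((Coord S \<alpha> \<circ> pt S \<beta>) has_field_derivative 1 / (cz \<alpha> \<beta> p)\<^sup>2) (at (Coord S \<beta> p))"
proof -
  let ?a = "Moebius S \<alpha> \<beta> $$ (0, 0)" and ?b = "Moebius S \<alpha> \<beta> $$ (0, 1)"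
  let ?c = "Moebius S \<alpha> \<beta> $$ (1, 0)" and ?d = "Moebius S \<alpha> \<beta> $$ (1, 1)"
  let ?x = "Coord S \<beta> p"
  have nz: "?c * ?x + ?d \<noteq> 0" using moebius_eq(1)[OF assms] by (simp add: cz_def)
  have "((\<lambda>x. (?a * x + ?b) / (?c * x + ?d)) has_field_derivative
      (?a * (?c * ?x + ?d) - (?a * ?x + ?b) * ?c) / ((?c * ?x + ?d) * (?c * ?x + ?d))) (at ?x)"
    using nz by (auto intro!: derivative_eq_intros)
  moreover have "?a * (?c * ?x + ?d) - (?a * ?x + ?b) * ?c = 1"
    using moebius_det[OF assms(1,2)] by (simp add: algebra_simps)
  ultimately have "((\<lambda>x. (?a * x + ?b) / (?c * x + ?d)) has_field_derivative
      1 / (cz \<alpha> \<beta> p)\<^sup>2) (at ?x)" by (simp add: cz_def power2_eq_square)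
  moreover have "open (Coord S \<beta> ` (Nbhd S \<alpha> \<inter> Nbhd S \<beta>))"
    using open_Coord_image[OF assms(2) openin_Nbhd[OF assms(1)]] .
  moreover have "?x \<in> Coord S \<beta> ` (Nbhd S \<alpha> \<inter> Nbhd S \<beta>)" using assms by auto
  moreover have "(?a * x + ?b) / (?c * x + ?d) = (Coord S \<alpha> \<circ> pt S \<beta>) x"
    if "x \<in> Coord S \<beta> ` (Nbhd S \<alpha> \<inter> Nbhd S \<beta>)" for x
    using that moebius_eq(2)[OF assms(1,2)] pt_Coord[OF assms(2)] by (auto simp: cz_def)
  ultimately show ?thesis by (rule has_field_derivative_transform_within_open)
qed

lemma dcoord_eq:
  assumes "\<alpha> \<in> Idx S" "\<beta> \<in> Idx S" "p \<in> Nbhd S \<alpha>" "p \<in> Nbhd S \<beta>"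
  shows "dcoord S \<alpha> \<beta> p = 1 / (cz \<alpha> \<beta> p)\<^sup>2"
  using DERIV_imp_deriv[OF transition_deriv[OF assms]] assms by (simp add: dcoord_def ddx_def)

lemma dcoord_nonzero:
  assumes "\<alpha> \<in> Idx S" "\<beta> \<in> Idx S" "p \<in> Nbhd S \<alpha>" "p \<in> Nbhd S \<beta>"
  shows "dcoord S \<alpha> \<beta> p \<noteq> 0"
  using dcoord_eq[OF assms] moebius_eq(1)[OF assms] by simp

text \<open>Quantifying over all charts at p makes the notion free of a chosen chart;
  \<open>diffable_one_chart\<close> recovers the test in a single one.\<close>

definition diffable :: "('a \<Rightarrow> complex) \<Rightarrow> 'a \<Rightarrow> bool" where
  "diffable f p \<longleftrightarrow> (\<forall>\<alpha>\<in>Idx S. p \<in> Nbhd S \<alpha> \<longrightarrow> (f \<circ> pt S \<alpha>) field_differentiable at (Coord S \<alpha> p))"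

lemma diffable_has_ddx:
  assumes "diffable f p" "\<alpha> \<in> Idx S" "p \<in> Nbhd S \<alpha>"
  shows "((f \<circ> pt S \<alpha>) has_field_derivative ddx S \<alpha> f p) (at (Coord S \<alpha> p))"
  using assms by (simp add: diffable_def ddx_def field_differentiable_derivI)

text \<open>The chain rule through the Moebius transition, applied on the overlap, which is an open
  neighborhood of p.\<close>

lemma change_chart:
  assumes ab: "\<alpha> \<in> Idx S" "\<beta> \<in> Idx S" "p \<in> Nbhd S \<alpha>" "p \<in> Nbhd S \<beta>"
    and f: "((f \<circ> pt S \<beta>) has_field_derivative D) (at (Coord S \<beta> p))"
  shows "((f \<circ> pt S \<alpha>) has_field_derivative D * dcoord S \<beta> \<alpha> p) (at (Coord S \<alpha> p))"
proof -
  have "((Coord S \<beta> \<circ> pt S \<alpha>) has_field_derivative dcoord S \<beta> \<alpha> p) (at (Coord S \<alpha> p))"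
    using transition_deriv[of \<beta> \<alpha>] dcoord_eq[of \<beta> \<alpha>] ab by simp
  moreover have "(Coord S \<beta> \<circ> pt S \<alpha>) (Coord S \<alpha> p) = Coord S \<beta> p" using pt_Coord ab by simp
  ultimately have "(((f \<circ> pt S \<beta>) \<circ> (Coord S \<beta> \<circ> pt S \<alpha>)) has_field_derivative D * dcoord S \<beta> \<alpha> p)
      (at (Coord S \<alpha> p))" using f DERIV_chain by metis
  moreover have "open (Coord S \<alpha> ` (Nbhd S \<beta> \<inter> Nbhd S \<alpha>))"
    using open_Coord_image[OF ab(1) openin_Nbhd[OF ab(2)]] .
  moreover have "Coord S \<alpha> p \<in> Coord S \<alpha> ` (Nbhd S \<beta> \<inter> Nbhd S \<alpha>)" using ab by auto
  moreover have "((f \<circ> pt S \<beta>) \<circ> (Coord S \<beta> \<circ> pt S \<alpha>)) x = (f \<circ> pt S \<alpha>) x"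
    if "x \<in> Coord S \<alpha> ` (Nbhd S \<beta> \<inter> Nbhd S \<alpha>)" for x
    using that pt_Coord ab by auto
  ultimately show ?thesis by (rule has_field_derivative_transform_within_open)
qed

lemma diffable_one_chart:
  assumes "\<beta> \<in> Idx S" "p \<in> Nbhd S \<beta>" "(f \<circ> pt S \<beta>) field_differentiable at (Coord S \<beta> p)"
  shows "diffable f p"
  using assms change_chart unfolding diffable_def field_differentiable_def by blast

lemma ddx_eqI:
  assumes "\<alpha> \<in> Idx S" "p \<in> Nbhd S \<alpha>" "((f \<circ> pt S \<alpha>) has_field_derivative D) (at (Coord S \<alpha> p))"
  shows "ddx S \<alpha> f p = D"
  using DERIV_imp_deriv[OF assms(3)] assms by (simp add: ddx_def)

lemma ddx_change_chart:
  assumes "\<alpha> \<in> Idx S" "\<beta> \<in> Idx S" "p \<in> Nbhd S \<alpha>" "p \<in> Nbhd S \<beta>" "diffable f p"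
  shows "ddx S \<alpha> f p = ddx S \<beta> f p * dcoord S \<beta> \<alpha> p"
  by (rule ddx_eqI[OF assms(1,3) change_chart[OF assms(1-4) diffable_has_ddx[OF assms(5,2,4)]]])

lemma diffable_Coord:
  assumes "\<alpha> \<in> Idx S" "p \<in> Nbhd S \<alpha>"
  shows "diffable (Coord S \<alpha>) p"
  using transition_deriv[OF assms(1) _ assms(2)] unfolding diffable_def field_differentiable_def by blast

lemma dcoord_cocycle:
  assumes "\<alpha> \<in> Idx S" "\<beta> \<in> Idx S" "\<gamma> \<in> Idx S" "p \<in> Nbhd S \<alpha>" "p \<in> Nbhd S \<beta>" "p \<in> Nbhd S \<gamma>"
  shows "dcoord S \<alpha> \<gamma> p = dcoord S \<alpha> \<beta> p * dcoord S \<beta> \<gamma> p"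
  using ddx_change_chart[of \<gamma> \<beta> p "Coord S \<alpha>"] diffable_Coord assms
  by (simp add: dcoord_def[of S \<alpha>])

lemma dcoord_self:
  assumes "\<alpha> \<in> Idx S" "p \<in> Nbhd S \<alpha>"
  shows "dcoord S \<alpha> \<alpha> p = 1"
  using dcoord_cocycle[of \<alpha> \<alpha> \<alpha> p] dcoord_nonzero[of \<alpha> \<alpha> p] assms by simp

lemma dcoord_inverse:
  assumes "\<alpha> \<in> Idx S" "\<beta> \<in> Idx S" "p \<in> Nbhd S \<alpha>" "p \<in> Nbhd S \<beta>"
  shows "dcoord S \<alpha> \<beta> p * dcoord S \<beta> \<alpha> p = 1"
  using dcoord_cocycle[of \<alpha> \<beta> \<alpha> p] dcoord_self assms by simp

lemma eq_near_chart:
  assumes "\<alpha> \<in> Idx S" "openin X W" "p \<in> W" "p \<in> Nbhd S \<alpha>" "\<And>q. q \<in> W \<Longrightarrow> f q = g q"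
    and "((f \<circ> pt S \<alpha>) has_field_derivative D) (at (Coord S \<alpha> p))"
  shows "((g \<circ> pt S \<alpha>) has_field_derivative D) (at (Coord S \<alpha> p))"
proof (rule has_field_derivative_transform_within_open[OF assms(6) open_Coord_image[OF assms(1,2)]])
  show "Coord S \<alpha> p \<in> Coord S \<alpha> ` (W \<inter> Nbhd S \<alpha>)" using assms by auto
  fix x assume "x \<in> Coord S \<alpha> ` (W \<inter> Nbhd S \<alpha>)"
  then show "(f \<circ> pt S \<alpha>) x = (g \<circ> pt S \<alpha>) x" using assms(5) pt_Coord[OF assms(1)] by auto
qed

lemma diffable_cong:
  assumes "openin X W" "p \<in> W" "\<And>q. q \<in> W \<Longrightarrow> f q = g q" "diffable f p"
  shows "diffable g p"
  unfolding diffable_def field_differentiable_def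
proof (intro ballI impI)
  fix \<alpha> assume \<alpha>: "\<alpha> \<in> Idx S" "p \<in> Nbhd S \<alpha>"
  show "\<exists>D. ((g \<circ> pt S \<alpha>) has_field_derivative D) (at (Coord S \<alpha> p))"
    using eq_near_chart[OF \<alpha>(1) assms(1,2) \<alpha>(2) assms(3) diffable_has_ddx[OF assms(4) \<alpha>]] by blast
qed

lemma ddx_cong:
  assumes "\<alpha> \<in> Idx S" "openin X W" "p \<in> W" "\<And>q. q \<in> W \<Longrightarrow> f q = g q" "diffable f p"
  shows "ddx S \<alpha> g p = ddx S \<alpha> f p"
proof (cases "p \<in> Nbhd S \<alpha>")
  case True
  show ?thesis
    by (rule ddx_eqI[OF assms(1) True eq_near_chart[OF assms(1-3) True assms(4)
          diffable_has_ddx[OF assms(5,1) True]]])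
qed (simp add: ddx_def)

lemma diffable_const: "diffable (\<lambda>q. c) p"
  by (simp add: diffable_def comp_def)

lemma diffable_add: "diffable f p \<Longrightarrow> diffable g p \<Longrightarrow> diffable (\<lambda>q. f q + g q) p"
  by (simp add: diffable_def comp_def field_differentiable_add)

lemma diffable_mult: "diffable f p \<Longrightarrow> diffable g p \<Longrightarrow> diffable (\<lambda>q. f q * g q) p"
  by (simp add: diffable_def comp_def field_differentiable_mult)

lemma diffable_sum: "(\<And>i. i \<in> A \<Longrightarrow> diffable (f i) p) \<Longrightarrow> diffable (\<lambda>q. \<Sum>i\<in>A. f i q) p"
  by (induction A rule: infinite_finite_induct) (auto intro: diffable_const diffable_add)

lemma diffable_power: "diffable f p \<Longrightarrow> diffable (\<lambda>q. f q ^ n) p"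
  by (induction n) (auto intro: diffable_const diffable_mult)

lemma ddx_add:
  assumes "\<alpha> \<in> Idx S" "p \<in> Nbhd S \<alpha>" "diffable f p" "diffable g p"
  shows "ddx S \<alpha> (\<lambda>q. f q + g q) p = ddx S \<alpha> f p + ddx S \<alpha> g p"
  using DERIV_add[OF diffable_has_ddx[OF assms(3,1,2)] diffable_has_ddx[OF assms(4,1,2)]]
  by (intro ddx_eqI[OF assms(1,2)]) (simp add: comp_def)

lemma ddx_mult:
  assumes "\<alpha> \<in> Idx S" "p \<in> Nbhd S \<alpha>" "diffable f p" "diffable g p"
  shows "ddx S \<alpha> (\<lambda>q. f q * g q) p = ddx S \<alpha> f p * g p + f p * ddx S \<alpha> g p"
  using DERIV_mult[OF diffable_has_ddx[OF assms(3,1,2)] diffable_has_ddx[OF assms(4,1,2)]]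
  by (intro ddx_eqI[OF assms(1,2)]) (simp add: comp_def pt_Coord[OF assms(1,2)] algebra_simps)

lemma ddx_const: "\<alpha> \<in> Idx S \<Longrightarrow> ddx S \<alpha> (\<lambda>q. c) p = 0"
  by (simp add: ddx_def comp_def)

lemma ddx_sum:
  assumes "\<alpha> \<in> Idx S" "p \<in> Nbhd S \<alpha>" "\<And>i. i \<in> A \<Longrightarrow> diffable (f i) p"
  shows "ddx S \<alpha> (\<lambda>q. \<Sum>i\<in>A. f i q) p = (\<Sum>i\<in>A. ddx S \<alpha> (f i) p)"
  using assms(3)
proof (induction A rule: infinite_finite_induct)
  case (insert i A)
  then show ?case using ddx_add[OF assms(1,2), of "f i" "\<lambda>q. \<Sum>i\<in>A. f i q"] diffable_sum[of A f p]
    by simp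
qed (auto simp: ddx_const assms(1))

text \<open>Differentiability on an open set is assumed, because the derivative is differentiable by
  holomorphy and not by differentiability at one point.\<close>

lemma diffable_ddx:
  assumes "\<alpha> \<in> Idx S" "openin X W" "W \<subseteq> Nbhd S \<alpha>" "\<And>q. q \<in> W \<Longrightarrow> diffable f q" "p \<in> W"
  shows "diffable (ddx S \<alpha> f) p"
proof (rule diffable_one_chart[OF assms(1)])
  show "p \<in> Nbhd S \<alpha>" using assms by auto
  let ?V = "Coord S \<alpha> ` (W \<inter> Nbhd S \<alpha>)"
  have V: "open ?V" by (rule open_Coord_image[OF assms(1,2)])
  have "(f \<circ> pt S \<alpha>) holomorphic_on ?V"
    unfolding holomorphic_on_open[OF V]
    using assms diffable_has_ddx by fastforce
  then have "deriv (f \<circ> pt S \<alpha>) holomorphic_on ?V" by (rule holomorphic_deriv[OF _ V])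
  then have "deriv (f \<circ> pt S \<alpha>) field_differentiable at (Coord S \<alpha> p)"
    using V assms(3,5) by (auto intro!: holomorphic_on_imp_differentiable_at)
  then obtain D where "(deriv (f \<circ> pt S \<alpha>) has_field_derivative D) (at (Coord S \<alpha> p))"
    by (auto simp: field_differentiable_def)
  then have "((ddx S \<alpha> f \<circ> pt S \<alpha>) has_field_derivative D) (at (Coord S \<alpha> p))"
    by (rule has_field_derivative_transform_within_open[OF _ V])
       (use assms in \<open>auto simp: ddx_def pt_Coord\<close>)
  then show "(ddx S \<alpha> f \<circ> pt S \<alpha>) field_differentiable at (Coord S \<alpha> p)"
    by (auto simp: field_differentiable_def)
qed

text \<open>Trades holomorphy in every chart for differentiability at each point, a form in which
  closure under sums and products is immediate.\<close>

lemma holfun_iff: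
  assumes "openin X W"
  shows "f \<in> holfun S W \<longleftrightarrow> (\<forall>p. p \<notin> W \<longrightarrow> f p = 0) \<and> (\<forall>p\<in>W. diffable f p)"
proof -
  have "(f \<circ> pt S \<alpha>) holomorphic_on (Coord S \<alpha> ` (W \<inter> Nbhd S \<alpha>)) \<longleftrightarrow>
      (\<forall>p\<in>W \<inter> Nbhd S \<alpha>. (f \<circ> pt S \<alpha>) field_differentiable at (Coord S \<alpha> p))"
    if "\<alpha> \<in> Idx S" for \<alpha>
    using holomorphic_on_open[OF open_Coord_image[OF that assms]]
    by (auto simp: field_differentiable_def)
  then show ?thesis by (auto simp: holfun_def diffable_def)
qed

lemma holfun_diffable: "openin X W \<Longrightarrow> f \<in> holfun S W \<Longrightarrow> p \<in> W \<Longrightarrow> diffable f p"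
  by (simp add: holfun_iff)

lemma holfun_outside: "openin X W \<Longrightarrow> f \<in> holfun S W \<Longrightarrow> p \<notin> W \<Longrightarrow> f p = 0"
  by (simp add: holfun_iff)

lemma holfun_add: "openin X W \<Longrightarrow> f \<in> holfun S W \<Longrightarrow> g \<in> holfun S W \<Longrightarrow> (\<lambda>p. f p + g p) \<in> holfun S W"
  by (simp add: holfun_iff diffable_add)

lemma holfun_mult: "openin X W \<Longrightarrow> f \<in> holfun S W \<Longrightarrow> g \<in> holfun S W \<Longrightarrow> (\<lambda>p. f p * g p) \<in> holfun S W"
  by (simp add: holfun_iff diffable_mult)

text \<open>Cutting off outside an open set changes no germ inside it. This brings constants and
  matrix entries into the extended-by-zero form of \<open>holfun\<close>.\<close>

lemma holfun_indicator:
  assumes W: "openin X W" and f: "\<And>p. p \<in> W \<Longrightarrow> diffable f p"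
  shows "(\<lambda>p. if p \<in> W then f p else 0) \<in> holfun S W"
  using diffable_cong[OF W, of _ f "\<lambda>p. if p \<in> W then f p else 0"] f by (auto simp: holfun_iff[OF W])

lemma holfun_zero: "openin X W \<Longrightarrow> (\<lambda>p. 0) \<in> holfun S W"
  by (simp add: holfun_iff diffable_const)

lemma holfun_ddx:
  assumes "\<alpha> \<in> Idx S" "f \<in> holfun S (Nbhd S \<alpha>)"
  shows "ddx S \<alpha> f \<in> holfun S (Nbhd S \<alpha>)"
  using assms diffable_ddx[OF assms(1) openin_Nbhd[OF assms(1)]]
  by (simp add: holfun_iff[OF openin_Nbhd[OF assms(1)]] ddx_def)

section \<open>Polynomials in hbar over holomorphic functions\<close>

lemma hbar_monom: "openin X W \<Longrightarrow> f \<in> holfun S W \<Longrightarrow> (\<lambda>p h. f p * h ^ n) \<in> holfun_hbar S W"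
  unfolding holfun_hbar_def
  by (intro CollectI exI[of _ n] exI[of _ "\<lambda>k. if k = n then f else (\<lambda>p. 0)"])
     (auto simp: holfun_zero if_distrib[of "\<lambda>f. f _"] if_distrib[of "\<lambda>x. x * _"] cong: if_cong)

lemma hbar_of_holfun: "openin X W \<Longrightarrow> f \<in> holfun S W \<Longrightarrow> (\<lambda>p h. f p) \<in> holfun_hbar S W"
  using hbar_monom[of W f 0] by simp

lemma hbar_add:
  assumes W: "openin X W" and "u \<in> holfun_hbar S W" "v \<in> holfun_hbar S W"
  shows "(\<lambda>p h. u p h + v p h) \<in> holfun_hbar S W"
proof -
  obtain n c where c: "\<forall>k\<le>n. c k \<in> holfun S W" "u = (\<lambda>p h. \<Sum>k\<le>n. c k p * h ^ k)"
    using assms(2) by (auto simp: holfun_hbar_def)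
  obtain m d where d: "\<forall>k\<le>m. d k \<in> holfun S W" "v = (\<lambda>p h. \<Sum>k\<le>m. d k p * h ^ k)"
    using assms(3) by (auto simp: holfun_hbar_def)
  define c' where "c' k = (if k \<le> n then c k else (\<lambda>p. 0))" for k
  define d' where "d' k = (if k \<le> m then d k else (\<lambda>p. 0))" for k
  have "c' k \<in> holfun S W" "d' k \<in> holfun S W" for k
    using c(1) d(1) holfun_zero[OF W] by (auto simp: c'_def d'_def)
  then have "(\<lambda>p. c' k p + d' k p) \<in> holfun S W" for k by (rule holfun_add[OF W])
  moreover have "u p h = (\<Sum>k\<le>max n m. c' k p * h ^ k)" for p h
    unfolding c(2) by (rule sum.mono_neutral_cong_left) (auto simp: c'_def)
  moreover have "v p h = (\<Sum>k\<le>max n m. d' k p * h ^ k)" for p h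
    unfolding d(2) by (rule sum.mono_neutral_cong_left) (auto simp: d'_def)
  ultimately show ?thesis
    unfolding holfun_hbar_def
    by (intro CollectI exI[of _ "max n m"] exI[of _ "\<lambda>k p. c' k p + d' k p"])
       (simp add: sum.distrib distrib_right)
qed

lemma hbar_zero: "openin X W \<Longrightarrow> (\<lambda>p h. 0) \<in> holfun_hbar S W"
  using hbar_of_holfun holfun_zero by blast

lemma hbar_sum:
  assumes W: "openin X W" and "\<And>i. i \<in> A \<Longrightarrow> f i \<in> holfun_hbar S W"
  shows "(\<lambda>p h. \<Sum>i\<in>A. f i p h) \<in> holfun_hbar S W"
  using assms(2)
  by (induction A rule: infinite_finite_induct) (auto intro: hbar_add[OF W] hbar_zero[OF W])

lemma hbar_mult:
  assumes W: "openin X W" and "u \<in> holfun_hbar S W" "v \<in> holfun_hbar S W"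
  shows "(\<lambda>p h. u p h * v p h) \<in> holfun_hbar S W"
proof -
  obtain n c where c: "\<forall>k\<le>n. c k \<in> holfun S W" "u = (\<lambda>p h. \<Sum>k\<le>n. c k p * h ^ k)"
    using assms(2) by (auto simp: holfun_hbar_def)
  obtain m d where d: "\<forall>k\<le>m. d k \<in> holfun S W" "v = (\<lambda>p h. \<Sum>k\<le>m. d k p * h ^ k)"
    using assms(3) by (auto simp: holfun_hbar_def)
  have "(\<lambda>p h. u p h * v p h) = (\<lambda>p h. \<Sum>i\<le>n. \<Sum>j\<le>m. (c i p * d j p) * h ^ (i + j))"
    by (simp add: c d sum_product power_add mult_ac)
  also have "\<dots> \<in> holfun_hbar S W"
    using c(1) d(1) by (intro hbar_sum[OF W] hbar_monom[OF W] holfun_mult[OF W]) auto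
  finally show ?thesis .
qed

lemma hbar_slice:
  assumes W: "openin X W" and "u \<in> holfun_hbar S W"
  shows "(\<lambda>p. u p h) \<in> holfun S W"
proof -
  obtain n c where c: "\<forall>k\<le>n. c k \<in> holfun S W" "u = (\<lambda>p h. \<Sum>k\<le>n. c k p * h ^ k)"
    using assms(2) by (auto simp: holfun_hbar_def)
  then show ?thesis
    by (auto simp: holfun_iff[OF W] intro!: diffable_sum diffable_mult diffable_const)
qed

lemma hbar_outside: "openin X W \<Longrightarrow> u \<in> holfun_hbar S W \<Longrightarrow> p \<notin> W \<Longrightarrow> u p h = 0"
  using holfun_outside[OF _ hbar_slice] by blast

text \<open>Elements are polynomial in hbar; this later recovers the value at hbar = 0 from the
  values at hbar \<noteq> 0.\<close>

lemma hbar_continuous: "u \<in> holfun_hbar S W \<Longrightarrow> continuous_on UNIV (u p)"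
  by (auto simp: holfun_hbar_def intro!: continuous_intros)

lemma hbar_ddx_closed:
  assumes \<alpha>: "\<alpha> \<in> Idx S" and "u \<in> holfun_hbar S (Nbhd S \<alpha>)"
  shows "hbar_ddx S \<alpha> u \<in> holfun_hbar S (Nbhd S \<alpha>)"
proof -
  let ?W = "Nbhd S \<alpha>"
  have W: "openin X ?W" by (rule openin_Nbhd[OF \<alpha>])
  obtain n c where c: "\<And>k. k \<le> n \<Longrightarrow> c k \<in> holfun S ?W" "u = (\<lambda>p h. \<Sum>k\<le>n. c k p * h ^ k)"
    using assms(2) by (auto simp: holfun_hbar_def)
  have "hbar_ddx S \<alpha> u p h = (\<Sum>k\<le>n. ddx S \<alpha> (c k) p * h ^ Suc k)" for p h
  proof (cases "p \<in> ?W")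
    case True
    have cd: "diffable (c k) p" if "k \<le> n" for k using holfun_diffable[OF W c(1)[OF that] True] .
    have "ddx S \<alpha> (\<lambda>p. u p h) p = (\<Sum>k\<le>n. ddx S \<alpha> (\<lambda>p. c k p * h ^ k) p)"
      unfolding c(2) using cd
      by (intro ddx_sum[OF \<alpha> True] diffable_mult diffable_const) auto
    also have "\<dots> = (\<Sum>k\<le>n. ddx S \<alpha> (c k) p * h ^ k)"
      using cd by (intro sum.cong) (auto simp: ddx_mult[OF \<alpha> True] diffable_const ddx_const[OF \<alpha>])
    finally show ?thesis by (simp add: hbar_ddx_def sum_distrib_left mult_ac)
  qed (simp add: hbar_ddx_def ddx_def)
  then have "hbar_ddx S \<alpha> u = (\<lambda>p h. \<Sum>k\<le>n. ddx S \<alpha> (c k) p * h ^ Suc k)" by blast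
  also have "\<dots> \<in> holfun_hbar S ?W"
    using c(1) by (intro hbar_sum[OF W] hbar_monom[OF W] holfun_ddx[OF \<alpha>]) auto
  finally show ?thesis .
qed

lemma sum_fun_apply2: "(\<Sum>i\<in>A. f i) p h = (\<Sum>i\<in>A. f i p h)"
  by (induction A rule: infinite_finite_induct) auto

lemma differential_ring_hbar:
  assumes \<alpha>: "\<alpha> \<in> Idx S"
  shows "differential_ring (holfun_hbar S (Nbhd S \<alpha>)) (\<lambda>p h. if p \<in> Nbhd S \<alpha> then 1 else 0)
    (hbar_ddx S \<alpha>)"
proof -
  let ?W = "Nbhd S \<alpha>"
  have W: "openin X ?W" by (rule openin_Nbhd[OF \<alpha>])
  have one: "(\<lambda>p h. if p \<in> ?W then 1 else 0) \<in> holfun_hbar S ?W"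
    by (intro hbar_of_holfun[OF W] holfun_indicator[OF W] diffable_const)
  show ?thesis
  proof (unfold_locales, goal_cases)
    case 1 then show ?case using hbar_zero[OF W] by (simp add: zero_fun_def)
  next
    case 2 then show ?case by (rule one)
  next
    case (3 a b) then show ?case using hbar_add[OF W, of a b] by (simp add: plus_fun_def)
  next
    case (4 a)
    \<comment> \<open>Negation is obtained as multiplication by -1, cut off like all functions on
      U.\<close>
    have "(\<lambda>p h. (if p \<in> ?W then -1 else 0) * a p h) \<in> holfun_hbar S ?W"
      by (intro hbar_mult[OF W] 4 hbar_of_holfun[OF W] holfun_indicator[OF W] diffable_const)
    moreover have "(\<lambda>p h. (if p \<in> ?W then -1 else 0) * a p h) = - a"
      using hbar_outside[OF W 4] by (auto simp: fun_eq_iff)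
    ultimately show ?case by simp
  next
    case (5 a b) then show ?case using hbar_mult[OF W, of a b] by (simp add: times_fun_def)
  next
    case (6 a) then show ?case using hbar_outside[OF W 6] by (auto simp: fun_eq_iff)
  next
    case (7 a) then show ?case by (rule hbar_ddx_closed[OF \<alpha>])
  next
    case (8 a b)
    have "hbar_ddx S \<alpha> (a + b) p h = (hbar_ddx S \<alpha> a + hbar_ddx S \<alpha> b) p h" for p h
      using ddx_add[OF \<alpha>, of p "\<lambda>p. a p h" "\<lambda>p. b p h"]
        holfun_diffable[OF W hbar_slice[OF W 8(1)], of p h] holfun_diffable[OF W hbar_slice[OF W 8(2)], of p h]
      by (cases "p \<in> ?W") (auto simp: hbar_ddx_def algebra_simps ddx_def)
    then show ?case by blast
  next
    case (9 a b)
    have "hbar_ddx S \<alpha> (a * b) p h = (hbar_ddx S \<alpha> a * b + a * hbar_ddx S \<alpha> b) p h" for p h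
      using ddx_mult[OF \<alpha>, of p "\<lambda>p. a p h" "\<lambda>p. b p h"]
        holfun_diffable[OF W hbar_slice[OF W 9(1)], of p h] holfun_diffable[OF W hbar_slice[OF W 9(2)], of p h]
      by (cases "p \<in> ?W") (auto simp: hbar_ddx_def algebra_simps ddx_def)
    then show ?case by blast
  qed
qed

end

section \<open>The Rees ring as a ring of differential operators\<close>

locale coordinate_patch = projective_structure X \<A> S
  for X :: "'a topology" and \<A> and S :: "('a, 'i) coord_system" +
  fixes \<alpha> :: 'i
  assumes \<alpha>: "\<alpha> \<in> Idx S"
begin

abbreviation N :: "'a set" where "N \<equiv> Nbhd S \<alpha>"
abbreviation \<O> :: "('a \<Rightarrow> complex \<Rightarrow> complex) set" where "\<O> \<equiv> holfun_hbar S N"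
abbreviation unit :: "'a \<Rightarrow> complex \<Rightarrow> complex" where "unit \<equiv> \<lambda>p h. if p \<in> N then 1 else 0"
abbreviation \<delta> :: "('a \<Rightarrow> complex \<Rightarrow> complex) \<Rightarrow> 'a \<Rightarrow> complex \<Rightarrow> complex" where "\<delta> \<equiv> hbar_ddx S \<alpha>"

lemma N: "openin X N"
  by (rule openin_Nbhd[OF \<alpha>])

sublocale dr: differential_ring \<O> unit \<delta>
  by (rule differential_ring_hbar[OF \<alpha>])

lemma act_apply: "dr.reg.act n b u p h = (\<Sum>k<n. b k p h * (\<delta> ^^ k) u p h)"
  by (simp add: dr.reg.act_def sum_fun_apply2)

lemma ddx_pow_holfun: "f \<in> holfun S N \<Longrightarrow> (ddx S \<alpha> ^^ k) f \<in> holfun S N"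
  by (induction k) (auto intro: holfun_ddx[OF \<alpha>])

text \<open>hbar is a constant for d/dx, so its powers collect in front.\<close>

lemma hbar_ddx_pow:
  assumes u: "u \<in> \<O>"
  shows "(\<delta> ^^ k) u p h = h ^ k * (ddx S \<alpha> ^^ k) (\<lambda>p'. u p' h) p"
proof (induction k arbitrary: p)
  case (Suc k)
  let ?D = "(ddx S \<alpha> ^^ k) (\<lambda>p'. u p' h)"
  have D: "?D \<in> holfun S N" by (rule ddx_pow_holfun[OF hbar_slice[OF N u]])
  have "(\<delta> ^^ Suc k) u p h = h * ddx S \<alpha> (\<lambda>p'. h ^ k * ?D p') p"
    by (simp add: hbar_ddx_def Suc.IH)
  also have "ddx S \<alpha> (\<lambda>p'. h ^ k * ?D p') p = h ^ k * ddx S \<alpha> ?D p"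
  proof (cases "p \<in> N")
    case True
    then show ?thesis
      using ddx_mult[OF \<alpha> True diffable_const holfun_diffable[OF N D True]] ddx_const[OF \<alpha>] by simp
  qed (simp add: ddx_def)
  finally show ?case by simp
qed simp

lemma rees_op_coefs:
  "(\<And>l. l \<le> n \<Longrightarrow> a l \<in> \<O>) \<Longrightarrow> (\<lambda>k. if k \<le> n then a (n - k) else 0) \<in> dr.coefs (Suc n)"
  by (auto simp: dr.coefs_def dr.R_zero)

text \<open>\<open>rees_op\<close> counts from the top, a_l belonging to (hbar d/dx)^(n-l), whereas
  \<open>coefs\<close> counts from the bottom; a sum up to l = n needs the strict bound n +
  1.\<close>

lemma rees_op_eq_op: "rees_op S \<alpha> n a = dr.op (Suc n) (\<lambda>k. if k \<le> n then a (n - k) else 0)"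
proof -
  have "(\<Sum>l\<le>n. a l p h * (\<delta> ^^ (n - l)) u p h) =
      (\<Sum>k<Suc n. (if k \<le> n then a (n - k) else 0) p h * (\<delta> ^^ k) u p h)" for u p h
    unfolding lessThan_Suc_atMost[symmetric]
    by (subst sum.nat_diff_reindex[symmetric]) (auto intro!: sum.cong)
  then show ?thesis
    by (auto simp: rees_op_def dr.op_def act_apply fun_eq_iff)
qed

text \<open>The strict bound n is used as a non-strict one, with top coefficient b_n = 0; this
  padding also covers n = 0.\<close>

lemma op_eq_rees_op:
  assumes b: "b \<in> dr.coefs n"
  shows "dr.op n b = rees_op S \<alpha> n (\<lambda>l. b (n - l))"
proof -
  have "(\<lambda>k. if k \<le> n then b (n - (n - k)) else 0) = b"
    using dr.coefs_zero[OF b] by (auto simp: fun_eq_iff)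
  then show ?thesis
    using dr.op_extend[OF b, of "Suc n"] by (simp add: rees_op_eq_op)
qed

text \<open>The monomial hbar^(j+k) c (d/dx)^k = hbar^j c (hbar d/dx)^k. The inequality j + k \<ge>
  k is the order condition of the Rees ring, so these monomials span both descriptions of
  it.\<close>

definition monop :: "('a \<Rightarrow> complex) \<Rightarrow> nat \<Rightarrow> nat \<Rightarrow> 'a hbar_op" where
  "monop c j k u = (if u \<in> \<O> then (\<lambda>p h. h ^ (j + k) * (c p * (ddx S \<alpha> ^^ k) (\<lambda>p'. u p' h) p)) else 0)"

lemma monop_op:
  assumes c: "c \<in> holfun S N"
  shows "monop c j k = dr.op (Suc k) (\<lambda>i. if i = k then (\<lambda>p h. c p * h ^ j) else 0)"
proof -
  have "(\<Sum>i<Suc k. (if i = k then \<lambda>p h. c p * h ^ j else 0) p h * (\<delta> ^^ i) u p h)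
      = c p * h ^ j * (\<delta> ^^ k) u p h" for u p h
    by simp
  then show ?thesis
    by (auto simp: monop_def dr.op_def fun_eq_iff act_apply hbar_ddx_pow power_add mult_ac)
qed

lemma monop_carrier: "c \<in> holfun S N \<Longrightarrow> monop c j k \<in> carrier dr.opring"
  unfolding monop_op dr.opring_simps
  by (rule CollectI, intro exI conjI, rule refl, rule dr.coefs_monom, rule hbar_monom[OF N])

lemma opring_add:
  assumes "T \<in> carrier dr.opring" "T' \<in> carrier dr.opring"
  shows "T + T' \<in> carrier dr.opring"
proof -
  obtain n b where b: "b \<in> dr.coefs n" "T = dr.op n b"
    using assms(1) unfolding dr.opring_simps by blast
  obtain m c where c: "c \<in> dr.coefs m" "T' = dr.op m c"
    using assms(2) unfolding dr.opring_simps by blast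
  define L where "L = max n m"
  have "T + T' = dr.op L (\<lambda>k. b k + c k)"
    using dr.op_extend[OF b(1), of L] dr.op_extend[OF c(1), of L] dr.op_add[of L b c]
    by (simp add: b(2) c(2) L_def plus_fun_def)
  moreover have "(\<lambda>k. b k + c k) \<in> dr.coefs L"
    using dr.coefs_mono[OF b(1), of L] dr.coefs_mono[OF c(1), of L]
    by (intro dr.coefs_add) (auto simp: L_def)
  ultimately show ?thesis unfolding dr.opring_simps by blast
qed

lemma opring_zero: "0 \<in> carrier dr.opring"
proof -
  have "(0 :: 'a hbar_op) = dr.op 0 (\<lambda>k. 0)" by (auto simp: dr.op_def fun_eq_iff act_apply)
  then show ?thesis unfolding dr.opring_simps using dr.coefs_0 by blast
qed

lemma opring_sum:
  "(\<And>i. i \<in> A \<Longrightarrow> f i \<in> carrier dr.opring) \<Longrightarrow> (\<Sum>i\<in>A. f i) \<in> carrier dr.opring"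
  by (induction A rule: infinite_finite_induct) (auto intro: opring_zero opring_add)

section \<open>The carrier of the Rees ring\<close>

definition rees_elem :: "nat \<Rightarrow> (nat \<Rightarrow> ('a \<Rightarrow> complex) \<Rightarrow> 'a \<Rightarrow> complex) \<Rightarrow> 'a hbar_op" where
  "rees_elem n Q u = (if u \<in> \<O> then (\<lambda>p h. \<Sum>m\<le>n. h ^ m * Q m (\<lambda>p'. u p' h) p) else (\<lambda>p h. 0))"

lemma rees_carrier: "carrier (rees_ring S \<alpha>) = {rees_elem n Q | n Q. \<forall>m\<le>n. Q m \<in> diffops S \<alpha> m}"
proof -
  have "carrier (rees_ring S \<alpha>) = {T. \<exists>n Q. (\<forall>m\<le>n. Q m \<in> diffops S \<alpha> m) \<and> T = rees_elem n Q}"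
    by (simp add: rees_ring_def rees_elem_def[abs_def])
  then show ?thesis by blast
qed

definition zero_diffop :: "('a \<Rightarrow> complex) \<Rightarrow> 'a \<Rightarrow> complex" where
  "zero_diffop f p = 0"

lemma zero_diffop: "zero_diffop \<in> diffops S \<alpha> m"
  unfolding diffops_def
  by (rule CollectI, rule exI[of _ "\<lambda>k p. 0"])
     (auto simp: zero_diffop_def fun_eq_iff holfun_zero[OF N])

lemma diffops_add:
  assumes "Q \<in> diffops S \<alpha> m" "Q' \<in> diffops S \<alpha> m"
  shows "(\<lambda>f p. Q f p + Q' f p) \<in> diffops S \<alpha> m"
proof -
  obtain a a' where a: "\<forall>k\<le>m. a k \<in> holfun S N" "\<forall>k\<le>m. a' k \<in> holfun S N"
    "Q = (\<lambda>f. if f \<in> holfun S N then (\<lambda>p. \<Sum>k\<le>m. a k p * (ddx S \<alpha> ^^ k) f p) else (\<lambda>p. 0))"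
    "Q' = (\<lambda>f. if f \<in> holfun S N then (\<lambda>p. \<Sum>k\<le>m. a' k p * (ddx S \<alpha> ^^ k) f p) else (\<lambda>p. 0))"
    using assms unfolding diffops_def by blast
  show ?thesis
    unfolding diffops_def
    by (rule CollectI, rule exI[of _ "\<lambda>k p. a k p + a' k p"])
       (use a in \<open>auto simp: holfun_add[OF N] fun_eq_iff sum.distrib distrib_right\<close>)
qed

lemma rees_carrier_add:
  assumes "T \<in> carrier (rees_ring S \<alpha>)" "T' \<in> carrier (rees_ring S \<alpha>)"
  shows "T + T' \<in> carrier (rees_ring S \<alpha>)"
proof -
  obtain n Q n' Q' where Q: "\<forall>m\<le>n. Q m \<in> diffops S \<alpha> m" "T = rees_elem n Q"
    and Q': "\<forall>m\<le>n'. Q' m \<in> diffops S \<alpha> m" "T' = rees_elem n' Q'"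
    using assms unfolding rees_carrier by blast
  define R where "R m = (if m \<le> n then Q m else zero_diffop)" for m
  define R' where "R' m = (if m \<le> n' then Q' m else zero_diffop)" for m
  have "R m \<in> diffops S \<alpha> m" "R' m \<in> diffops S \<alpha> m" for m
    using Q(1) Q'(1) zero_diffop by (auto simp: R_def R'_def)
  then have "\<forall>m\<le>max n n'. (\<lambda>f p. R m f p + R' m f p) \<in> diffops S \<alpha> m"
    using diffops_add by blast
  moreover have "(\<Sum>m\<le>n. h ^ m * Q m f p) = (\<Sum>m\<le>max n n'. h ^ m * R m f p)" for h f p
    by (rule sum.mono_neutral_cong_left) (auto simp: R_def zero_diffop_def)
  moreover have "(\<Sum>m\<le>n'. h ^ m * Q' m f p) = (\<Sum>m\<le>max n n'. h ^ m * R' m f p)" for h f p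
    by (rule sum.mono_neutral_cong_left) (auto simp: R'_def zero_diffop_def)
  ultimately have "T + T' = rees_elem (max n n') (\<lambda>m f p. R m f p + R' m f p)"
    unfolding Q Q' by (auto simp: fun_eq_iff rees_elem_def sum.distrib distrib_left)
  with \<open>\<forall>m\<le>max n n'. (\<lambda>f p. R m f p + R' m f p) \<in> diffops S \<alpha> m\<close> show ?thesis
    unfolding rees_carrier by blast
qed

lemma rees_carrier_zero: "0 \<in> carrier (rees_ring S \<alpha>)"
proof -
  have "0 = rees_elem 0 (\<lambda>m. zero_diffop)"
    by (simp add: rees_elem_def fun_eq_iff zero_diffop_def)
  then show ?thesis unfolding rees_carrier using zero_diffop by blast
qed

lemma rees_carrier_sum:
  "(\<And>i. i \<in> A \<Longrightarrow> f i \<in> carrier (rees_ring S \<alpha>)) \<Longrightarrow> (\<Sum>i\<in>A. f i) \<in> carrier (rees_ring S \<alpha>)"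
  by (induction A rule: infinite_finite_induct) (auto intro: rees_carrier_zero rees_carrier_add)

lemma monop_rees_carrier:
  assumes c: "c \<in> holfun S N"
  shows "monop c j k \<in> carrier (rees_ring S \<alpha>)"
proof -
  define Q where "Q m = (if m = j + k then (\<lambda>f. if f \<in> holfun S N then
     (\<lambda>p. \<Sum>i\<le>m. (if i = k then c else (\<lambda>p. 0)) p * (ddx S \<alpha> ^^ i) f p) else (\<lambda>p. 0))
     else zero_diffop)" for m
  have "Q m \<in> diffops S \<alpha> m" for m
  proof (cases "m = j + k")
    case True
    then show ?thesis
      unfolding diffops_def
      by (intro CollectI exI[of _ "\<lambda>i. if i = k then c else (\<lambda>p. 0)"])
         (auto simp: Q_def c holfun_zero[OF N])
  qed (simp add: Q_def zero_diffop)
  moreover have "monop c j k = rees_elem (j + k) Q"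
  proof -
    have "(\<Sum>i\<le>j + k. (if i = k then c else (\<lambda>p. 0)) p * D i) = c p * D k" for p and D :: "nat \<Rightarrow> complex"
      by (subst sum.remove[of _ k]) auto
    then have "(\<Sum>m\<le>j + k. h ^ m * Q m f p) = h ^ (j + k) * (c p * (ddx S \<alpha> ^^ k) f p)"
      if "f \<in> holfun S N" for f h p
      using that by (subst sum.remove[of _ "j + k"]) (auto simp: Q_def zero_diffop_def)
    then show ?thesis
      by (auto simp: fun_eq_iff monop_def rees_elem_def hbar_slice[OF N])
  qed
  ultimately show ?thesis unfolding rees_carrier by blast
qed

lemma sum_op_apply: "(\<Sum>i\<in>A. f i) (u :: 'a \<Rightarrow> complex \<Rightarrow> complex) p h = (\<Sum>i\<in>A. f i u p h :: complex)"
  by (induction A rule: infinite_finite_induct) auto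

text \<open>Both sides are finite sums of \<open>monop\<close>: in degree m a term c (d/dx)^k has k
  \<le> m and takes j = m - k; conversely the coefficient of (hbar d/dx)^k is a polynomial in hbar
  and gives one monomial for each j.\<close>

lemma carrier_rees_eq: "carrier (rees_ring S \<alpha>) = carrier dr.opring"
proof (intro equalityI subsetI)
  fix T assume "T \<in> carrier (rees_ring S \<alpha>)"
  then obtain n Q where Q: "\<forall>m\<le>n. Q m \<in> diffops S \<alpha> m" "T = rees_elem n Q"
    unfolding rees_carrier by blast
  have "\<forall>m. \<exists>a. m \<le> n \<longrightarrow> (\<forall>k\<le>m. a k \<in> holfun S N) \<and>
     Q m = (\<lambda>f. if f \<in> holfun S N then (\<lambda>p. \<Sum>k\<le>m. a k p * (ddx S \<alpha> ^^ k) f p) else (\<lambda>p. 0))"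
    using Q(1) unfolding diffops_def by blast
  from choice[OF this] obtain A where A: "\<And>m k. m \<le> n \<Longrightarrow> k \<le> m \<Longrightarrow> A m k \<in> holfun S N"
     "\<And>m. m \<le> n \<Longrightarrow> Q m = (\<lambda>f. if f \<in> holfun S N then (\<lambda>p. \<Sum>k\<le>m. A m k p * (ddx S \<alpha> ^^ k) f p)
        else (\<lambda>p. 0))" by blast
  have "T u p h = (\<Sum>m\<le>n. \<Sum>k\<le>m. monop (A m k) (m - k) k) u p h" for u p h
  proof (cases "u \<in> \<O>")
    case True
    then have "(\<lambda>p'. u p' h) \<in> holfun S N" by (rule hbar_slice[OF N])
    then show ?thesis
      using True by (auto simp: Q(2) rees_elem_def sum_op_apply monop_def A(2) sum_distrib_left
          intro!: sum.cong)
  qed (simp add: Q(2) rees_elem_def sum_op_apply monop_def)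
  then have "T = (\<Sum>m\<le>n. \<Sum>k\<le>m. monop (A m k) (m - k) k)" by blast
  also have "\<dots> \<in> carrier dr.opring"
    using A(1) by (intro opring_sum monop_carrier) auto
  finally show "T \<in> carrier dr.opring" .
next
  fix T assume "T \<in> carrier dr.opring"
  then obtain n b where b: "b \<in> dr.coefs n" "T = dr.op n b" unfolding dr.opring_simps by blast
  have "\<forall>k. \<exists>d c. (\<forall>j\<le>d. c j \<in> holfun S N) \<and> b k = (\<lambda>p h. \<Sum>j\<le>d. c j p * h ^ j)"
    using dr.coefs_in[OF b(1)] unfolding holfun_hbar_def by blast
  from choice[OF this] obtain d where
    "\<forall>k. \<exists>c. (\<forall>j\<le>d k. c j \<in> holfun S N) \<and> b k = (\<lambda>p h. \<Sum>j\<le>d k. c j p * h ^ j)" by blast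
  from choice[OF this] obtain C where C: "\<And>k j. j \<le> d k \<Longrightarrow> C k j \<in> holfun S N"
    "\<And>k. b k = (\<lambda>p h. \<Sum>j\<le>d k. C k j p * h ^ j)" by blast
  have "T u p h = (\<Sum>k<n. \<Sum>j\<le>d k. monop (C k j) j k) u p h" for u p h
  proof (cases "u \<in> \<O>")
    case True
    have "(\<Sum>j\<le>d k. C k j p * h ^ j) * (h ^ k * D) = (\<Sum>j\<le>d k. h ^ (j + k) * (C k j p * D))" for k D
      unfolding sum_distrib_right by (intro sum.cong) (simp_all add: power_add mult_ac)
    then show ?thesis
      using True by (simp add: b(2) dr.op_def act_apply sum_op_apply monop_def C(2) hbar_ddx_pow)
  qed (simp add: b(2) dr.op_def sum_op_apply monop_def)
  then have "T = (\<Sum>k<n. \<Sum>j\<le>d k. monop (C k j) j k)" by blast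
  also have "\<dots> \<in> carrier (rees_ring S \<alpha>)"
    using C(1) by (intro rees_carrier_sum monop_rees_carrier) auto
  finally show "T \<in> carrier (rees_ring S \<alpha>)" .
qed

lemma rees_ring_eq: "rees_ring S \<alpha> = dr.opring"
proof -
  have "rees_ring S \<alpha> = \<lparr>carrier = carrier (rees_ring S \<alpha>), monoid.mult = (\<lambda>T T'. T \<circ> T'),
      one = (\<lambda>u. if u \<in> \<O> then u else (\<lambda>p h. 0)), zero = (\<lambda>u p h. 0),
      add = (\<lambda>T T' u p h. T u p h + T' u p h)\<rparr>"
    by (simp add: rees_ring_def)
  then show ?thesis
    unfolding carrier_rees_eq dr.opring_simps by (simp add: dr.opring_def zero_fun_def plus_fun_def cong: if_cong)
qed

text \<open>The truncated differences k - j make the product vanish once i exceeds k, so derivatives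
  beyond the degree are covered as well.\<close>

lemma ddx_pow_power:
  "(ddx S \<alpha> ^^ i) (\<lambda>q. if q \<in> N then (Coord S \<alpha> q - c) ^ k else 0) =
   (\<lambda>q. if q \<in> N then (\<Prod>j<i. of_nat (k - j)) * (Coord S \<alpha> q - c) ^ (k - i) else 0)"
proof (induction i)
  case (Suc i)
  let ?a = "\<Prod>j<i. of_nat (k - j) :: complex"
  have "ddx S \<alpha> (\<lambda>q. if q \<in> N then ?a * (Coord S \<alpha> q - c) ^ (k - i) else 0) q =
      (if q \<in> N then (\<Prod>j<Suc i. of_nat (k - j)) * (Coord S \<alpha> q - c) ^ (k - Suc i) else 0)" for q
  proof (cases "q \<in> N")
    case True
    let ?x = "Coord S \<alpha> q"
    have "((\<lambda>x. ?a * (x - c) ^ (k - i)) has_field_derivative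
        ?a * (of_nat (k - i) * (?x - c) ^ (k - i - 1))) (at ?x)"
      by (auto intro!: derivative_eq_intros)
    then have "(((\<lambda>q. if q \<in> N then ?a * (Coord S \<alpha> q - c) ^ (k - i) else 0) \<circ> pt S \<alpha>)
        has_field_derivative ?a * (of_nat (k - i) * (?x - c) ^ (k - i - 1))) (at ?x)"
      by (rule has_field_derivative_transform_within_open[OF _ open_Coord_Nbhd[OF \<alpha>]])
         (use True pt_Coord[OF \<alpha>] in auto)
    from ddx_eqI[OF \<alpha> True this] show ?thesis using True by simp
  qed (simp add: ddx_def)
  then show ?case unfolding funpow.simps comp_def Suc.IH by blast
qed (simp add: fun_eq_iff)

text \<open>At p the test function (x - x(p))^k isolates k! hbar^k b_k(p). For k > 0 this says
  nothing at hbar = 0, where continuity in hbar takes over.\<close>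

lemma faithful:
  assumes b: "b \<in> dr.coefs n" and 0: "\<And>u. u \<in> \<O> \<Longrightarrow> dr.reg.act n b u = 0"
  shows "b = (\<lambda>k. 0)"
proof -
  have "b k p h = 0" for k p h
  proof (cases "k < n \<and> p \<in> N")
    case True
    let ?f = "\<lambda>q. if q \<in> N then (Coord S \<alpha> q - Coord S \<alpha> p) ^ k else 0"
    have "?f \<in> holfun S N"
    proof (rule holfun_indicator[OF N])
      fix q assume "q \<in> N"
      then show "diffable (\<lambda>q. (Coord S \<alpha> q - Coord S \<alpha> p) ^ k) q"
        using diffable_power[OF diffable_add[OF diffable_Coord[OF \<alpha>] diffable_const[of "- Coord S \<alpha> p"]]]
        by simp
    qed
    then have u: "(\<lambda>q h. ?f q) \<in> \<O>" by (rule hbar_of_holfun[OF N])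
    have coef: "(\<Prod>j<i. of_nat (k - j)) * 0 ^ (k - i) = (if i = k then fact k else (0 :: complex))" for i
    proof (cases "i \<le> k")
      case True
      have "(\<Prod>j<k. of_nat (k - j)) = (fact k :: complex)"
        by (simp add: fact_prod_rev atLeast0LessThan)
      then show ?thesis using True by auto
    next
      case False
      then have "(\<Prod>j<i. of_nat (k - j)) = (0 :: complex)" by (intro prod_zero) auto
      then show ?thesis using False by simp
    qed
    have z: "b k p h' * h' ^ k * fact k = 0" for h'
    proof -
      have "0 = dr.reg.act n b (\<lambda>q h. ?f q) p h'" using 0[OF u] by simp
      also have "\<dots> = (\<Sum>i<n. b i p h' * (h' ^ i * ((\<Prod>j<i. of_nat (k - j)) * 0 ^ (k - i))))"
        unfolding act_apply hbar_ddx_pow[OF u] ddx_pow_power using True by simp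
      also have "\<dots> = (\<Sum>i<n. if i = k then b k p h' * h' ^ k * fact k else 0)"
        unfolding coef by (intro sum.cong) auto
      finally show ?thesis using True by simp
    qed
    then have nz: "b k p h' = 0" if "h' \<noteq> 0" for h' using that z[of h'] by simp
    have "isCont (b k p) 0"
      using hbar_continuous[OF dr.coefs_in[OF b, of k]] by (simp add: continuous_on_eq_continuous_at)
    then have "(b k p \<longlongrightarrow> b k p 0) (at 0)" by (simp add: isCont_def)
    moreover have "(b k p \<longlongrightarrow> 0) (at 0)"
      by (rule tendsto_eventually) (auto simp: eventually_at_filter nz)
    ultimately have "b k p 0 = 0" by (rule tendsto_unique[OF at_neq_bot])
    then show ?thesis using nz[of h] by (cases "h = 0") auto
  next
    case False
    then consider "n \<le> k" | "p \<notin> N" by linarith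
    then show ?thesis
      by cases (simp_all add: dr.coefs_zero[OF b, of k] hbar_outside[OF N dr.coefs_in[OF b, of k]])
  qed
  then show ?thesis by (simp add: fun_eq_iff)
qed

end

section \<open>The transition matrices of the oper bundle\<close>

text \<open>The square root of s_m in the sl(2) triple. It vanishes at both ends m = 0 and m = r, so
  the boundary terms of matrix products drop out by themselves.\<close>

definition sq :: "nat \<Rightarrow> nat \<Rightarrow> complex" where
  "sq r m = complex_of_real (sqrt (real (m * (r - m))))"

text \<open>The factors w_ij of the overview; the half-open range makes them multiplicative along i
  \<le> k \<le> j.\<close>

definition wt :: "nat \<Rightarrow> nat \<Rightarrow> nat \<Rightarrow> complex" where
  "wt r i j = (\<Prod>m\<in>{i<..j}. sq r m)"

lemma sq_square: "sq r m * sq r m = of_nat (m * (r - m))"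
  unfolding sq_def of_real_mult[symmetric] by (simp del: of_nat_mult)

lemma sq_nat: "m \<le> r \<Longrightarrow> (of_nat (m * (r - m)) :: complex) = of_nat m * (of_nat r - of_nat m)"
  by (simp add: of_nat_diff)

lemma sq_nonzero: "0 < m \<Longrightarrow> m < r \<Longrightarrow> sq r m \<noteq> 0"
  by (simp add: sq_def)

lemma sq_0 [simp]: "sq r 0 = 0" and sq_r [simp]: "sq r r = 0"
  by (simp_all add: sq_def)

lemma wt_self [simp]: "wt r i i = 1"
  by (simp add: wt_def)

lemma wt_Suc_right: "i \<le> j \<Longrightarrow> wt r i (Suc j) = wt r i j * sq r (Suc j)"
proof -
  assume "i \<le> j"
  then have "{i<..Suc j} = insert (Suc j) {i<..j}" by auto
  then show ?thesis by (simp add: wt_def mult.commute)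
qed

lemma wt_trans: "i \<le> k \<Longrightarrow> k \<le> j \<Longrightarrow> wt r i k * wt r k j = wt r i j"
proof -
  assume "i \<le> k" "k \<le> j"
  then have "{i<..j} = {i<..k} \<union> {k<..j}" by auto
  then show ?thesis by (simp add: wt_def prod.union_disjoint)
qed

lemma wt_Suc_left: "i \<le> j \<Longrightarrow> 0 < i \<Longrightarrow> wt r (i - 1) j = sq r i * wt r i j"
  using wt_trans[of "i - 1" i j r] wt_Suc_right[of "i - 1" "i - 1" r] by simp

lemma Xminus_carrier [simp]: "Xminus r \<in> carrier_mat r r"
  and Xplus_carrier [simp]: "Xplus r \<in> carrier_mat r r"
  by (simp_all add: Xminus_def Xplus_def)

lemma X_dims [simp]: "dim_row (Xminus r) = r" "dim_col (Xminus r) = r"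
    "dim_row (Xplus r) = r" "dim_col (Xplus r) = r"
  by (simp_all add: Xminus_def Xplus_def)

lemma Xminus_entry: "i < r \<Longrightarrow> j < r \<Longrightarrow> Xminus r $$ (i, j) = (if i = Suc j then sq r i else 0)"
  by (simp add: Xminus_def sq_def)

lemma Xplus_entry: "i < r \<Longrightarrow> j < r \<Longrightarrow> Xplus r $$ (i, j) = (if j = Suc i then sq r j else 0)"
  by (auto simp: Xplus_def Xminus_def sq_def)

lemma mult_entry:
  assumes "A \<in> carrier_mat r r" "B \<in> carrier_mat r r" "i < r" "j < r"
  shows "(A * B) $$ (i, j) = (\<Sum>k<r. A $$ (i, k) * B $$ (k, j))"
  using assms by (simp add: scalar_prod_def atLeast0LessThan)

lemma Xplus_scaled_pow_entry:
  assumes "i < r" "j < r"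
  shows "((c \<cdot>\<^sub>m Xplus r) ^\<^sub>m m) $$ (i, j) = (if j = i + m then c ^ m * wt r i j else 0)"
  using assms
proof (induction m arbitrary: j)
  case 0
  then show ?case by (simp add: Xplus_def Xminus_def)
next
  case (Suc m)
  have c: "(c \<cdot>\<^sub>m Xplus r) \<in> carrier_mat r r" by simp
  have "((c \<cdot>\<^sub>m Xplus r) ^\<^sub>m Suc m) $$ (i, j) =
      (\<Sum>k<r. ((c \<cdot>\<^sub>m Xplus r) ^\<^sub>m m) $$ (i, k) * (c \<cdot>\<^sub>m Xplus r) $$ (k, j))"
    using mult_entry[OF pow_carrier_mat[OF c, of m] c Suc.prems] by simp
  also have "\<dots> = (\<Sum>k<r. if k = i + m then (if j = Suc k then c ^ Suc m * (wt r i k * sq r j) else 0) else 0)"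
    using Suc.prems by (intro sum.cong) (auto simp: Suc.IH Xplus_entry)
  also have "\<dots> = (if j = i + Suc m then c ^ Suc m * wt r i j else 0)"
    using Suc.prems by (auto simp: wt_Suc_right)
  finally show ?case .
qed

lemma Xplus_pow_entry:
  "i < r \<Longrightarrow> j < r \<Longrightarrow> (Xplus r ^\<^sub>m m) $$ (i, j) = (if j = i + m then wt r i j else 0)"
proof -
  assume ij: "i < r" "j < r"
  have "1 \<cdot>\<^sub>m Xplus r = Xplus r" by (rule eq_matI) auto
  then show ?thesis using Xplus_scaled_pow_entry[OF ij, of 1 m] by simp
qed

text \<open>The diagonal entries of the commutator are s_(i+1) - s_i = r - 1 - 2i.\<close>

lemma Hmat_entry:
  assumes "i < r" "j < r"
  shows "Hmat r $$ (i, j) = (if i = j then of_int (int r - 1 - 2 * int i) else 0)"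
proof -
  have "(Xplus r * Xminus r) $$ (i, j) = (\<Sum>k<r. Xplus r $$ (i, k) * Xminus r $$ (k, j))"
    by (rule mult_entry[OF Xplus_carrier Xminus_carrier assms])
  also have "\<dots> = (\<Sum>k<r. if k = Suc i then (if i = j then sq r k * sq r k else 0) else 0)"
    using assms by (intro sum.cong) (auto simp: Xplus_entry Xminus_entry)
  also have "\<dots> = (if i = j then of_nat (Suc i * (r - Suc i)) else 0)"
    using assms by (cases "Suc i = r") (auto simp: sq_square)
  finally have 1: "(Xplus r * Xminus r) $$ (i, j) = (if i = j then of_nat (Suc i * (r - Suc i)) else 0)" .
  have "(Xminus r * Xplus r) $$ (i, j) = (\<Sum>k<r. Xminus r $$ (i, k) * Xplus r $$ (k, j))"
    by (rule mult_entry[OF Xminus_carrier Xplus_carrier assms])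
  \<comment> \<open>For i = 0 the truncated i - 1 is 0 again, a valid index; the condition
    \<open>i \<noteq> 0\<close> removes that term.\<close>
  also have "\<dots> = (\<Sum>k<r. if k = i - 1 then (if i = j \<and> i \<noteq> 0 then sq r i * sq r i else 0) else 0)"
    using assms by (intro sum.cong) (auto simp: Xplus_entry Xminus_entry)
  also have "\<dots> = (if i = j then of_nat (i * (r - i)) else 0)"
    using assms by (cases i) (auto simp: sq_square)
  finally have 2: "(Xminus r * Xplus r) $$ (i, j) = (if i = j then of_nat (i * (r - i)) else 0)" .
  have "Hmat r $$ (i, j) = (Xplus r * Xminus r) $$ (i, j) - (Xminus r * Xplus r) $$ (i, j)"
    unfolding Hmat_def using assms by (subst index_minus_mat) auto
  also have "\<dots> = (if i = j then of_int (int r - 1 - 2 * int i) else 0)"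
    unfolding 1 2 using assms sq_nat[of "Suc i" r] sq_nat[of i r] by (auto simp: algebra_simps)
  finally show ?thesis .
qed

lemma H_dims [simp]: "dim_row (Hmat r) = r" "dim_col (Hmat r) = r"
  by (simp_all add: Hmat_def)

lemma Hmat_carrier [simp]: "Hmat r \<in> carrier_mat r r"
  by (rule carrier_matI) simp_all

lemma diagonal_pow_entry:
  assumes A: "A \<in> carrier_mat r r" and d: "\<And>i j. i < r \<Longrightarrow> j < r \<Longrightarrow> A $$ (i, j) = (if i = j then d i else 0)"
    and "i < r" "j < r"
  shows "(A ^\<^sub>m m) $$ (i, j) = (if i = j then d i ^ m else 0)"
  using assms(3,4)
proof (induction m arbitrary: j)
  case 0
  then show ?case using A by simp
next
  case (Suc m)
  have "(A ^\<^sub>m Suc m) $$ (i, j) = (\<Sum>k<r. (A ^\<^sub>m m) $$ (i, k) * A $$ (k, j))"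
    using mult_entry[OF pow_carrier_mat[OF A] A Suc.prems] by simp
  also have "\<dots> = (\<Sum>k<r. if k = i then (if i = j then d i ^ Suc m else 0) else 0)"
    using Suc.prems by (intro sum.cong) (auto simp: Suc.IH d power_Suc2 simp del: power_Suc)
  finally show ?case using Suc.prems by simp
qed

text \<open>The logarithm is multiplied by an integer before exponentiation, so its branch
  disappears in an integer power of z.\<close>

lemma mat_exp_Hmat_entry:
  assumes "i < r" "j < r" "z \<noteq> 0"
  shows "mat_exp (Ln z \<cdot>\<^sub>m Hmat r) $$ (i, j) = (if i = j then z powi (int r - 1 - 2 * int i) else 0)"
proof -
  let ?d = "\<lambda>i. Ln z * of_int (int r - 1 - 2 * int i)"
  have "((Ln z \<cdot>\<^sub>m Hmat r) ^\<^sub>m k) $$ (i, j) = (if i = j then ?d i ^ k else 0)" for k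
  proof (rule diagonal_pow_entry[OF _ _ assms(1,2)])
    show "Ln z \<cdot>\<^sub>m Hmat r \<in> carrier_mat r r" by simp
    fix i j assume "i < r" "j < r"
    then show "(Ln z \<cdot>\<^sub>m Hmat r) $$ (i, j) = (if i = j then ?d i else 0)"
      by (simp add: Hmat_entry)
  qed
  then have "mat_exp (Ln z \<cdot>\<^sub>m Hmat r) $$ (i, j) = suminf (\<lambda>k. (if i = j then ?d i ^ k else 0) / fact k)"
    using assms(1,2) by (simp add: mat_exp_def)
  also have "\<dots> = (if i = j then exp (?d i) else 0)"
    by (simp add: exp_def scaleR_conv_of_real field_simps)
  also have "exp (?d i) = z powi (int r - 1 - 2 * int i)"
    using exp_power_int[of "Ln z" "int r - 1 - 2 * int i"] assms(3) by (simp add: mult.commute)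
  finally show ?thesis .
qed

text \<open>X_+^k lives on the k-th superdiagonal, so the exponential series has at most one nonzero
  term in each entry.\<close>

lemma mat_exp_Xplus_entry:
  assumes "i < r" "j < r"
  shows "mat_exp (c \<cdot>\<^sub>m Xplus r) $$ (i, j) = (if i \<le> j then c ^ (j - i) * wt r i j / fact (j - i) else 0)"
proof -
  have "mat_exp (c \<cdot>\<^sub>m Xplus r) $$ (i, j) = suminf (\<lambda>k. (if j = i + k then c ^ k * wt r i j else 0) / fact k)"
    using assms by (simp add: mat_exp_def Xplus_scaled_pow_entry)
  also have "\<dots> = (\<Sum>k\<in>(if i \<le> j then {j - i} else {}). (if j = i + k then c ^ k * wt r i j else 0) / fact k)"
    by (rule suminf_finite) (auto split: if_splits)
  finally show ?thesis by simp
qed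

text \<open>Entry (i, j) of z^H exp((k/z) X_+), with the denominator z^(j-i) merged into the power
  of z: (r - 1 - 2i) - (j - i) = r - 1 - i - j. It is defined for all natural indices, so that the
  neighbors i - 1 and j + 1 can be used at the border of the matrix.\<close>

definition tr :: "nat \<Rightarrow> complex \<Rightarrow> complex \<Rightarrow> nat \<Rightarrow> nat \<Rightarrow> complex" where
  "tr r z k i j = (if i \<le> j then
     z powi (int r - 1 - int i - int j) * k ^ (j - i) * wt r i j / fact (j - i) else 0)"

lemma oper_bundle_entry:
  assumes "i < r" "j < r" "\<xi> \<alpha> \<beta> p \<noteq> 0"
  shows "oper_bundle S \<xi> r h \<alpha> \<beta> p $$ (i, j) = tr r (\<xi> \<alpha> \<beta> p) (h * ddx S \<beta> (\<xi> \<alpha> \<beta>) p) i j"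
proof -
  let ?z = "\<xi> \<alpha> \<beta> p" and ?k = "ddx S \<beta> (\<xi> \<alpha> \<beta>) p"
  let ?A = "mat_exp (Ln ?z \<cdot>\<^sub>m Hmat r)" and ?B = "mat_exp ((h * (?k / ?z)) \<cdot>\<^sub>m Xplus r)"
  have "?A \<in> carrier_mat r r" "?B \<in> carrier_mat r r"
    by (simp_all add: mat_exp_def)
  then have "oper_bundle S \<xi> r h \<alpha> \<beta> p $$ (i, j) = (\<Sum>k<r. ?A $$ (i, k) * ?B $$ (k, j))"
    unfolding oper_bundle_def using mult_entry assms by blast
  also have "\<dots> = (\<Sum>k<r. if k = i then ?z powi (int r - 1 - 2 * int i) * ?B $$ (i, j) else 0)"
    using assms by (intro sum.cong) (auto simp: mat_exp_Hmat_entry)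
  also have "\<dots> = ?z powi (int r - 1 - 2 * int i) * ?B $$ (i, j)" using assms by simp
  also have "\<dots> = tr r ?z (h * ?k) i j"
  proof (cases "i \<le> j")
    case True
    then have "int r - 1 - 2 * int i = (int r - 1 - int i - int j) + int (j - i)" by simp
    then have "?z powi (int r - 1 - 2 * int i) = ?z powi (int r - 1 - int i - int j) * ?z ^ (j - i)"
      using assms(3) by (simp only: power_int_add[OF disjI1[OF assms(3)]] power_int_of_nat)
    then show ?thesis
      using True assms by (simp add: mat_exp_Xplus_entry tr_def power_mult_distrib power_divide)
  qed (use assms in \<open>simp add: mat_exp_Xplus_entry tr_def\<close>)
  finally show ?thesis .
qed

lemma oper_bundle_carrier: "oper_bundle S \<xi> r h \<alpha> \<beta> p \<in> carrier_mat r r"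
  unfolding oper_bundle_def by (rule mult_carrier_mat[of _ r r]) (simp_all add: mat_exp_def)

text \<open>The pairs (z, k) multiply like a function and its derivative: k2 z1 + k1 / z2 is the
  product rule, where k1 z2 is divided by z2^2 because the first derivative is taken in another
  coordinate. Entrywise the matrix product is a binomial expansion of the power of this sum.\<close>

lemma tr_cocycle:
  assumes z: "z1 \<noteq> 0" "z2 \<noteq> 0" and ij: "i < r" "j < r"
  shows "(\<Sum>k<r. tr r z1 k1 i k * tr r z2 k2 k j) = tr r (z1 * z2) (k2 * z1 + k1 / z2) i j"
proof (cases "i \<le> j")
  case False
  then have "tr r z1 k1 i k * tr r z2 k2 k j = 0" for k by (auto simp: tr_def)
  then have "(\<Sum>k<r. tr r z1 k1 i k * tr r z2 k2 k j) = 0" by (intro sum.neutral) blast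
  with False show ?thesis by (simp add: tr_def)
next
  case True
  define n where "n = j - i"
  have j: "j = i + n" using True by (simp add: n_def)
  define R where "R = int r - 1 - 2 * int i"
  have e: "int r - 1 - int i - int j = R - int n" by (simp add: R_def j)
  have "(\<Sum>k<r. tr r z1 k1 i k * tr r z2 k2 k j) = (\<Sum>k\<in>{i..j}. tr r z1 k1 i k * tr r z2 k2 k j)"
    using ij by (intro sum.mono_neutral_right) (auto simp: tr_def)
  also have "\<dots> = (\<Sum>a\<le>n. tr r z1 k1 i (i + a) * tr r z2 k2 (i + a) j)"
    by (rule sum.reindex_bij_witness[of _ "\<lambda>a. i + a" "\<lambda>k. k - i"]) (auto simp: j)
  also have "\<dots> = (\<Sum>a\<le>n. (z1 * z2) powi (R - int n) * (of_nat (n choose a) * (k1 / z2) ^ a * (k2 * z1) ^ (n - a))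
      * wt r i j / fact n)"
  proof (rule sum.cong)
    fix a assume "a \<in> {..n}"
    then have a: "a \<le> n" by simp
    \<comment> \<open>Both exponents are measured against R - n, the exponent in the product; the
      leftover z1^(n-a) and z2^(-a) complete the binomial terms.\<close>
    have e1: "int r - 1 - int i - int (i + a) = (R - int n) + int (n - a)"
      and e2: "int r - 1 - int (i + a) - int j = (R - int n) + - int a"
      using a by (simp_all add: R_def j)
    have "tr r z1 k1 i (i + a) * tr r z2 k2 (i + a) j =
       (z1 powi (R - int n) * z1 ^ (n - a)) * k1 ^ a *
       (z2 powi (R - int n) * z2 powi (- int a)) * k2 ^ (n - a) * (wt r i (i + a) * wt r (i + a) j)
       / (fact a * fact (n - a))"
      using a unfolding tr_def e1 e2 power_int_add[OF disjI1[OF z(1)]] power_int_add[OF disjI1[OF z(2)]]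
        power_int_of_nat by (simp add: j)
    also have "wt r i (i + a) * wt r (i + a) j = wt r i j" using a by (intro wt_trans) (auto simp: j)
    also have "z2 powi (- int a) = 1 / z2 ^ a" by (simp add: power_int_minus field_simps)
    finally show "tr r z1 k1 i (i + a) * tr r z2 k2 (i + a) j =
       (z1 * z2) powi (R - int n) * (of_nat (n choose a) * (k1 / z2) ^ a * (k2 * z1) ^ (n - a))
       * wt r i j / fact n"
      using binomial_fact[OF a, where ?'a = complex]
      by (simp add: power_int_mult_distrib power_mult_distrib power_divide mult_ac)
  qed simp
  also have "\<dots> = (z1 * z2) powi (R - int n) * (k1 / z2 + k2 * z1) ^ n * wt r i j / fact n"
    by (simp add: binomial_ring sum_distrib_left sum_distrib_right sum_divide_distrib mult.assoc)
  also have "\<dots> = tr r (z1 * z2) (k2 * z1 + k1 / z2) i j"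
    using True by (simp only: tr_def e if_True n_def[symmetric] add.commute)
  finally show ?thesis .
qed

lemma tr_unit: "tr r 1 0 i j = (if i = j then 1 else 0)"
  by (auto simp: tr_def)

section \<open>The Higgs field and its gauge transformation\<close>

lemma higgs_carrier [simp]: "higgs_field r q \<alpha> p \<in> carrier_mat r r"
  by (simp add: higgs_field_def)

lemma higgs_dims [simp]: "dim_row (higgs_field r q \<alpha> p) = r" "dim_col (higgs_field r q \<alpha> p) = r"
  by (simp_all add: higgs_field_def)

lemma higgs_entry:
  assumes "i < r" "j < r"
  shows "higgs_field r q \<alpha> p $$ (i, j) = (if i = Suc j then sq r i else 0) +
    (\<Sum>l\<in>{2..r}. q l \<alpha> p * (if j = i + (l - 1) then wt r i j else 0))"
  using assms by (simp add: higgs_field_def Xminus_entry Xplus_pow_entry)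

text \<open>hbar times the derivative of \<open>tr\<close> when hbar z' = k and k is constant: only
  the power of z is differentiated, and hbar z' supplies the extra factor k.\<close>

definition dtr :: "nat \<Rightarrow> complex \<Rightarrow> complex \<Rightarrow> nat \<Rightarrow> nat \<Rightarrow> complex" where
  "dtr r z k i j = (if i \<le> j then of_int (int r - 1 - int i - int j) *
     z powi (int r - 2 - int i - int j) * k ^ Suc (j - i) * wt r i j / fact (j - i) else 0)"

text \<open>X_- accounts for the inhomogeneous term of the gauge law. Everything rests on s_(j+1) -
  s_i = (j + 1 - i)(r - 1 - i - j), whose first factor turns (j + 1 - i)! into (j - i)!. Just below
  the diagonal, at i = j + 1, the two terms cancel.\<close>

lemma tr_Xminus:
  assumes z: "z \<noteq> 0" and ij: "i < r" "j < r"
  shows "tr r z k i (Suc j) * sq r (Suc j) - sq r i * tr r z k (i - 1) j / z\<^sup>2 = dtr r z k i j"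
proof -
  consider "i \<le> j" | "i = Suc j" | "Suc j < i" by linarith
  then show ?thesis
  proof cases
    case 1
    let ?E = "int r - 2 - int i - int j" and ?n = "j - i"
    have A: "tr r z k i (Suc j) * sq r (Suc j) =
        z powi ?E * k ^ Suc ?n * wt r i j / fact (Suc ?n) * (of_nat (Suc j * (r - Suc j)))"
    proof -
      have e: "int r - 1 - int i - int (Suc j) = ?E" by simp
      have "tr r z k i (Suc j) = z powi ?E * k ^ Suc ?n * (wt r i j * sq r (Suc j)) / fact (Suc ?n)"
        using 1 unfolding tr_def e by (simp add: Suc_diff_le wt_Suc_right)
      then show ?thesis unfolding sq_square[symmetric] by simp
    qed
    have B: "sq r i * tr r z k (i - 1) j / z\<^sup>2 =
        z powi ?E * k ^ Suc ?n * wt r i j / fact (Suc ?n) * (of_nat (i * (r - i)))"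
    \<comment> \<open>For i = 0 both sides vanish because s_0 = 0, whatever the truncated i - 1
      is.\<close>
    proof (cases "i = 0")
      case False
      have e: "int r - 1 - int (i - 1) - int j = ?E + int 2" using False by simp
      have "tr r z k (i - 1) j = (z powi ?E * z\<^sup>2) * k ^ Suc ?n * (sq r i * wt r i j) / fact (Suc ?n)"
        using 1 False wt_Suc_left[of i j r] Suc_diff_le[OF 1]
        unfolding tr_def e power_int_add[OF disjI1[OF z]] power_int_of_nat
        by (auto simp: numeral_2_eq_2)
      then show ?thesis unfolding sq_square[symmetric] using z by simp
    qed simp
    have "of_nat (Suc j * (r - Suc j)) - of_nat (i * (r - i)) =
        (of_int (int r - 1 - int i - int j) * of_nat (Suc ?n) :: complex)"
      using 1 ij sq_nat[of "Suc j" r] sq_nat[of i r] by (simp add: of_nat_diff algebra_simps)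
    then have "tr r z k i (Suc j) * sq r (Suc j) - sq r i * tr r z k (i - 1) j / z\<^sup>2 =
       z powi ?E * k ^ Suc ?n * wt r i j / fact (Suc ?n) * (of_int (int r - 1 - int i - int j) * of_nat (Suc ?n))"
      unfolding A B right_diff_distrib[symmetric] by simp
    also have "\<dots> = dtr r z k i j"
      using 1 by (simp add: dtr_def field_simps del: of_nat_Suc)
    finally show ?thesis .
  next
    case 2
    have e: "int r - 1 - int (i - 1) - int j = (int r - 1 - int i - int i) + int 2" using 2 by simp
    have "tr r z k (i - 1) j = z powi (int r - 1 - int i - int i) * z\<^sup>2"
      using 2 unfolding tr_def e power_int_add[OF disjI1[OF z]] power_int_of_nat by simp
    moreover have "tr r z k i (Suc j) = z powi (int r - 1 - int i - int i)"
      using 2 by (simp add: tr_def)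
    ultimately show ?thesis using 2 z by (simp add: dtr_def)
  next
    case 3
    then show ?thesis by (auto simp: tr_def dtr_def)
  qed
qed

text \<open>X_+ commutes with its exponential, and z^H X_+ = z^2 X_+ z^H because [H, X_+] = 2 X_+;
  so moving X_+^m across costs z^(2m).\<close>

lemma tr_Xplus:
  assumes z: "z \<noteq> 0" and ij: "i < r" "j < r"
  shows "(\<Sum>k<r. tr r z c i k * (if j = k + m then wt r k j else 0)) / z ^ (2 * m) =
         (\<Sum>k<r. (if k = i + m then wt r i k else 0) * tr r z c k j)"
proof (cases "i + m \<le> j")
  case True
  have "(\<Sum>k<r. tr r z c i k * (if j = k + m then wt r k j else 0)) =
      (\<Sum>k<r. if k = j - m then tr r z c i (j - m) * wt r (j - m) j else 0)"
    using True by (intro sum.cong) auto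
  also have "\<dots> = tr r z c i (j - m) * wt r (j - m) j" using ij by simp
  also have "\<dots> = z powi (int r - 1 - int i - int (j - m)) * c ^ (j - m - i) * wt r i j / fact (j - m - i)"
    using True wt_trans[of i "j - m" j r] by (simp add: tr_def)
  also have "int r - 1 - int i - int (j - m) = (int r - 1 - int (i + m) - int j) + int (2 * m)"
    using True by simp
  also have "z powi \<dots> = z powi (int r - 1 - int (i + m) - int j) * z ^ (2 * m)"
    by (simp only: power_int_add[OF disjI1[OF z]] power_int_of_nat)
  finally have L: "(\<Sum>k<r. tr r z c i k * (if j = k + m then wt r k j else 0)) / z ^ (2 * m) =
      z powi (int r - 1 - int (i + m) - int j) * c ^ (j - m - i) * wt r i j / fact (j - m - i)"
    using z by simp
  have "(\<Sum>k<r. (if k = i + m then wt r i k else 0) * tr r z c k j) =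
      (\<Sum>k<r. if k = i + m then wt r i (i + m) * tr r z c (i + m) j else 0)"
    by (intro sum.cong) auto
  also have "\<dots> = wt r i (i + m) * tr r z c (i + m) j" using True ij by simp
  also have "\<dots> = z powi (int r - 1 - int (i + m) - int j) * c ^ (j - (i + m)) *
      (wt r i (i + m) * wt r (i + m) j) / fact (j - (i + m))"
    using True by (simp add: tr_def)
  also have "wt r i (i + m) * wt r (i + m) j = wt r i j" using True by (intro wt_trans) auto
  finally show ?thesis unfolding L using True by (simp add: diff_diff_add add.commute)
next
  case False
  then have "tr r z c i k * (if j = k + m then wt r k j else 0) = 0"
    "(if k = i + m then wt r i k else 0) * tr r z c k j = 0" for k
    by (auto simp: tr_def)
  then show ?thesis by (simp only: sum.neutral_const div_0)
qed

text \<open>The gauge transformation law of the connections, \<open>\<hbar> \<partial>f = f \<phi>\<^sub>\<beta> - (dx\<^sub>\<alpha> / dx\<^sub>\<beta>) \<phi>\<^sub>\<alpha> f\<close>; the derivative of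
  \<open>\<xi>\<close> is constant.\<close>

lemma gauge_law:
  assumes z: "z \<noteq> 0" and ij: "i < r" "j < r"
    and q: "\<And>l. l \<in> {2..r} \<Longrightarrow> q l \<beta> p = q l \<alpha> p / z ^ (2 * l)"
  shows "(\<Sum>k<r. tr r z c i k * higgs_field r q \<beta> p $$ (k, j)) -
    (\<Sum>k<r. higgs_field r q \<alpha> p $$ (i, k) * tr r z c k j) / z\<^sup>2 = dtr r z c i j"
proof -
  have "(\<Sum>k<r. tr r z c i k * higgs_field r q \<beta> p $$ (k, j)) =
     (\<Sum>k<r. tr r z c i k * (if k = Suc j then sq r k else 0)) +
     (\<Sum>l\<in>{2..r}. q l \<beta> p * (\<Sum>k<r. tr r z c i k * (if j = k + (l - 1) then wt r k j else 0)))"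
  proof -
    have "(\<Sum>k<r. tr r z c i k * higgs_field r q \<beta> p $$ (k, j)) =
      (\<Sum>k<r. tr r z c i k * (if k = Suc j then sq r k else 0) +
       (\<Sum>l\<in>{2..r}. q l \<beta> p * (tr r z c i k * (if j = k + (l - 1) then wt r k j else 0))))"
      using ij by (intro sum.cong) (auto simp: higgs_entry distrib_left sum_distrib_left intro!: sum.cong)
    then show ?thesis
      by (simp add: sum.distrib sum_distrib_left) (rule sum.swap)
  qed
  moreover have "(\<Sum>k<r. tr r z c i k * (if k = Suc j then sq r k else 0)) = tr r z c i (Suc j) * sq r (Suc j)"
  proof (cases "Suc j = r")
    \<comment> \<open>\<open>Suc j\<close> is then out of range as a summation index, and the right
      side vanishes because s_r = 0.\<close>
    case True
    then have "tr r z c i k * (if k = Suc j then sq r k else 0) = 0" for k by auto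
    then show ?thesis using True sq_r[of r] by simp
  next
    case False
    have "(\<Sum>k<r. tr r z c i k * (if k = Suc j then sq r k else 0)) =
       (\<Sum>k<r. if k = Suc j then tr r z c i (Suc j) * sq r (Suc j) else 0)" by (intro sum.cong) auto
    then show ?thesis using False ij by simp
  qed
  moreover have "(\<Sum>k<r. higgs_field r q \<alpha> p $$ (i, k) * tr r z c k j) =
     (\<Sum>k<r. (if i = Suc k then sq r i else 0) * tr r z c k j) +
     (\<Sum>l\<in>{2..r}. q l \<alpha> p * (\<Sum>k<r. (if k = i + (l - 1) then wt r i k else 0) * tr r z c k j))"
  proof -
    have "(\<Sum>k<r. higgs_field r q \<alpha> p $$ (i, k) * tr r z c k j) =
      (\<Sum>k<r. (if i = Suc k then sq r i else 0) * tr r z c k j +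
       (\<Sum>l\<in>{2..r}. q l \<alpha> p * ((if k = i + (l - 1) then wt r i k else 0) * tr r z c k j)))"
      using ij by (intro sum.cong) (auto simp: higgs_entry distrib_right sum_distrib_right mult.assoc intro!: sum.cong)
    then show ?thesis
      by (simp add: sum.distrib sum_distrib_left) (rule sum.swap)
  qed
  moreover have "(\<Sum>k<r. (if i = Suc k then sq r i else 0) * tr r z c k j) = sq r i * tr r z c (i - 1) j"
  proof -
    have "(\<Sum>k<r. (if i = Suc k then sq r i else 0) * tr r z c k j) =
       (\<Sum>k<r. if k = i - 1 then sq r i * tr r z c (i - 1) j else 0)"
      by (intro sum.cong) (cases i; auto)+
    then show ?thesis using ij by simp
  qed
  moreover have "(\<Sum>l\<in>{2..r}. q l \<beta> p * (\<Sum>k<r. tr r z c i k * (if j = k + (l - 1) then wt r k j else 0))) =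
     (\<Sum>l\<in>{2..r}. q l \<alpha> p * (\<Sum>k<r. (if k = i + (l - 1) then wt r i k else 0) * tr r z c k j)) / z\<^sup>2"
    unfolding sum_divide_distrib
  proof (rule sum.cong)
    fix l assume l: "l \<in> {2..r}"
    \<comment> \<open>The weight 2l of q_l splits into 2(l - 1), absorbed by X_+^(l-1), and 2, which
      is the factor from the change of dx.\<close>
    then have l2: "2 * l = 2 * (l - 1) + 2" by auto
    have "z ^ (2 * l) = z ^ (2 * (l - 1)) * z\<^sup>2" by (subst l2) (rule power_add)
    then show "q l \<beta> p * (\<Sum>k<r. tr r z c i k * (if j = k + (l - 1) then wt r k j else 0)) =
      q l \<alpha> p * (\<Sum>k<r. (if k = i + (l - 1) then wt r i k else 0) * tr r z c k j) / z\<^sup>2"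
      unfolding tr_Xplus[OF z ij, symmetric] using q[OF l] by simp
  qed simp
  ultimately show ?thesis
    using tr_Xminus[OF z ij, of c] by (simp add: add_divide_distrib)
qed

section \<open>Sections of the dual oper bundle\<close>

locale theta_structure = projective_structure X \<A> S
  for X :: "'a topology" and \<A> and S :: "('a, 'i) coord_system" +
  fixes \<xi> :: "'i \<Rightarrow> 'i \<Rightarrow> 'a \<Rightarrow> complex"
  assumes theta: "theta_characteristic S \<xi>"
begin

abbreviation kap :: "'i \<Rightarrow> 'i \<Rightarrow> 'a \<Rightarrow> complex" where "kap \<alpha> \<beta> \<equiv> ddx S \<beta> (\<xi> \<alpha> \<beta>)"

lemma xi_pm:
  assumes "\<alpha> \<in> Idx S" "\<beta> \<in> Idx S" "p \<in> Nbhd S \<alpha>" "p \<in> Nbhd S \<beta>"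
  shows "\<xi> \<alpha> \<beta> p = cz \<alpha> \<beta> p \<or> \<xi> \<alpha> \<beta> p = - cz \<alpha> \<beta> p"
proof -
  have "\<forall>p \<in> Nbhd S \<alpha> \<inter> Nbhd S \<beta>. \<xi> \<alpha> \<beta> p = cz \<alpha> \<beta> p \<or> \<xi> \<alpha> \<beta> p = - cz \<alpha> \<beta> p"
    using theta assms(1,2) unfolding theta_characteristic_def cz_def by blast
  with assms show ?thesis by blast
qed

lemma xi_nonzero:
  assumes "\<alpha> \<in> Idx S" "\<beta> \<in> Idx S" "p \<in> Nbhd S \<alpha>" "p \<in> Nbhd S \<beta>"
  shows "\<xi> \<alpha> \<beta> p \<noteq> 0"
  using xi_pm[OF assms] moebius_eq(1)[OF assms] by auto

lemma xi_square:
  assumes "\<alpha> \<in> Idx S" "\<beta> \<in> Idx S" "p \<in> Nbhd S \<alpha>" "p \<in> Nbhd S \<beta>"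
  shows "\<xi> \<alpha> \<beta> p * \<xi> \<alpha> \<beta> p = cz \<alpha> \<beta> p * cz \<alpha> \<beta> p"
  using xi_pm[OF assms] by auto

lemma dcoord_xi:
  assumes "\<alpha> \<in> Idx S" "\<beta> \<in> Idx S" "p \<in> Nbhd S \<alpha>" "p \<in> Nbhd S \<beta>"
  shows "dcoord S \<alpha> \<beta> p = 1 / (\<xi> \<alpha> \<beta> p)\<^sup>2"
  using dcoord_eq[OF assms] xi_square[OF assms] by (simp add: power2_eq_square)

lemma xi_cocycle:
  assumes "\<alpha> \<in> Idx S" "\<beta> \<in> Idx S" "\<gamma> \<in> Idx S" "p \<in> Nbhd S \<alpha>" "p \<in> Nbhd S \<beta>" "p \<in> Nbhd S \<gamma>"
  shows "\<xi> \<alpha> \<beta> p * \<xi> \<beta> \<gamma> p = \<xi> \<alpha> \<gamma> p"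
proof -
  have "\<forall>p \<in> Nbhd S \<alpha> \<inter> Nbhd S \<beta> \<inter> Nbhd S \<gamma>. \<xi> \<alpha> \<beta> p * \<xi> \<beta> \<gamma> p = \<xi> \<alpha> \<gamma> p"
    using theta assms(1-3) unfolding theta_characteristic_def by blast
  with assms show ?thesis by blast
qed

lemma xi_self:
  assumes "\<alpha> \<in> Idx S" "p \<in> Nbhd S \<alpha>"
  shows "\<xi> \<alpha> \<alpha> p = 1"
  using xi_cocycle[of \<alpha> \<alpha> \<alpha> p] xi_nonzero[of \<alpha> \<alpha> p] assms by simp

lemma xi_diffable:
  assumes "\<alpha> \<in> Idx S" "\<beta> \<in> Idx S" "p \<in> Nbhd S \<alpha>" "p \<in> Nbhd S \<beta>"
  shows "diffable (\<xi> \<alpha> \<beta>) p"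
proof (rule diffable_one_chart[OF assms(2,4)])
  have "(\<xi> \<alpha> \<beta> \<circ> pt S \<beta>) holomorphic_on (Coord S \<beta> ` (Nbhd S \<alpha> \<inter> Nbhd S \<beta>))"
    using theta assms(1,2) unfolding theta_characteristic_def by blast
  then show "(\<xi> \<alpha> \<beta> \<circ> pt S \<beta>) field_differentiable at (Coord S \<beta> p)"
    by (rule holomorphic_on_imp_differentiable_at)
       (use assms open_Coord_image[OF assms(2) openin_Nbhd[OF assms(1)]] in auto)
qed

lemma openin_overlap: "\<alpha> \<in> Idx S \<Longrightarrow> \<beta> \<in> Idx S \<Longrightarrow> openin X (Nbhd S \<alpha> \<inter> Nbhd S \<beta>)"
  by (intro openin_Int openin_Nbhd)

lemma kap_diffable:
  assumes "\<alpha> \<in> Idx S" "\<beta> \<in> Idx S" "p \<in> Nbhd S \<alpha>" "p \<in> Nbhd S \<beta>"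
  shows "diffable (kap \<alpha> \<beta>) p"
  by (rule diffable_ddx[OF assms(2) openin_overlap[OF assms(1,2)]]) (use assms xi_diffable in auto)

text \<open>Half the derivative of \<xi>^2 = (c x + d)^2, which avoids a decision about the
  sign.\<close>

lemma xi_kap:
  assumes "\<alpha> \<in> Idx S" "\<beta> \<in> Idx S" "p \<in> Nbhd S \<alpha>" "p \<in> Nbhd S \<beta>"
  shows "\<xi> \<alpha> \<beta> p * kap \<alpha> \<beta> p = cz \<alpha> \<beta> p * Moebius S \<alpha> \<beta> $$ (1, 0)"
proof -
  let ?c = "Moebius S \<alpha> \<beta> $$ (1, 0)" and ?d = "Moebius S \<alpha> \<beta> $$ (1, 1)"
  have cz: "diffable (cz \<alpha> \<beta>) p"
    unfolding cz_def[abs_def]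
    by (intro diffable_add diffable_mult diffable_const diffable_Coord assms)
  have "ddx S \<beta> (cz \<alpha> \<beta>) p = ddx S \<beta> (\<lambda>q. ?c * Coord S \<beta> q + ?d) p"
    by (simp add: cz_def[abs_def])
  also have "\<dots> = ?c * dcoord S \<beta> \<beta> p"
    using assms by (simp add: ddx_add ddx_mult diffable_mult diffable_const diffable_Coord ddx_const dcoord_def)
  finally have dcz: "ddx S \<beta> (cz \<alpha> \<beta>) p = ?c" using dcoord_self[OF assms(2,4)] by simp
  have "ddx S \<beta> (\<lambda>q. \<xi> \<alpha> \<beta> q * \<xi> \<alpha> \<beta> q) p = ddx S \<beta> (\<lambda>q. cz \<alpha> \<beta> q * cz \<alpha> \<beta> q) p"
    by (rule ddx_cong[OF assms(2) openin_overlap[OF assms(1,2)]])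
       (use assms xi_square diffable_mult[OF cz cz] in auto)
  then have "2 * (\<xi> \<alpha> \<beta> p * kap \<alpha> \<beta> p) = 2 * (cz \<alpha> \<beta> p * ?c)"
    using ddx_mult[OF assms(2,4) xi_diffable[OF assms] xi_diffable[OF assms]]
      ddx_mult[OF assms(2,4) cz cz] dcz by (simp add: algebra_simps)
  then show ?thesis by simp
qed

text \<open>Differentiating \<xi> \<kappa> = c (c x + d) gives \<kappa>^2 + \<xi> \<kappa>' = c^2;
  squaring it instead and cancelling \<xi>^2 = (c x + d)^2 gives \<kappa>^2 = c^2.\<close>

lemma ddx_kap:
  assumes "\<alpha> \<in> Idx S" "\<beta> \<in> Idx S" "p \<in> Nbhd S \<alpha>" "p \<in> Nbhd S \<beta>"
  shows "ddx S \<beta> (kap \<alpha> \<beta>) p = 0"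
proof -
  let ?c = "Moebius S \<alpha> \<beta> $$ (1, 0)" and ?d = "Moebius S \<alpha> \<beta> $$ (1, 1)"
  let ?z = "\<xi> \<alpha> \<beta> p" and ?k = "kap \<alpha> \<beta> p"
  have cz: "diffable (\<lambda>q. cz \<alpha> \<beta> q * ?c) p"
    unfolding cz_def[abs_def]
    by (intro diffable_add diffable_mult diffable_const diffable_Coord assms)
  have "ddx S \<beta> (\<lambda>q. cz \<alpha> \<beta> q * ?c) p = ddx S \<beta> (\<lambda>q. (?c * Coord S \<beta> q + ?d) * ?c) p"
    by (simp add: cz_def[abs_def])
  also have "\<dots> = ?c * dcoord S \<beta> \<beta> p * ?c"
    using assms
    by (simp add: ddx_add ddx_mult diffable_add diffable_mult diffable_const diffable_Coord ddx_const dcoord_def)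
  finally have "ddx S \<beta> (\<lambda>q. cz \<alpha> \<beta> q * ?c) p = ?c * ?c" using dcoord_self[OF assms(2,4)] by simp
  moreover have "ddx S \<beta> (\<lambda>q. \<xi> \<alpha> \<beta> q * kap \<alpha> \<beta> q) p = ddx S \<beta> (\<lambda>q. cz \<alpha> \<beta> q * ?c) p"
    by (rule ddx_cong[OF assms(2) openin_overlap[OF assms(1,2)]]) (use assms xi_kap cz in auto)
  ultimately have "?k * ?k + ?z * ddx S \<beta> (kap \<alpha> \<beta>) p = ?c * ?c"
    using ddx_mult[OF assms(2,4) xi_diffable[OF assms] kap_diffable[OF assms]] by simp
  moreover have "?k * ?k = ?c * ?c"
  proof -
    have "(?z * ?z) * (?k * ?k) = (?z * ?k) * (?z * ?k)" by (simp only: mult_ac)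
    also have "\<dots> = (?z * ?z) * (?c * ?c)"
      unfolding xi_kap[OF assms] xi_square[OF assms] by (simp only: mult_ac)
    finally show ?thesis using xi_nonzero[OF assms] by simp
  qed
  ultimately show ?thesis using xi_nonzero[OF assms] by simp
qed

text \<open>The product rule for the cocycle \<xi>, with d/dx_\<gamma> rewritten by d/dx_\<beta> on
  the first factor. The result has the form of the second argument in
  \<open>tr_cocycle\<close>.\<close>

lemma kap_cocycle:
  assumes "\<alpha> \<in> Idx S" "\<beta> \<in> Idx S" "\<gamma> \<in> Idx S" "p \<in> Nbhd S \<alpha>" "p \<in> Nbhd S \<beta>" "p \<in> Nbhd S \<gamma>"
  shows "kap \<alpha> \<gamma> p = kap \<beta> \<gamma> p * \<xi> \<alpha> \<beta> p + kap \<alpha> \<beta> p / \<xi> \<beta> \<gamma> p"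
proof -
  have ab: "diffable (\<xi> \<alpha> \<beta>) p" and bg: "diffable (\<xi> \<beta> \<gamma>) p" using xi_diffable assms by auto
  have "kap \<alpha> \<gamma> p = ddx S \<gamma> (\<lambda>q. \<xi> \<alpha> \<beta> q * \<xi> \<beta> \<gamma> q) p"
    by (rule ddx_cong[OF assms(3) openin_Int[OF openin_overlap[OF assms(1,2)] openin_Nbhd[OF assms(3)]]])
       (use assms xi_cocycle diffable_mult[OF ab bg] in auto)
  also have "\<dots> = ddx S \<gamma> (\<xi> \<alpha> \<beta>) p * \<xi> \<beta> \<gamma> p + \<xi> \<alpha> \<beta> p * kap \<beta> \<gamma> p"
    by (rule ddx_mult[OF assms(3,6) ab bg])
  also have "ddx S \<gamma> (\<xi> \<alpha> \<beta>) p = kap \<alpha> \<beta> p * (1 / (\<xi> \<beta> \<gamma> p)\<^sup>2)"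
    using ddx_change_chart[OF assms(3,2,6,5) ab] dcoord_xi[OF assms(2,3,5,6)] by simp
  finally show ?thesis
    using xi_nonzero[OF assms(2,3,5,6)] by (simp add: power2_eq_square mult.commute)
qed

lemma kap_self:
  assumes "\<alpha> \<in> Idx S" "p \<in> Nbhd S \<alpha>"
  shows "kap \<alpha> \<alpha> p = 0"
  using kap_cocycle[of \<alpha> \<alpha> \<alpha> p] xi_self assms by simp

abbreviation oper_tr :: "nat \<Rightarrow> complex \<Rightarrow> 'i \<Rightarrow> 'i \<Rightarrow> nat \<Rightarrow> nat \<Rightarrow> 'a \<Rightarrow> complex" where
  "oper_tr r h \<alpha> \<beta> i j p \<equiv> tr r (\<xi> \<alpha> \<beta> p) (h * kap \<alpha> \<beta> p) i j"

text \<open>\<kappa> is constant, so only the power of \<xi> contributes to the derivative.\<close>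

lemma oper_tr_deriv:
  assumes "\<alpha> \<in> Idx S" "\<beta> \<in> Idx S" "p \<in> Nbhd S \<alpha>" "p \<in> Nbhd S \<beta>"
  shows "diffable (oper_tr r h \<alpha> \<beta> i j) p"
    and "h * ddx S \<beta> (oper_tr r h \<alpha> \<beta> i j) p = dtr r (\<xi> \<alpha> \<beta> p) (h * kap \<alpha> \<beta> p) i j"
proof -
  let ?x = "Coord S \<beta> p"
  let ?D = "if i \<le> j then of_int (int r - 1 - int i - int j) * \<xi> \<alpha> \<beta> p powi (int r - 2 - int i - int j)
      * kap \<alpha> \<beta> p * (h * kap \<alpha> \<beta> p) ^ (j - i) * wt r i j / fact (j - i) else 0"
  define F where "F = \<xi> \<alpha> \<beta> \<circ> pt S \<beta>"
  define G where "G = kap \<alpha> \<beta> \<circ> pt S \<beta>"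
  have F: "(F has_field_derivative kap \<alpha> \<beta> p) (at ?x)"
    unfolding F_def by (rule diffable_has_ddx[OF xi_diffable[OF assms] assms(2,4)])
  have G: "(G has_field_derivative 0) (at ?x)"
    unfolding G_def using diffable_has_ddx[OF kap_diffable[OF assms] assms(2,4)] ddx_kap[OF assms] by simp
  have Fx: "F ?x = \<xi> \<alpha> \<beta> p" "G ?x = kap \<alpha> \<beta> p" using assms by (simp_all add: F_def G_def pt_Coord)
  have nz: "F ?x \<noteq> 0" using Fx xi_nonzero[OF assms] by simp
  have "((\<lambda>x. tr r (F x) (h * G x) i j) has_field_derivative ?D) (at ?x)"
  proof (cases "i \<le> j")
    case True
    have e: "int r - 1 - int i - int j - 1 = int r - 2 - int i - int j" by simp
    have "((\<lambda>x. F x powi (int r - 1 - int i - int j) * ((h * G x) ^ (j - i) * wt r i j / fact (j - i)))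
        has_field_derivative
        (of_int (int r - 1 - int i - int j) * F ?x powi (int r - 1 - int i - int j - 1) * kap \<alpha> \<beta> p)
          * ((h * G ?x) ^ (j - i) * wt r i j / fact (j - i))
        + 0 * F ?x powi (int r - 1 - int i - int j)) (at ?x)"
    proof (rule DERIV_mult)
      show "((\<lambda>x. F x powi (int r - 1 - int i - int j)) has_field_derivative
        of_int (int r - 1 - int i - int j) * F ?x powi (int r - 1 - int i - int j - 1) * kap \<alpha> \<beta> p) (at ?x)"
        using F nz by (auto intro!: derivative_eq_intros)
      show "((\<lambda>x. (h * G x) ^ (j - i) * wt r i j / fact (j - i)) has_field_derivative 0) (at ?x)"
        using G by (auto intro!: derivative_eq_intros)
    qed
    then show ?thesis using True unfolding e by (simp add: tr_def Fx mult_ac)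
  qed (simp add: tr_def)
  then have D: "((oper_tr r h \<alpha> \<beta> i j \<circ> pt S \<beta>) has_field_derivative ?D) (at ?x)"
    by (simp add: F_def G_def comp_def)
  then show "diffable (oper_tr r h \<alpha> \<beta> i j) p"
    using diffable_one_chart[OF assms(2,4)] by (auto simp: field_differentiable_def)
  have "ddx S \<beta> (oper_tr r h \<alpha> \<beta> i j) p = ?D" by (rule ddx_eqI[OF assms(2,4) D])
  then show "h * ddx S \<beta> (oper_tr r h \<alpha> \<beta> i j) p = dtr r (\<xi> \<alpha> \<beta> p) (h * kap \<alpha> \<beta> p) i j"
    by (simp add: dtr_def mult_ac)
qed

text \<open>hbar enters the entry (i, j) only as hbar^(j-i), so the entry at hbar = 1 is its single
  coefficient.\<close>

lemma oper_tr_hbar: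
  assumes "\<alpha> \<in> Idx S" "\<beta> \<in> Idx S"
  shows "(\<lambda>p h. if p \<in> Nbhd S \<alpha> \<inter> Nbhd S \<beta> then oper_tr r h \<alpha> \<beta> i j p else 0)
    \<in> holfun_hbar S (Nbhd S \<alpha> \<inter> Nbhd S \<beta>)"
proof -
  let ?W = "Nbhd S \<alpha> \<inter> Nbhd S \<beta>"
  have W: "openin X ?W" by (rule openin_overlap[OF assms])
  have "(\<lambda>p. if p \<in> ?W then oper_tr r 1 \<alpha> \<beta> i j p else 0) \<in> holfun S ?W"
    by (rule holfun_indicator[OF W]) (use oper_tr_deriv(1)[OF assms, of _ r 1 i j] in blast)
  from hbar_monom[OF W this, of "j - i"]
  have "(\<lambda>p h. (if p \<in> ?W then oper_tr r 1 \<alpha> \<beta> i j p else 0) * h ^ (j - i)) \<in> holfun_hbar S ?W" .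
  moreover have "(\<lambda>p h. (if p \<in> ?W then oper_tr r 1 \<alpha> \<beta> i j p else 0) * h ^ (j - i)) =
     (\<lambda>p h. if p \<in> ?W then oper_tr r h \<alpha> \<beta> i j p else 0)"
    by (auto simp: fun_eq_iff tr_def power_mult_distrib)
  ultimately show ?thesis by simp
qed

lemma oper_tr_cocycle:
  assumes "\<alpha> \<in> Idx S" "\<beta> \<in> Idx S" "\<gamma> \<in> Idx S" "p \<in> Nbhd S \<alpha>" "p \<in> Nbhd S \<beta>" "p \<in> Nbhd S \<gamma>"
    and "i < r" "j < r"
  shows "(\<Sum>k<r. oper_tr r h \<alpha> \<beta> i k p * oper_tr r h \<beta> \<gamma> k j p) = oper_tr r h \<alpha> \<gamma> i j p"
  using tr_cocycle[OF xi_nonzero[OF assms(1,2,4,5)] xi_nonzero[OF assms(2,3,5,6)] assms(7,8),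
      of "h * kap \<alpha> \<beta> p" "h * kap \<beta> \<gamma> p"]
    kap_cocycle[OF assms(1-6)] xi_cocycle[OF assms(1-6)]
  by (simp add: algebra_simps)

lemma oper_transpose_mult:
  assumes "\<alpha> \<in> Idx S" "\<beta> \<in> Idx S" "p \<in> Nbhd S \<alpha>" "p \<in> Nbhd S \<beta>" "v \<in> carrier_vec r" "j < r"
  shows "(transpose_mat (oper_bundle S \<xi> r h \<alpha> \<beta> p) *\<^sub>v v) $ j =
     (\<Sum>i<r. oper_tr r h \<alpha> \<beta> i j p * v $ i)"
  using assms oper_bundle_carrier[of S \<xi> r h \<alpha> \<beta> p] xi_nonzero[OF assms(1-4)]
  by (auto simp: scalar_prod_def atLeast0LessThan oper_bundle_entry intro!: sum.cong)

end

section \<open>Covector sections over one chart as a free module with connection\<close>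

locale oper_patch = theta_structure X \<A> S \<xi> + coordinate_patch X \<A> S \<alpha>
  for X :: "'a topology" and \<A> and S :: "('a, 'i) coord_system" and \<xi> \<alpha> +
  fixes r :: nat and q :: "nat \<Rightarrow> 'i \<Rightarrow> 'a \<Rightarrow> complex"
  assumes r: "r \<ge> 2"
    and q: "\<forall>l\<in>{2..r}. q l \<in> pluricanonical S l"
begin

text \<open>Row vectors in the frame of chart \<alpha>, padded with zeros to sequences, which form
  an additive group without any bookkeeping of dimensions.\<close>

definition Mods :: "(nat \<Rightarrow> 'a \<Rightarrow> complex \<Rightarrow> complex) set" where
  "Mods = {m. (\<forall>j<r. m j \<in> \<O>) \<and> (\<forall>j\<ge>r. m j = 0)}"

text \<open>The entries do not depend on hbar but are stored as elements of O[hbar], hence the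
  cut-off outside U.\<close>

definition \<Phi> :: "nat \<Rightarrow> nat \<Rightarrow> 'a \<Rightarrow> complex \<Rightarrow> complex" where
  "\<Phi> i j p h = (if p \<in> N then higgs_field r q \<alpha> p $$ (i, j) else 0)"

definition smod :: "('a \<Rightarrow> complex \<Rightarrow> complex) \<Rightarrow> (nat \<Rightarrow> 'a \<Rightarrow> complex \<Rightarrow> complex) \<Rightarrow>
    nat \<Rightarrow> 'a \<Rightarrow> complex \<Rightarrow> complex" where
  "smod a m = (\<lambda>j. a * m j)"

definition nab :: "(nat \<Rightarrow> 'a \<Rightarrow> complex \<Rightarrow> complex) \<Rightarrow> nat \<Rightarrow> 'a \<Rightarrow> complex \<Rightarrow> complex" where
  "nab m j = (if j < r then \<delta> (m j) - (\<Sum>i<r. \<Phi> i j * m i) else 0)"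

lemma q_holfun: "l \<in> {2..r} \<Longrightarrow> \<beta> \<in> Idx S \<Longrightarrow> q l \<beta> \<in> holfun S (Nbhd S \<beta>)"
  using q by (auto simp: pluricanonical_def)

lemma q_transform:
  assumes "l \<in> {2..r}" "\<beta> \<in> Idx S" "\<gamma> \<in> Idx S" "p \<in> Nbhd S \<beta>" "p \<in> Nbhd S \<gamma>"
  shows "q l \<beta> p = dcoord S \<gamma> \<beta> p ^ l * q l \<gamma> p"
  using q assms unfolding pluricanonical_def by blast

lemma \<Phi>_in: "i < r \<Longrightarrow> j < r \<Longrightarrow> \<Phi> i j \<in> \<O>"
proof -
  assume ij: "i < r" "j < r"
  have "(\<lambda>p. if p \<in> N then higgs_field r q \<alpha> p $$ (i, j) else 0) \<in> holfun S N"
  proof (rule holfun_indicator[OF N])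
    fix p assume "p \<in> N"
    then show "diffable (\<lambda>p. higgs_field r q \<alpha> p $$ (i, j)) p"
      unfolding higgs_entry[OF ij]
      by (intro diffable_add diffable_const diffable_sum diffable_mult)
         (use q_holfun[OF _ \<alpha>] holfun_diffable[OF N] in auto)
  qed
  from hbar_of_holfun[OF N this] show ?thesis by (simp add: \<Phi>_def[abs_def])
qed

sublocale dm: differential_module \<O> unit \<delta> Mods smod nab
proof (unfold_locales, goal_cases)
  case 1 show ?case by (simp add: Mods_def dr.R_zero)
next
  case (2 v w) then show ?case by (simp add: Mods_def dr.R_add)
next
  case (3 a v) then show ?case by (simp add: Mods_def smod_def dr.R_mult)
next
  case (4 a b v) show ?case by (simp add: smod_def fun_eq_iff distrib_right)
next
  case (5 a v w) show ?case by (simp add: smod_def fun_eq_iff distrib_left)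
next
  case (6 a b v) show ?case by (simp add: smod_def mult.assoc)
next
  case (7 v)
  then have "unit * v j = v j" for j
    using dr.unit_mult[of "v j"] by (cases "j < r") (auto simp: Mods_def)
  then show ?case by (simp add: smod_def)
next
  case (8 v)
  then show ?case
    by (auto simp: Mods_def nab_def intro!: dr.R_minus dr.R_deriv dr.R_sum dr.R_mult \<Phi>_in)
next
  case (9 v w)
  have "nab (v + w) j = (nab v + nab w) j" for j
    using 9 by (auto simp: Mods_def nab_def dr.deriv_add distrib_left sum.distrib)
  then show ?case by blast
next
  case (10 a v)
  have "nab (smod a v) j = (smod (\<delta> a) v + smod a (nab v)) j" for j
  proof (cases "j < r")
    case True
    have "(\<Sum>i<r. \<Phi> i j * (a * v i)) = a * (\<Sum>i<r. \<Phi> i j * v i)"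
      by (simp add: sum_distrib_left mult.left_commute)
    then show ?thesis
      using 10 True by (simp add: Mods_def nab_def smod_def dr.deriv_mult right_diff_distrib)
  next
    case False
    then show ?thesis using 10 by (simp add: Mods_def nab_def smod_def)
  qed
  then show ?case by blast
qed

abbreviation trf :: "complex \<Rightarrow> ('a, 'i) transition" where "trf \<equiv> oper_bundle S \<xi> r"
abbreviation con :: "complex \<Rightarrow> ('a, 'i) matrix_form" where "con \<equiv> oper_hbar_connection r q"
abbreviation Sec :: "('a, 'i) covector set" where "Sec \<equiv> covector_sections S r trf N"

text \<open>For hbar \<noteq> 0 the factor 1/hbar cancels, and the value at hbar = 0 is set
  consistently with this.\<close>

lemma B_eq: "con h \<beta> p = higgs_field r q \<beta> p"
proof -
  have "h \<cdot>\<^sub>m ((1 / h) \<cdot>\<^sub>m higgs_field r q \<beta> p) = higgs_field r q \<beta> p" if "h \<noteq> 0"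
    by (rule eq_matI) (use that in auto)
  then show ?thesis by (simp add: oper_hbar_connection_def oper_connection_def)
qed

text \<open>The section with given components in chart \<alpha>; in every other chart its components
  are forced by the law that covectors transform by right multiplication with the transition
  matrix.\<close>

definition sec :: "(nat \<Rightarrow> 'a \<Rightarrow> complex \<Rightarrow> complex) \<Rightarrow> ('a, 'i) covector" where
  "sec m = (\<lambda>\<beta> p h. if \<beta> \<in> Idx S \<and> p \<in> N \<inter> Nbhd S \<beta> then
     Matrix.vec r (\<lambda>j. \<Sum>i<r. oper_tr r h \<alpha> \<beta> i j p * m i p h) else 0\<^sub>v r)"

definition comps :: "('a, 'i) covector \<Rightarrow> nat \<Rightarrow> 'a \<Rightarrow> complex \<Rightarrow> complex" where
  "comps v = (\<lambda>j p h. if j < r then v \<alpha> p h $ j else 0)"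

lemma sec_carrier: "sec m \<beta> p h \<in> carrier_vec r"
  by (simp add: sec_def)

text \<open>Compatibility between two further charts is the cocycle condition of the transition
  matrices.\<close>

lemma sec_in:
  assumes m: "m \<in> Mods"
  shows "sec m \<in> Sec"
  unfolding covector_sections_def
proof (intro CollectI conjI allI ballI impI)
  fix \<beta> p h show "sec m \<beta> p h \<in> carrier_vec r" by (rule sec_carrier)
next
  fix \<beta> p h assume "\<beta> \<notin> Idx S" then show "sec m \<beta> p h = 0\<^sub>v r" by (simp add: sec_def)
next
  fix \<beta> j assume \<beta>: "\<beta> \<in> Idx S" and j: "j < r"
  let ?W = "N \<inter> Nbhd S \<beta>"
  have W: "openin X ?W" by (rule openin_overlap[OF \<alpha> \<beta>])
  have restr: "(\<lambda>p h. if p \<in> ?W then u p h else 0) \<in> holfun_hbar S ?W" if u: "u \<in> \<O>" for u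
  proof -
    obtain n c where c: "\<And>k. k \<le> n \<Longrightarrow> c k \<in> holfun S N" "u = (\<lambda>p h. \<Sum>k\<le>n. c k p * h ^ k)"
      using u by (auto simp: holfun_hbar_def)
    have "(\<lambda>p h. if p \<in> ?W then u p h else 0) = (\<lambda>p h. \<Sum>k\<le>n. (if p \<in> ?W then c k p else 0) * h ^ k)"
      by (auto simp: c(2) fun_eq_iff)
    also have "\<dots> \<in> holfun_hbar S ?W"
      by (intro hbar_sum[OF W] hbar_monom[OF W] holfun_indicator[OF W])
         (use c(1) holfun_diffable[OF N] in auto)
    finally show ?thesis .
  qed
  have "(\<lambda>p h. sec m \<beta> p h $ j) = (\<lambda>p h. \<Sum>i<r. (if p \<in> ?W then oper_tr r h \<alpha> \<beta> i j p else 0) *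
      (if p \<in> ?W then m i p h else 0))"
    using \<beta> j by (auto simp: sec_def fun_eq_iff)
  also have "\<dots> \<in> holfun_hbar S ?W"
    by (intro hbar_sum[OF W] hbar_mult[OF W] oper_tr_hbar[OF \<alpha> \<beta>] restr) (use m in \<open>auto simp: Mods_def\<close>)
  finally show "(\<lambda>p h. sec m \<beta> p h $ j) \<in> holfun_hbar S ?W" .
next
  fix \<beta> \<gamma> p h assume \<beta>: "\<beta> \<in> Idx S" and \<gamma>: "\<gamma> \<in> Idx S" and p: "p \<in> N \<inter> Nbhd S \<beta> \<inter> Nbhd S \<gamma>"
  show "sec m \<gamma> p h = transpose_mat (trf h \<beta> \<gamma> p) *\<^sub>v sec m \<beta> p h"
  proof (rule eq_vecI)
    show "dim_vec (sec m \<gamma> p h) = dim_vec (transpose_mat (trf h \<beta> \<gamma> p) *\<^sub>v sec m \<beta> p h)"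
      using oper_bundle_carrier[of S \<xi> r h \<beta> \<gamma> p] sec_carrier[of m \<gamma> p h] by auto
    fix j assume "j < dim_vec (transpose_mat (trf h \<beta> \<gamma> p) *\<^sub>v sec m \<beta> p h)"
    then have j: "j < r" using oper_bundle_carrier[of S \<xi> r h \<beta> \<gamma> p] by auto
    have "(transpose_mat (trf h \<beta> \<gamma> p) *\<^sub>v sec m \<beta> p h) $ j =
        (\<Sum>k<r. oper_tr r h \<beta> \<gamma> k j p * sec m \<beta> p h $ k)"
      using oper_transpose_mult[OF \<beta> \<gamma> _ _ sec_carrier j] p by simp
    also have "\<dots> = (\<Sum>k<r. \<Sum>i<r. oper_tr r h \<alpha> \<beta> i k p * oper_tr r h \<beta> \<gamma> k j p * m i p h)"
      using \<beta> p by (intro sum.cong) (auto simp: sec_def sum_distrib_left mult_ac)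
    also have "\<dots> = (\<Sum>i<r. \<Sum>k<r. oper_tr r h \<alpha> \<beta> i k p * oper_tr r h \<beta> \<gamma> k j p * m i p h)"
      by (rule sum.swap)
    also have "\<dots> = (\<Sum>i<r. oper_tr r h \<alpha> \<gamma> i j p * m i p h)"
      unfolding sum_distrib_right[symmetric]
      using oper_tr_cocycle[OF \<alpha> \<beta> \<gamma> _ _ _ _ j] p by (intro sum.cong) auto
    also have "\<dots> = sec m \<gamma> p h $ j" using \<gamma> p j by (simp add: sec_def)
    finally show "sec m \<gamma> p h $ j = (transpose_mat (trf h \<beta> \<gamma> p) *\<^sub>v sec m \<beta> p h) $ j" ..
  qed
qed

lemma sec_self: "j < r \<Longrightarrow> p \<in> N \<Longrightarrow> sec m \<alpha> p h $ j = m j p h"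
  using \<alpha> by (simp add: sec_def xi_self kap_self tr_unit if_distrib[of "\<lambda>x. x * _"] cong: if_cong)

lemma comps_in: "v \<in> Sec \<Longrightarrow> comps v \<in> Mods"
proof -
  assume "v \<in> Sec"
  then have "(\<lambda>p h. v \<alpha> p h $ j) \<in> holfun_hbar S (N \<inter> N)" if "j < r" for j
    using that \<alpha> unfolding covector_sections_def by blast
  then show ?thesis by (auto simp: Mods_def comps_def zero_fun_def)
qed

lemma comps_sec:
  assumes m: "m \<in> Mods"
  shows "comps (sec m) = m"
proof -
  have "comps (sec m) j p h = m j p h" for j p h
  proof (cases "j < r")
    case True
    then show ?thesis
      using m hbar_outside[OF N, of "m j" p h] sec_self[OF True, of p m h]
      by (cases "p \<in> N") (auto simp: comps_def Mods_def sec_def)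
  qed (use m in \<open>simp add: comps_def Mods_def\<close>)
  then show ?thesis by blast
qed

text \<open>Components are extended by zero. Without this \<open>sec\<close> and
  \<open>comps\<close> would be inverse only on the overlaps and not as total functions.\<close>

lemma Sec_outside:
  assumes v: "v \<in> Sec" and "\<not> (\<beta> \<in> Idx S \<and> p \<in> N \<inter> Nbhd S \<beta>)"
  shows "v \<beta> p h = 0\<^sub>v r"
proof (cases "\<beta> \<in> Idx S")
  case True
  have car: "v \<beta> p h \<in> carrier_vec r" using v unfolding covector_sections_def by blast
  show ?thesis
  proof (rule eq_vecI)
    fix j assume "j < dim_vec (0\<^sub>v r :: complex vec)"
    then have j: "j < r" by simp
    have "(\<lambda>p h. v \<beta> p h $ j) \<in> holfun_hbar S (N \<inter> Nbhd S \<beta>)"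
      using v True j unfolding covector_sections_def by blast
    from hbar_outside[OF openin_overlap[OF \<alpha> True] this, of p h]
    show "v \<beta> p h $ j = 0\<^sub>v r $ j" using assms True j by simp
  qed (use car in simp)
next
  case False
  then show ?thesis using v unfolding covector_sections_def by blast
qed

lemma sec_comps:
  assumes v: "v \<in> Sec"
  shows "sec (comps v) = v"
proof (intro ext)
  fix \<beta> p h
  show "sec (comps v) \<beta> p h = v \<beta> p h"
  proof (cases "\<beta> \<in> Idx S \<and> p \<in> N \<inter> Nbhd S \<beta>")
    case True
    then have t: "v \<beta> p h = transpose_mat (trf h \<alpha> \<beta> p) *\<^sub>v v \<alpha> p h"
      using v \<alpha> unfolding covector_sections_def by blast
    have c: "v \<alpha> p h \<in> carrier_vec r" "v \<beta> p h \<in> carrier_vec r"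
      using v unfolding covector_sections_def by blast+
    show ?thesis
    proof (rule eq_vecI)
      fix j assume "j < dim_vec (v \<beta> p h)"
      then have j: "j < r" using c by simp
      show "sec (comps v) \<beta> p h $ j = v \<beta> p h $ j"
        unfolding t using oper_transpose_mult[OF \<alpha> _ _ _ c(1) j, of \<beta> p h] True j
        by (simp add: sec_def comps_def)
    qed (use c sec_carrier[of "comps v" \<beta> p h] in auto)
  next
    case False
    then show ?thesis using Sec_outside[OF v False] by (auto simp: sec_def)
  qed
qed

text \<open>In chart \<beta> the transition matrix is differentiated too. The gauge law trades this
  derivative together with \<phi>_\<beta> for \<phi>_\<alpha>, and the factor dx_\<beta> /
  dx_\<alpha> = \<xi>^2 removes the remaining \<xi>^(-2).\<close>

lemma hbar_nabla_sec:
  assumes m: "m \<in> Mods"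
  shows "hbar_nabla S r con \<alpha> (sec m) = sec (nab m)"
proof (intro ext)
  fix \<beta> p h
  show "hbar_nabla S r con \<alpha> (sec m) \<beta> p h = sec (nab m) \<beta> p h"
  proof (cases "\<beta> \<in> Idx S \<and> p \<in> N \<inter> Nbhd S \<beta>")
    case True
    then have \<beta>: "\<beta> \<in> Idx S" and pa: "p \<in> N" and pb: "p \<in> Nbhd S \<beta>" by auto
    let ?t = "\<lambda>i j. oper_tr r h \<alpha> \<beta> i j" and ?d = "dcoord S \<beta> \<alpha> p"
    let ?z = "\<xi> \<alpha> \<beta> p"
    have z: "?z \<noteq> 0" by (rule xi_nonzero[OF \<alpha> \<beta> pa pb])
    have dz: "?d = ?z\<^sup>2"
      using dcoord_inverse[OF \<alpha> \<beta> pa pb] dcoord_xi[OF \<alpha> \<beta> pa pb] z by (simp add: field_simps)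
    have md: "diffable (\<lambda>p'. m i p' h) p" if "i < r" for i
      using m that holfun_diffable[OF N hbar_slice[OF N] pa] by (auto simp: Mods_def)
    have dsec: "ddx S \<beta> (\<lambda>p'. sec m \<beta> p' h $ j) p =
        (\<Sum>i<r. ddx S \<beta> (?t i j) p * m i p h + ?t i j p * ddx S \<beta> (\<lambda>p'. m i p' h) p)"
      if j: "j < r" for j
    proof -
      have di: "diffable (\<lambda>p'. ?t i j p' * m i p' h) p" if "i < r" for i
        using oper_tr_deriv(1)[OF \<alpha> \<beta> pa pb] md[OF that] by (intro diffable_mult) auto
      have "ddx S \<beta> (\<lambda>p'. sec m \<beta> p' h $ j) p = ddx S \<beta> (\<lambda>p'. \<Sum>i<r. ?t i j p' * m i p' h) p"
        by (rule ddx_cong[OF \<beta> openin_overlap[OF \<alpha> \<beta>]])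
           (use True j di in \<open>auto simp: sec_def intro!: diffable_sum\<close>)
      also have "\<dots> = (\<Sum>i<r. ddx S \<beta> (\<lambda>p'. ?t i j p' * m i p' h) p)"
        by (rule ddx_sum[OF \<beta> pb]) (use di in auto)
      also have "\<dots> = (\<Sum>i<r. ddx S \<beta> (?t i j) p * m i p h + ?t i j p * ddx S \<beta> (\<lambda>p'. m i p' h) p)"
        by (intro sum.cong ddx_mult[OF \<beta> pb oper_tr_deriv(1)[OF \<alpha> \<beta> pa pb]]) (use md in auto)
      finally show ?thesis .
    qed
    have higgs: "(transpose_mat (con h \<beta> p) *\<^sub>v sec m \<beta> p h) $ j =
        (\<Sum>i<r. (\<Sum>k<r. ?t i k p * higgs_field r q \<beta> p $$ (k, j)) * m i p h)" if j: "j < r" for j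
    proof -
      have "(transpose_mat (con h \<beta> p) *\<^sub>v sec m \<beta> p h) $ j =
          (\<Sum>k<r. higgs_field r q \<beta> p $$ (k, j) * sec m \<beta> p h $ k)"
        using j sec_carrier[of m \<beta> p h] unfolding B_eq
        by (auto simp: scalar_prod_def atLeast0LessThan intro!: sum.cong)
      also have "\<dots> = (\<Sum>k<r. \<Sum>i<r. ?t i k p * higgs_field r q \<beta> p $$ (k, j) * m i p h)"
        using True by (intro sum.cong) (auto simp: sec_def sum_distrib_left mult_ac)
      also have "\<dots> = (\<Sum>i<r. \<Sum>k<r. ?t i k p * higgs_field r q \<beta> p $$ (k, j) * m i p h)"
        by (rule sum.swap)
      finally show ?thesis by (simp add: sum_distrib_right)
    qed
    have gauge: "h * ddx S \<beta> (?t i j) p - (\<Sum>k<r. ?t i k p * higgs_field r q \<beta> p $$ (k, j)) =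
        - (\<Sum>k<r. higgs_field r q \<alpha> p $$ (i, k) * ?t k j p) / ?z\<^sup>2" if ij: "i < r" "j < r" for i j
    proof -
      have "q l \<beta> p = q l \<alpha> p / ?z ^ (2 * l)" if l: "l \<in> {2..r}" for l
        using q_transform[OF l \<beta> \<alpha> pb pa] dcoord_xi[OF \<alpha> \<beta> pa pb]
        by (simp add: power_divide power_mult)
      from gauge_law[where q = q and \<beta> = \<beta> and \<alpha> = \<alpha> and p = p and c = "h * kap \<alpha> \<beta> p", OF z ij this] oper_tr_deriv(2)[OF \<alpha> \<beta> pa pb, of h r i j]
      show ?thesis by (simp add: algebra_simps)
    qed
    show ?thesis
    proof (rule eq_vecI)
      show "dim_vec (hbar_nabla S r con \<alpha> (sec m) \<beta> p h) = dim_vec (sec (nab m) \<beta> p h)"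
        using sec_carrier[of "nab m" \<beta> p h] True
        by (auto simp: hbar_nabla_def B_eq)
      fix j assume "j < dim_vec (sec (nab m) \<beta> p h)"
      then have j: "j < r" using sec_carrier[of "nab m" \<beta> p h] by simp
      have "hbar_nabla S r con \<alpha> (sec m) \<beta> p h $ j =
          ?d * (h * ddx S \<beta> (\<lambda>p'. sec m \<beta> p' h $ j) p - (transpose_mat (con h \<beta> p) *\<^sub>v sec m \<beta> p h) $ j)"
        using True j by (auto simp: hbar_nabla_def B_eq)
      also have "\<dots> = ?d * (\<Sum>i<r. (h * ddx S \<beta> (?t i j) p -
            (\<Sum>k<r. ?t i k p * higgs_field r q \<beta> p $$ (k, j))) * m i p h
            + ?t i j p * (h * ddx S \<beta> (\<lambda>p'. m i p' h) p))"
        unfolding dsec[OF j] higgs[OF j] sum_distrib_left sum_subtractf[symmetric]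
        by (intro arg_cong2[where f = "(*)"] sum.cong refl) (simp add: algebra_simps)
      also have "\<dots> = ?d * (\<Sum>i<r. - (\<Sum>k<r. higgs_field r q \<alpha> p $$ (i, k) * ?t k j p) / ?z\<^sup>2 * m i p h
            + ?t i j p * (h * (ddx S \<alpha> (\<lambda>p'. m i p' h) p / ?d)))"
      proof (intro arg_cong2[where f = "(*)"] sum.cong refl)
        fix i assume "i \<in> {..<r}"
        then have i: "i < r" by simp
        have "ddx S \<alpha> (\<lambda>p'. m i p' h) p = ddx S \<beta> (\<lambda>p'. m i p' h) p * ?d"
          by (rule ddx_change_chart[OF \<alpha> \<beta> pa pb md[OF i]])
        then show "(h * ddx S \<beta> (?t i j) p - (\<Sum>k<r. ?t i k p * higgs_field r q \<beta> p $$ (k, j))) * m i p h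
            + ?t i j p * (h * ddx S \<beta> (\<lambda>p'. m i p' h) p) =
            - (\<Sum>k<r. higgs_field r q \<alpha> p $$ (i, k) * ?t k j p) / ?z\<^sup>2 * m i p h
            + ?t i j p * (h * (ddx S \<alpha> (\<lambda>p'. m i p' h) p / ?d))"
          unfolding gauge[OF i j] using dz z by simp
      qed
      also have "\<dots> = (\<Sum>i<r. ?t i j p * (h * ddx S \<alpha> (\<lambda>p'. m i p' h) p)) -
          (\<Sum>i<r. \<Sum>k<r. higgs_field r q \<alpha> p $$ (i, k) * ?t k j p * m i p h)"
        unfolding sum_distrib_left sum_subtractf[symmetric]
        using dz z by (intro sum.cong refl) (simp add: sum_distrib_right[symmetric] field_simps, simp add: sum_distrib_left)
      also have "(\<Sum>i<r. \<Sum>k<r. higgs_field r q \<alpha> p $$ (i, k) * ?t k j p * m i p h) =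
          (\<Sum>k<r. \<Sum>i<r. higgs_field r q \<alpha> p $$ (i, k) * ?t k j p * m i p h)"
        by (rule sum.swap)
      also have "(\<Sum>i<r. ?t i j p * (h * ddx S \<alpha> (\<lambda>p'. m i p' h) p)) -
          (\<Sum>k<r. \<Sum>i<r. higgs_field r q \<alpha> p $$ (i, k) * ?t k j p * m i p h) =
          (\<Sum>k<r. ?t k j p * nab m k p h)"
        unfolding sum_subtractf[symmetric]
        using pa by (intro sum.cong refl)
          (simp add: nab_def hbar_ddx_def sum_fun_apply2 \<Phi>_def right_diff_distrib sum_distrib_left mult_ac)
      also have "\<dots> = sec (nab m) \<beta> p h $ j" using True j by (simp add: sec_def)
      finally show "hbar_nabla S r con \<alpha> (sec m) \<beta> p h $ j = sec (nab m) \<beta> p h $ j" .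
    qed
  next
    case False
    then show ?thesis by (auto simp: hbar_nabla_def sec_def)
  qed
qed

lemma hbar_nabla_pow_sec: "m \<in> Mods \<Longrightarrow> (hbar_nabla S r con \<alpha> ^^ k) (sec m) = sec ((nab ^^ k) m)"
  by (induction k) (auto simp: hbar_nabla_sec dm.nab_pow_closed)

end

section \<open>The local generator and its equation\<close>

lemma prod_list_diag:
  "prod_list (diag_mat A) = (\<Prod>i<dim_row A. A $$ (i, i))"
  by (simp add: diag_mat_def prod.distinct_set_conv_list[symmetric] atLeast0LessThan)

text \<open>Multiplication by the unipotent \<open>W\<close>, whose last column is (y^(r-1), ..., y,
  1), turns the last column of \<open>K\<close> into (p, 0, ..., 0). Expanding along it leaves a
  triangular minor with diagonal -1.\<close>

lemma det_companion:
  fixes b :: "nat \<Rightarrow> complex" and y :: complex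
  assumes r: "r > 0"
  defines "K \<equiv> Matrix.mat r r (\<lambda>(i, m). (if i = m then y else 0) +
    (if i = 0 then b (r - 1 - m) else if m = i - 1 then -1 else 0))"
  shows "Determinant.det K = y ^ r + (\<Sum>k<r. b k * y ^ k)"
proof -
  define W where "W = Matrix.mat r r (\<lambda>(i, j). if j = r - 1 then y ^ (r - 1 - i) else if i = j then 1 else 0)"
  define p where "p = y ^ r + (\<Sum>k<r. b k * y ^ k)"
  have K: "K \<in> carrier_mat r r" and W: "W \<in> carrier_mat r r" by (simp_all add: K_def W_def)
  have detW: "Determinant.det W = 1"
  proof -
    have "upper_triangular W" by (auto simp: W_def)
    then have "Determinant.det W = (\<Prod>i<r. W $$ (i, i))"
      using det_upper_triangular[OF _ W] W by (simp add: prod_list_diag)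
    also have "\<dots> = 1" by (rule prod.neutral) (auto simp: W_def)
    finally show ?thesis .
  qed
  have KW: "(K * W) $$ (i, j) = (if j = r - 1 then (if i = 0 then p else 0) else K $$ (i, j))"
    if ij: "i < r" "j < r" for i j
  proof -
    have e: "(K * W) $$ (i, j) = (\<Sum>m<r. K $$ (i, m) * W $$ (m, j))" by (rule mult_entry[OF K W ij])
    show ?thesis
    proof (cases "j = r - 1")
      case False
      have "(\<Sum>m<r. K $$ (i, m) * W $$ (m, j)) = (\<Sum>m<r. if m = j then K $$ (i, j) else 0)"
        using False ij by (intro sum.cong) (auto simp: W_def)
      then show ?thesis using e False ij by simp
    next
      case True
      have *: "(K * W) $$ (i, j) = (\<Sum>m<r. (if m = i then y * y ^ (r - 1 - i) else 0) +
         (if i = 0 then b (r - 1 - m) * y ^ (r - 1 - m) else if m = i - 1 then - (y ^ (r - 1 - m)) else 0))"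
        unfolding e using True ij by (intro sum.cong) (auto simp: W_def K_def algebra_simps)
      show ?thesis
      proof (cases "i = 0")
        case True
        have "(\<Sum>m<r. b (r - 1 - m) * y ^ (r - 1 - m)) = (\<Sum>k<r. b k * y ^ k)"
          using sum.nat_diff_reindex[of "\<lambda>k. b k * y ^ k" r] by simp
        moreover have "y * y ^ (r - 1) = y ^ r" using r by (cases r) auto
        ultimately show ?thesis
          unfolding * using True \<open>j = r - 1\<close> r by (simp add: sum.distrib p_def)
      next
        case False
        have "y * y ^ (r - 1 - i) = y ^ (r - 1 - (i - 1))"
          using False ij by (simp add: Suc_diff_Suc power_Suc[symmetric] del: power_Suc)
        then show ?thesis
          unfolding * using False \<open>j = r - 1\<close> ij by (simp add: sum.distrib)
      qed
    qed
  qed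
  have KWc: "K * W \<in> carrier_mat r r" using K W by simp
  let ?M = "mat_delete (K * W) 0 (r - 1)"
  have M: "?M \<in> carrier_mat (r - 1) (r - 1)"
    using K W by (intro carrier_matI) (auto simp: mat_delete_def)
  have Me: "?M $$ (i, j) = K $$ (Suc i, j)" if "i < r - 1" "j < r - 1" for i j
    using that K W KW[of "Suc i" j] by (auto simp: mat_delete_def)
  have Ks: "K $$ (Suc i, j) = (if Suc i = j then y else 0) + (if j = i then -1 else 0)"
    if "i < r - 1" "j < r - 1" for i j
    using that by (simp add: K_def)
  have "upper_triangular ?M"
    unfolding upper_triangular_def
  proof (intro allI impI)
    fix i j assume "i < dim_row ?M" "j < i"
    then have "i < r - 1" "j < r - 1" "j < i" using M by auto
    then show "?M $$ (i, j) = 0" using Me[of i j] Ks[of i j] by simp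
  qed
  then have "Determinant.det ?M = (\<Prod>i<r - 1. ?M $$ (i, i))"
    using det_upper_triangular[OF _ M] by (simp only: prod_list_diag carrier_matD(1)[OF M])
  also have "\<dots> = (\<Prod>i<r - 1. -1)"
    using Me Ks by (intro prod.cong) (simp_all del: One_nat_def)
  finally have detM: "Determinant.det ?M = (- 1) ^ (r - 1)" by simp
  have "Determinant.det K = Determinant.det (K * W)" using det_mult[OF K W] detW by simp
  also have "\<dots> = (\<Sum>i<r. (K * W) $$ (i, r - 1) * cofactor (K * W) i (r - 1))"
    by (rule laplace_expansion_column[OF KWc]) (use r in simp)
  also have "\<dots> = (\<Sum>i<r. if i = 0 then p * cofactor (K * W) 0 (r - 1) else 0)"
    using r by (intro sum.cong) (auto simp: KW)
  also have "\<dots> = p"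
  proof -
    \<comment> \<open>The sign of the position (0, r - 1) cancels the determinant of the
      minor.\<close>
    have "cofactor (K * W) 0 (r - 1) = (-1) ^ (r - 1) * (-1) ^ (r - 1)"
      unfolding cofactor_def detM by simp
    then show ?thesis using r by (simp add: power_mult_distrib[symmetric])
  qed
  finally show ?thesis by (simp add: p_def)
qed

text \<open>With u_(r-1), ..., u_0 as rows in this order, \<open>U\<close> is upper triangular and
  invertible, and U (y + A) = K U for the companion matrix above; hence the two determinants
  agree.\<close>

lemma det_cyclic:
  fixes A :: "complex mat" and u :: "nat \<Rightarrow> nat \<Rightarrow> complex"
  assumes r: "r > 0" and A: "A \<in> carrier_mat r r"
    and step: "\<And>k j. k < r \<Longrightarrow> j < r \<Longrightarrow> u (Suc k) j = - (\<Sum>i<r. A $$ (i, j) * u k i)"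
    and tri: "\<And>k j. k < r \<Longrightarrow> j + k < r - 1 \<Longrightarrow> u k j = 0"
    and diag: "\<And>k. k < r \<Longrightarrow> u k (r - 1 - k) \<noteq> 0"
    and rel: "\<And>j. j < r \<Longrightarrow> u r j + (\<Sum>k<r. b k * u k j) = 0"
  shows "Determinant.det (y \<cdot>\<^sub>m 1\<^sub>m r + A) = y ^ r + (\<Sum>k<r. b k * y ^ k)"
proof -
  define U where "U = Matrix.mat r r (\<lambda>(i, j). u (r - 1 - i) j)"
  define K where "K = Matrix.mat r r (\<lambda>(i, m). (if i = m then y else 0) +
    (if i = 0 then b (r - 1 - m) else if m = i - 1 then -1 else 0))"
  have U: "U \<in> carrier_mat r r" and K: "K \<in> carrier_mat r r" by (simp_all add: U_def K_def)
  have yA: "y \<cdot>\<^sub>m 1\<^sub>m r + A \<in> carrier_mat r r" using A by simp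
  have "upper_triangular U" using tri r by (auto simp: U_def upper_triangular_def)
  then have "Determinant.det U = (\<Prod>i<r. U $$ (i, i))"
    using det_upper_triangular[OF _ U] U by (simp add: prod_list_diag)
  also have "\<dots> \<noteq> 0"
  proof -
    have "U $$ (i, i) \<noteq> 0" if "i < r" for i using diag[of "r - 1 - i"] that by (simp add: U_def)
    then show ?thesis by simp
  qed
  finally have detU: "Determinant.det U \<noteq> 0" .
  have "U * (y \<cdot>\<^sub>m 1\<^sub>m r + A) = K * U"
  proof (rule eq_matI)
    fix i j assume "i < dim_row (K * U)" "j < dim_col (K * U)"
    then have ij: "i < r" "j < r" using K U by auto
    have "(U * (y \<cdot>\<^sub>m 1\<^sub>m r + A)) $$ (i, j) = (\<Sum>m<r. U $$ (i, m) * (y \<cdot>\<^sub>m 1\<^sub>m r + A) $$ (m, j))"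
      by (rule mult_entry[OF U yA ij])
    also have "\<dots> = (\<Sum>m<r. (if m = j then y * u (r - 1 - i) j else 0) + A $$ (m, j) * u (r - 1 - i) m)"
      using ij A by (intro sum.cong) (auto simp: U_def algebra_simps)
    also have "\<dots> = y * u (r - 1 - i) j - u (r - i) j"
      using step[of "r - 1 - i" j] ij by (simp add: sum.distrib Suc_diff_Suc)
    finally have L: "(U * (y \<cdot>\<^sub>m 1\<^sub>m r + A)) $$ (i, j) = y * u (r - 1 - i) j - u (r - i) j" .
    have "(K * U) $$ (i, j) = (\<Sum>m<r. K $$ (i, m) * U $$ (m, j))" by (rule mult_entry[OF K U ij])
    also have "\<dots> = (\<Sum>m<r. (if m = i then y * u (r - 1 - i) j else 0) +
       (if i = 0 then b (r - 1 - m) * u (r - 1 - m) j else if m = i - 1 then - u (r - 1 - m) j else 0))"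
      using ij by (intro sum.cong) (auto simp: U_def K_def algebra_simps)
    also have "\<dots> = y * u (r - 1 - i) j - u (r - i) j"
    proof (cases "i = 0")
      case True
      have "(\<Sum>m<r. b (r - 1 - m) * u (r - 1 - m) j) = (\<Sum>k<r. b k * u k j)"
        using sum.nat_diff_reindex[of "\<lambda>k. b k * u k j" r] by simp
      then show ?thesis using True rel[OF ij(2)] ij by (simp add: sum.distrib add_eq_0_iff)
    next
      case False
      then show ?thesis using ij by (simp add: sum.distrib)
    qed
    finally show "(U * (y \<cdot>\<^sub>m 1\<^sub>m r + A)) $$ (i, j) = (K * U) $$ (i, j)" using L by simp
  qed (use U K A in auto)
  then have "Determinant.det U * Determinant.det (y \<cdot>\<^sub>m 1\<^sub>m r + A) = Determinant.det U * Determinant.det K"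
    using det_mult[OF U yA] det_mult[OF K U] mult.commute[of "Determinant.det K"] by metis
  then have "Determinant.det (y \<cdot>\<^sub>m 1\<^sub>m r + A) = Determinant.det K"
    using detU by (simp only: mult_left_cancel[OF detU])
  then show ?thesis using det_companion[OF r, where y = y and b = b] unfolding K_def by (rule trans)
qed

section \<open>The last basis vector as a cyclic vector\<close>

context oper_patch
begin

text \<open>The covector that reads off \<psi>, the last component of a flat section.\<close>

definition gen :: "nat \<Rightarrow> 'a \<Rightarrow> complex \<Rightarrow> complex" where
  "gen j = (if j = r - 1 then unit else 0)"

lemma gen_in: "gen \<in> Mods"
  using r dr.R_unit dr.R_zero by (auto simp: Mods_def gen_def)

lemma \<Phi>_lower: "i < r \<Longrightarrow> j < r \<Longrightarrow> j < i \<Longrightarrow> i \<noteq> Suc j \<Longrightarrow> \<Phi> i j = 0"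
  by (auto simp: \<Phi>_def fun_eq_iff higgs_entry intro!: sum.neutral)

lemma \<Phi>_sub: "Suc j < r \<Longrightarrow> \<Phi> (Suc j) j = (\<lambda>p h. if p \<in> N then sq r (Suc j) else 0)"
  by (auto simp: \<Phi>_def fun_eq_iff higgs_entry intro!: sum.neutral)

text \<open>As \<phi> is upper Hessenberg, each nabla reaches exactly one index lower, and the new
  entry is the previous one times -\<open>sq\<close>, a nonzero constant. Such an entry is
  invertible in O[hbar], so the change of basis exists over all of U and also at hbar = 0.\<close>

lemma nab_pow_gen:
  assumes "k < r"
  shows "(\<forall>j. j + k < r - 1 \<longrightarrow> (nab ^^ k) gen j = (0 :: 'a \<Rightarrow> complex \<Rightarrow> complex)) \<and>
    (\<exists>c. c \<noteq> 0 \<and> (nab ^^ k) gen (r - 1 - k) = (\<lambda>p h. if p \<in> N then c else 0))"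
  using assms
proof (induction k)
  case 0
  show ?case by (auto simp: gen_def intro!: exI[of _ 1])
next
  case (Suc k)
  let ?v = "(nab ^^ k) gen"
  obtain c where v0: "\<And>j. j + k < r - 1 \<Longrightarrow> ?v j = 0"
    and c: "c \<noteq> 0" "?v (r - 1 - k) = (\<lambda>p h. if p \<in> N then c else 0)"
    using Suc.IH[OF Suc_lessD[OF Suc.prems]] by blast
  \<comment> \<open>An index i \<noteq> j + 1 either lies before the support of nabla^k e or is too
    far below the diagonal of \<phi>.\<close>
  have van: "\<Phi> i j * ?v i = 0" if j: "j + Suc k \<le> r - 1" "i < r" "i \<noteq> Suc j" for i j
  proof (cases "i + k < r - 1")
    case True
    then show ?thesis using v0[of i] by simp
  next
    case False
    then show ?thesis using \<Phi>_lower[of i j] j by simp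
  qed
  have low: "nab ?v j = 0" if j: "j + Suc k < r - 1" for j
  proof -
    have "\<Phi> i j * ?v i = 0" if i: "i < r" for i
      using van[of j i] v0[of i] j i by (cases "i = Suc j") auto
    then have "(\<Sum>i<r. \<Phi> i j * ?v i) = 0" by (intro sum.neutral) auto
    then show ?thesis using v0[of j] j by (simp add: nab_def dr.deriv_zero)
  qed
  let ?j = "r - 1 - Suc k"
  have j: "Suc ?j = r - 1 - k" "?j < r" "Suc ?j < r" using Suc.prems by auto
  have "(\<Sum>i<r. \<Phi> i ?j * ?v i) = (\<Sum>i<r. if i = Suc ?j then \<Phi> (Suc ?j) ?j * ?v (Suc ?j) else 0)"
  proof (rule sum.cong)
    fix i assume "i \<in> {..<r}"
    then show "\<Phi> i ?j * ?v i = (if i = Suc ?j then \<Phi> (Suc ?j) ?j * ?v (Suc ?j) else 0)"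
      using van[of ?j i] Suc.prems by (cases "i = Suc ?j") auto
  qed simp
  also have "\<dots> = \<Phi> (Suc ?j) ?j * ?v (Suc ?j)" using j by simp
  also have "\<dots> = (\<lambda>p h. if p \<in> N then sq r (Suc ?j) * c else 0)"
    unfolding \<Phi>_sub[OF j(3)] using c(2) j(1) by (auto simp: fun_eq_iff)
  finally have s: "(\<Sum>i<r. \<Phi> i ?j * ?v i) = (\<lambda>p h. if p \<in> N then sq r (Suc ?j) * c else 0)" .
  have "nab ?v ?j = \<delta> (?v ?j) - (\<Sum>i<r. \<Phi> i ?j * ?v i)" using j by (simp add: nab_def)
  \<comment> \<open>The entry was still 0 before this application of nabla, so no derivative
    appears.\<close>
  also have "?v ?j = 0" using v0[of ?j] Suc.prems by simp
  finally have "nab ?v ?j = (\<lambda>p h. if p \<in> N then - sq r (Suc ?j) * c else 0)"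
    unfolding s dr.deriv_zero by (auto simp: fun_eq_iff)
  moreover have "- sq r (Suc ?j) * c \<noteq> 0" using sq_nonzero[of "Suc ?j" r] j c(1) by simp
  ultimately show ?case
    using low unfolding funpow.simps comp_apply by blast
qed

lemma smod_apply: "smod a m j = a * m j"
  by (simp add: smod_def)

lemma sum_mod_apply: "(\<Sum>i\<in>A. (f i :: nat \<Rightarrow> 'a \<Rightarrow> complex \<Rightarrow> complex)) j = (\<Sum>i\<in>A. f i j)"
  by (induction A rule: infinite_finite_induct) auto

lemma act_gen_apply: "dm.act n b v j = (\<Sum>k<n. b k * (nab ^^ k) v j)"
  by (simp add: dm.act_def sum_mod_apply smod_apply)

text \<open>Triangular elimination: a multiple of nabla^n e removes component r - 1 - n, and the
  rest is supported on one component fewer.\<close>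

lemma gen_generates:
  assumes "n \<le> r" "v \<in> Mods" "\<And>j. j < r - n \<Longrightarrow> v j = (0 :: 'a \<Rightarrow> complex \<Rightarrow> complex)"
  shows "\<exists>b \<in> dr.coefs n. v = dm.act n b gen"
  using assms
proof (induction n arbitrary: v)
  case 0
  have "v j = 0" for j
  proof (cases "j < r")
    case True
    then have "j < r - 0" by simp
    then show ?thesis by (rule "0.prems"(3))
  next
    case False
    then have "r \<le> j" by simp
    then show ?thesis using "0.prems"(2) unfolding Mods_def by blast
  qed
  then have "v = dm.act 0 (\<lambda>k. 0) gen" by (simp add: dm.act_def fun_eq_iff)
  then show ?case using dr.coefs_0 by blast
next
  case (Suc n)
  let ?v = "(nab ^^ n) gen" and ?j = "r - 1 - n"
  have n: "n < r" using Suc.prems(1) by simp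
  obtain c where v0: "\<And>j. j + n < r - 1 \<Longrightarrow> ?v j = 0"
    and c: "c \<noteq> 0" "?v ?j = (\<lambda>p h. if p \<in> N then c else 0)"
    using nab_pow_gen[OF n] by blast
  define a where "a = v ?j * (\<lambda>p h. if p \<in> N then 1 / c else 0)"
  have vj: "v ?j \<in> \<O>" using Suc.prems(2) n by (simp add: Mods_def)
  have a: "a \<in> \<O>"
    unfolding a_def
    by (intro dr.R_mult vj hbar_of_holfun[OF N] holfun_indicator[OF N] diffable_const)
  define v' where "v' = v + smod (- a) ?v"
  have "v' \<in> Mods"
    unfolding v'_def by (intro dm.M_add dm.M_smult Suc.prems dr.R_uminus a dm.nab_pow_closed gen_in)
  moreover have "v' j = 0" if "j < r - n" for j
  proof (cases "j = ?j")
    case True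
    have "a * ?v ?j = v ?j"
      unfolding a_def c(2) using c(1) hbar_outside[OF N vj] by (auto simp: fun_eq_iff)
    then show ?thesis using True by (simp add: v'_def smod_apply)
  next
    case False
    then have j: "j < r - Suc n" "j + n < r - 1" using that by auto
    show ?thesis
      using v0[OF j(2)] Suc.prems(3)[OF j(1)] by (simp add: v'_def smod_apply fun_eq_iff)
  qed
  ultimately obtain b where b: "b \<in> dr.coefs n" "v' = dm.act n b gen"
    using Suc.IH[of v'] n by auto
  define b' where "b' = (\<lambda>k. if k = n then a else b k)"
  have "b' \<in> dr.coefs (Suc n)" using b(1) a by (auto simp: b'_def dr.coefs_def)
  moreover have "v = dm.act (Suc n) b' gen"
  proof -
    have "dm.act (Suc n) b' gen = dm.act n b gen + smod a ?v"
      by (simp add: dm.act_def b'_def)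
    also have "\<dots> = v" unfolding b(2)[symmetric] v'_def by (simp add: dm.sm_minus_left)
    finally show ?thesis ..
  qed
  ultimately show ?case by blast
qed

text \<open>Component r - 1 - n sees only the last of e, ..., nabla^n e, so the top coefficient
  vanishes and the order drops.\<close>

lemma gen_independent:
  assumes "n \<le> r" "b \<in> dr.coefs n" "dm.act n b gen = 0"
  shows "b = (\<lambda>k. 0)"
  using assms
proof (induction n)
  case 0
  then show ?case by (simp add: dr.coefs_def fun_eq_iff)
next
  case (Suc n)
  let ?j = "r - 1 - n"
  have n: "n < r" using Suc.prems(1) by simp
  obtain c where c: "c \<noteq> 0" "(nab ^^ n) gen ?j = (\<lambda>p h. if p \<in> N then c else 0)"
    using nab_pow_gen[OF n] by blast
  have "b k * (nab ^^ k) gen ?j = 0" if "k < n" for k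
  proof -
    have k: "k < r" "?j + k < r - 1" using that n by auto
    have "(nab ^^ k) gen ?j = 0" using nab_pow_gen[OF k(1)] k(2) by blast
    then show ?thesis by (simp only: mult_zero_right)
  qed
  then have "(\<Sum>k<n. b k * (nab ^^ k) gen ?j) = 0" by (intro sum.neutral) auto
  moreover have "(\<Sum>k<Suc n. b k * (nab ^^ k) gen ?j) = 0"
  proof -
    have "dm.act (Suc n) b gen ?j = 0" using Suc.prems(3) by (simp add: fun_eq_iff)
    then show ?thesis unfolding act_gen_apply .
  qed
  ultimately have z: "b n * (\<lambda>p h. if p \<in> N then c else 0) = 0" using c(2) by simp
  have "b n p h = 0" for p h
    using fun_cong[OF fun_cong[OF z, of p], of h] c(1)
      hbar_outside[OF N dr.coefs_in[OF Suc.prems(2), of n], of p h]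
    by (cases "p \<in> N") auto
  then have bn: "b n = 0" by (simp add: fun_eq_iff)
  have "b k = 0" if "k \<ge> n" for k
    using bn dr.coefs_zero[OF Suc.prems(2), of k] that by (cases "k = n") auto
  then have b: "b \<in> dr.coefs n" using Suc.prems(2) by (auto simp: dr.coefs_def)
  have "dm.act n b gen = 0"
    using dm.act_extend[OF b, of "Suc n" gen] Suc.prems(3) by (metis le_SucI order_refl)
  from Suc.IH[OF _ b this] n show ?case by simp
qed

text \<open>The coefficients of the scalar equation for \<psi> that remains after the other
  components are eliminated.\<close>

definition is_eqn :: "(nat \<Rightarrow> 'a \<Rightarrow> complex \<Rightarrow> complex) \<Rightarrow> bool" where
  "is_eqn P \<longleftrightarrow> P \<in> dr.coefs (Suc r) \<and> P r = unit \<and> dm.act (Suc r) P gen = 0"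

lemma eqn_exists: "\<exists>P. is_eqn P"
proof -
  let ?v = "smod (- unit) ((nab ^^ r) gen)"
  have "?v \<in> Mods" by (intro dm.M_smult dr.R_uminus dr.R_unit dm.nab_pow_closed gen_in)
  then obtain b where b: "b \<in> dr.coefs r" "?v = dm.act r b gen" using gen_generates[of r ?v] by auto
  define P where "P = (\<lambda>k. if k = r then unit else b k)"
  have "P \<in> dr.coefs (Suc r)" using b(1) dr.R_unit by (auto simp: P_def dr.coefs_def)
  moreover have "dm.act (Suc r) P gen = 0"
  proof -
    have "dm.act (Suc r) P gen = dm.act r b gen + smod unit ((nab ^^ r) gen)"
      by (simp add: dm.act_def P_def)
    also have "\<dots> = 0" unfolding b(2)[symmetric] by (simp add: dm.sm_minus_left)
    finally show ?thesis .
  qed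
  ultimately show ?thesis unfolding is_eqn_def by (intro exI[of _ P]) (simp add: P_def)
qed

lemma cyclic:
  assumes "is_eqn P"
  shows "cyclic_differential_module \<O> unit \<delta> Mods smod nab gen r P"
proof (unfold_locales, goal_cases)
  case (1 n b) then show ?case by (rule faithful)
next
  case 2 show ?case by (rule gen_in)
next
  case (3 v)
  have "r \<le> r" "\<And>j. j < r - r \<Longrightarrow> v j = 0" by simp_all
  then show ?case using gen_generates[OF _ 3, of r] by blast
next
  case (4 b) then show ?case by (rule gen_independent[OF order_refl])
qed (use assms in \<open>simp_all add: is_eqn_def\<close>)

lemma sec_add: "sec (m + m') = (\<lambda>\<beta> p h. sec m \<beta> p h + sec m' \<beta> p h)"
  by (intro ext eq_vecI) (auto simp: sec_def distrib_left sum.distrib)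

lemma sec_act: "sec (dm.act n b m) =
   (\<lambda>\<beta> p h. Matrix.vec r (\<lambda>j. \<Sum>k<n. b k p h * sec ((nab ^^ k) m) \<beta> p h $ j))"
proof (intro ext eq_vecI)
  fix \<beta> p h j assume "j < dim_vec (Matrix.vec r (\<lambda>j. \<Sum>k<n. b k p h * sec ((nab ^^ k) m) \<beta> p h $ j))"
  then have j: "j < r" by simp
  have "(\<Sum>i<r. oper_tr r h \<alpha> \<beta> i j p * (\<Sum>k<n. b k p h * (nab ^^ k) m i p h)) =
      (\<Sum>k<n. b k p h * (\<Sum>i<r. oper_tr r h \<alpha> \<beta> i j p * (nab ^^ k) m i p h))"
    unfolding sum_distrib_left by (subst sum.swap) (simp add: mult.left_commute)
  then show "sec (dm.act n b m) \<beta> p h $ j =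
      Matrix.vec r (\<lambda>j. \<Sum>k<n. b k p h * sec ((nab ^^ k) m) \<beta> p h $ j) $ j"
    using j by (cases "\<beta> \<in> Idx S \<and> p \<in> N \<inter> Nbhd S \<beta>") (auto simp: sec_def act_gen_apply sum_fun_apply2)
qed (auto simp: sec_def)

text \<open>Scalar multiplication in \<open>rees_module\<close> is a definite description over all
  representations of the operator. Its uniqueness is the statement that equal operators act equally,
  which the cyclic module provides.\<close>

lemma rees_smult:
  assumes P: "is_eqn P" and t: "t \<in> dr.coefs n" and m: "m \<in> Mods"
  shows "dr.op n t \<odot>\<^bsub>rees_module S r trf con \<alpha>\<^esub> sec m = sec (dm.act n t m)"
proof -
  interpret cy: cyclic_differential_module \<O> unit \<delta> Mods smod nab gen r P by (rule cyclic[OF P])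
  have w: "(\<lambda>\<beta> p h. Matrix.vec r (\<lambda>j. \<Sum>l\<le>n'. a l p h *
       vec_index ((hbar_nabla S r con \<alpha> ^^ (n' - l)) (sec m) \<beta> p h) j)) =
     sec (dm.act (Suc n') (\<lambda>k. if k \<le> n' then a (n' - k) else 0) m)" for n' a
  proof -
    have "(\<Sum>l\<le>n'. a l p h * sec ((nab ^^ (n' - l)) m) \<beta> p h $ j) =
      (\<Sum>k<Suc n'. (if k \<le> n' then a (n' - k) else 0) p h * sec ((nab ^^ k) m) \<beta> p h $ j)" for \<beta> p h j
      unfolding lessThan_Suc_atMost[symmetric]
      by (subst sum.nat_diff_reindex[symmetric]) (auto intro!: sum.cong)
    then show ?thesis by (simp add: hbar_nabla_pow_sec[OF m] sec_act)
  qed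
  have "dr.op n t \<odot>\<^bsub>rees_module S r trf con \<alpha>\<^esub> sec m =
    (THE w. \<exists>n' a. (\<forall>l\<le>n'. a l \<in> \<O>) \<and> dr.op n t = rees_op S \<alpha> n' a \<and>
        w = sec (dm.act (Suc n') (\<lambda>k. if k \<le> n' then a (n' - k) else 0) m))"
    by (simp add: rees_module_def w)
  also have "\<dots> = sec (dm.act n t m)"
  proof (rule the_equality)
    have e: "(\<lambda>k. if k \<le> n then t (n - (n - k)) else 0) = t"
      using dr.coefs_zero[OF t] by (auto simp: fun_eq_iff)
    show "\<exists>n' a. (\<forall>l\<le>n'. a l \<in> \<O>) \<and> dr.op n t = rees_op S \<alpha> n' a \<and>
        sec (dm.act n t m) = sec (dm.act (Suc n') (\<lambda>k. if k \<le> n' then a (n' - k) else 0) m)"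
      using op_eq_rees_op[OF t] dr.coefs_in[OF t] dm.act_extend[OF t, of "Suc n" m]
      by (intro exI[of _ n] exI[of _ "\<lambda>l. t (n - l)"]) (simp add: e)
  next
    fix w assume "\<exists>n' a. (\<forall>l\<le>n'. a l \<in> \<O>) \<and> dr.op n t = rees_op S \<alpha> n' a \<and>
        w = sec (dm.act (Suc n') (\<lambda>k. if k \<le> n' then a (n' - k) else 0) m)"
    then obtain n' a where a: "\<And>l. l \<le> n' \<Longrightarrow> a l \<in> \<O>" "dr.op n t = rees_op S \<alpha> n' a"
      "w = sec (dm.act (Suc n') (\<lambda>k. if k \<le> n' then a (n' - k) else 0) m)" by blast
    show "w = sec (dm.act n t m)"
      using cy.op_eq_imp_act_eq[OF t rees_op_coefs[of n' a, OF a(1)]] a(2,3) rees_op_eq_op[of n' a]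
      by simp
  qed
  finally show ?thesis .
qed

lemma bij_sec: "bij_betw sec Mods Sec"
  by (rule bij_betw_byWitness[where f' = comps])
     (auto simp: comps_sec sec_comps sec_in comps_in)

lemma rees_module_iso:
  assumes P: "is_eqn P"
  shows "left_module_iso (rees_ring S \<alpha>)
    (left_quotient (rees_ring S \<alpha>) (rees_op S \<alpha> r (\<lambda>l. P (r - l)))) (rees_module S r trf con \<alpha>)"
proof -
  interpret cy: cyclic_differential_module \<O> unit \<delta> Mods smod nab gen r P by (rule cyclic[OF P])
  have Pc: "P \<in> dr.coefs (Suc r)" using P by (simp add: is_eqn_def)
  have "(\<lambda>k. if k \<le> r then P (r - (r - k)) else 0) = P"
    using dr.coefs_zero[OF Pc] by (auto simp: fun_eq_iff)
  then have op: "rees_op S \<alpha> r (\<lambda>l. P (r - l)) = dr.op (Suc r) P" by (simp add: rees_op_eq_op)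
  let ?Q = "left_quotient dr.opring (dr.op (Suc r) P)"
  obtain F where F: "bij_betw F (carrier ?Q) Mods"
    "\<And>A B. A \<in> carrier ?Q \<Longrightarrow> B \<in> carrier ?Q \<Longrightarrow> F (A \<oplus>\<^bsub>?Q\<^esub> B) = F A + F B"
    "\<And>m t A. t \<in> dr.coefs m \<Longrightarrow> A \<in> carrier ?Q \<Longrightarrow> F (dr.op m t \<odot>\<^bsub>?Q\<^esub> A) = dm.act m t (F A)"
    using cy.cyclic_quotient_iso by blast
  have FM: "F A \<in> Mods" if "A \<in> carrier ?Q" for A using bij_betwE[OF F(1)] that by blast
  show ?thesis
    unfolding left_module_iso_def rees_ring_eq op
  proof (intro exI[of _ "sec \<circ> F"] conjI ballI)
    show "bij_betw (sec \<circ> F) (carrier ?Q) (carrier (rees_module S r trf con \<alpha>))"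
      using bij_betw_trans[OF F(1) bij_sec] by (simp add: rees_module_def)
    fix A B assume "A \<in> carrier ?Q" "B \<in> carrier ?Q"
    then show "(sec \<circ> F) (A \<oplus>\<^bsub>?Q\<^esub> B) = (sec \<circ> F) A \<oplus>\<^bsub>rees_module S r trf con \<alpha>\<^esub> (sec \<circ> F) B"
      using F(2) by (simp add: rees_module_def sec_add)
  next
    fix T A assume T: "T \<in> carrier dr.opring" and A: "A \<in> carrier ?Q"
    obtain n t where t: "t \<in> dr.coefs n" "T = dr.op n t" using T unfolding dr.opring_simps by blast
    show "(sec \<circ> F) (T \<odot>\<^bsub>?Q\<^esub> A) = T \<odot>\<^bsub>rees_module S r trf con \<alpha>\<^esub> (sec \<circ> F) A"
      using F(3)[OF t(1) A] rees_smult[OF P t(1) FM[OF A]] t(2) by simp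
  qed
qed

text \<open>At hbar = 0 the connection loses its derivative and becomes the pointwise map v to -v
  \<phi>, so the values of nabla^k e at p satisfy the hypotheses of
  \<open>det_cyclic\<close>.\<close>

lemma symbol_eq_det:
  assumes P: "is_eqn P" and p: "p \<in> N"
  shows "(\<Sum>l\<le>r. P (r - l) p 0 * y ^ (r - l)) = Determinant.det (y \<cdot>\<^sub>m 1\<^sub>m r + higgs_field r q \<alpha> p)"
proof -
  define u where "u k j = (nab ^^ k) gen j p 0" for k j
  have "Determinant.det (y \<cdot>\<^sub>m 1\<^sub>m r + higgs_field r q \<alpha> p) = y ^ r + (\<Sum>k<r. P k p 0 * y ^ k)"
  proof (rule det_cyclic[where u = u])
    show "0 < r" using r by simp
    show "higgs_field r q \<alpha> p \<in> carrier_mat r r" by simp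
    show "u (Suc k) j = - (\<Sum>i<r. higgs_field r q \<alpha> p $$ (i, j) * u k i)" if "k < r" "j < r" for k j
      using that p by (simp add: u_def nab_def hbar_ddx_def sum_fun_apply2 \<Phi>_def)
    show "u k j = 0" if "k < r" "j + k < r - 1" for k j
      using nab_pow_gen[OF that(1)] that by (simp add: u_def)
    show "u k (r - 1 - k) \<noteq> 0" if k: "k < r" for k
    proof -
      obtain c where "c \<noteq> 0" "(nab ^^ k) gen (r - 1 - k) = (\<lambda>p h. if p \<in> N then c else 0)"
        using nab_pow_gen[OF k] by blast
      then show ?thesis using p by (simp add: u_def)
    qed
    show "u r j + (\<Sum>k<r. P k p 0 * u k j) = 0" if "j < r" for j
    proof -
      have "dm.act (Suc r) P gen j p 0 = 0" using P by (simp add: is_eqn_def)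
      then have "(\<Sum>k<Suc r. P k p 0 * u k j) = 0"
        unfolding act_gen_apply sum_fun_apply2 u_def by simp
      then show ?thesis using P p by (simp add: is_eqn_def add.commute)
    qed
  qed
  also have "\<dots> = (\<Sum>k<Suc r. P k p 0 * y ^ k)" using P p by (simp add: is_eqn_def add.commute)
  also have "\<dots> = (\<Sum>l\<le>r. P (r - l) p 0 * y ^ (r - l))"
    using sum.nat_diff_reindex[of "\<lambda>k. P k p 0 * y ^ k" "Suc r"] by (simp add: lessThan_Suc_atMost)
  finally show ?thesis ..
qed

end

section \<open>Holomorphic functions on the compactified cotangent bundle\<close>

text \<open>The pointwise form of \<open>holomorphic2_on\<close>, for which closure under algebra
  and composition needs no domains.\<close>

definition hol2 :: "(complex \<times> complex \<Rightarrow> complex) \<Rightarrow> complex \<times> complex \<Rightarrow> bool" where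
  "hol2 f z \<longleftrightarrow> (\<exists>A B. (f has_derivative (\<lambda>(s, t). A * s + B * t)) (at z))"

lemma holomorphic2_on_iff: "holomorphic2_on f W \<longleftrightarrow> (\<forall>z\<in>W. hol2 f z)"
  by (simp add: holomorphic2_on_def hol2_def)

lemma hol2_cong:
  assumes "open V" "z \<in> V" "\<And>w. w \<in> V \<Longrightarrow> f w = g w" "hol2 f z"
  shows "hol2 g z"
  using assms has_derivative_transform_within_open[of f _ z UNIV V g] unfolding hol2_def by blast

lemma hol2_const: "hol2 (\<lambda>w. c) z"
  unfolding hol2_def by (rule exI[of _ 0], rule exI[of _ 0]) (simp add: case_prod_unfold)

lemma hol2_fst: "hol2 fst z"
  unfolding hol2_def
  by (rule exI[of _ 1], rule exI[of _ 0]) (auto simp: case_prod_unfold intro!: derivative_eq_intros)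

lemma hol2_snd: "hol2 snd z"
  unfolding hol2_def
  by (rule exI[of _ 0], rule exI[of _ 1]) (auto simp: case_prod_unfold intro!: derivative_eq_intros)

lemma hol2_add:
  assumes "hol2 f z" "hol2 g z"
  shows "hol2 (\<lambda>w. f w + g w) z"
proof -
  obtain A B C D where "(f has_derivative (\<lambda>(s, t). A * s + B * t)) (at z)"
    "(g has_derivative (\<lambda>(s, t). C * s + D * t)) (at z)"
    using assms by (auto simp: hol2_def)
  from has_derivative_add[OF this] show ?thesis
    unfolding hol2_def
    by (intro exI[of _ "A + C"] exI[of _ "B + D"]) (simp add: case_prod_unfold algebra_simps)
qed

lemma hol2_mult:
  assumes "hol2 f z" "hol2 g z"
  shows "hol2 (\<lambda>w. f w * g w) z"
proof -
  obtain A B C D where "(f has_derivative (\<lambda>(s, t). A * s + B * t)) (at z)"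
    "(g has_derivative (\<lambda>(s, t). C * s + D * t)) (at z)"
    using assms by (auto simp: hol2_def)
  from has_derivative_mult[OF this] show ?thesis
    unfolding hol2_def
    by (intro exI[of _ "f z * C + A * g z"] exI[of _ "f z * D + B * g z"])
       (simp add: case_prod_unfold algebra_simps)
qed

lemma hol2_power: "hol2 f z \<Longrightarrow> hol2 (\<lambda>w. f w ^ n) z"
  by (induction n) (auto intro: hol2_const hol2_mult)

lemma hol2_sum: "(\<And>i. i \<in> A \<Longrightarrow> hol2 (f i) z) \<Longrightarrow> hol2 (\<lambda>w. \<Sum>i\<in>A. f i w) z"
  by (induction A rule: infinite_finite_induct) (auto intro: hol2_const hol2_add)

lemma hol2_compose1:
  assumes "hol2 g z" "f field_differentiable at (g z)"
  shows "hol2 (\<lambda>w. f (g w)) z"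
proof -
  obtain A B where g: "(g has_derivative (\<lambda>(s, t). A * s + B * t)) (at z)"
    using assms by (auto simp: hol2_def)
  obtain D where "(f has_derivative (\<lambda>h. D * h)) (at (g z))"
    using assms(2) by (auto simp: field_differentiable_def has_field_derivative_def)
  from has_derivative_compose[OF g this] show ?thesis
    unfolding hol2_def
    by (intro exI[of _ "D * A"] exI[of _ "D * B"]) (simp add: case_prod_unfold algebra_simps)
qed

lemma hol2_inverse: "hol2 f z \<Longrightarrow> f z \<noteq> 0 \<Longrightarrow> hol2 (\<lambda>w. 1 / f w) z"
  by (rule hol2_compose1[where f = "\<lambda>x. 1 / x"])
     (auto simp: field_differentiable_def intro!: derivative_eq_intros exI)

lemma hol2_compose2:
  assumes "hol2 f z" "hol2 g z" "hol2 F (f z, g z)"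
  shows "hol2 (\<lambda>w. F (f w, g w)) z"
proof -
  obtain A B C D E G where f: "(f has_derivative (\<lambda>(s, t). A * s + B * t)) (at z)"
    and g: "(g has_derivative (\<lambda>(s, t). C * s + D * t)) (at z)"
    and F: "(F has_derivative (\<lambda>(s, t). E * s + G * t)) (at (f z, g z))"
    using assms by (auto simp: hol2_def)
  from has_derivative_compose[OF has_derivative_Pair[OF f g] F] show ?thesis
    unfolding hol2_def
    by (intro exI[of _ "E * A + G * C"] exI[of _ "E * B + G * D"])
       (simp add: case_prod_unfold algebra_simps)
qed

lemma hol2_isCont: "hol2 f z \<Longrightarrow> isCont f z"
  unfolding hol2_def using has_derivative_continuous by blast

lemma hol2_slice:
  assumes "hol2 F (x, t)"
  shows "(\<lambda>s. F (x, s)) field_differentiable at t"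
proof -
  obtain A B where F: "(F has_derivative (\<lambda>(s, t). A * s + B * t)) (at (x, t))"
    using assms by (auto simp: hol2_def)
  have "((\<lambda>s. (x, s)) has_derivative (\<lambda>h. (0, h))) (at t)"
    by (intro has_derivative_Pair has_derivative_const has_derivative_ident)
  from has_derivative_compose[OF this F] have "((\<lambda>s. F (x, s)) has_derivative (\<lambda>h. B * h)) (at t)"
    by simp
  then show ?thesis by (auto simp: field_differentiable_def has_field_derivative_def)
qed

section \<open>Charts of the compactified cotangent bundle\<close>

context projective_structure
begin

lemma covec_in:
  assumes "\<alpha> \<in> Idx S" "p \<in> Nbhd S \<alpha>"
  shows "covec S \<alpha> p t \<in> cotangent_space S p"
  unfolding cotangent_space_def
proof (intro CollectI conjI ballI allI impI)
  fix \<beta> \<gamma> assume "\<beta> \<in> Idx S" "\<gamma> \<in> Idx S" "p \<in> Nbhd S \<beta> \<inter> Nbhd S \<gamma>"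
  then show "covec S \<alpha> p t \<beta> = dcoord S \<gamma> \<beta> p * covec S \<alpha> p t \<gamma>"
    using dcoord_cocycle[of \<alpha> \<gamma> \<beta> p] assms by (simp add: covec_def mult_ac)
qed (auto simp: covec_def)

lemma covec_self: "\<alpha> \<in> Idx S \<Longrightarrow> p \<in> Nbhd S \<alpha> \<Longrightarrow> covec S \<alpha> p t \<alpha> = t"
  by (simp add: covec_def dcoord_self)

lemma covec_unique:
  assumes "\<alpha> \<in> Idx S" "p \<in> Nbhd S \<alpha>" "y \<in> cotangent_space S p"
  shows "covec S \<alpha> p (y \<alpha>) = y"
proof
  fix \<beta>
  show "covec S \<alpha> p (y \<alpha>) \<beta> = y \<beta>"
  proof (cases "\<beta> \<in> Idx S \<and> p \<in> Nbhd S \<beta>")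
    case True
    then have "y \<beta> = dcoord S \<alpha> \<beta> p * y \<alpha>"
      using assms unfolding cotangent_space_def by blast
    then show ?thesis using True by (simp add: covec_def mult.commute)
  next
    case False
    then have "y \<beta> = 0" using assms(3) unfolding cotangent_space_def by blast
    then show ?thesis using False by (auto simp: covec_def)
  qed
qed

lemma covec_change:
  assumes "\<alpha> \<in> Idx S" "\<beta> \<in> Idx S" "p \<in> Nbhd S \<alpha>" "p \<in> Nbhd S \<beta>"
  shows "covec S \<beta> p t = covec S \<alpha> p (t * dcoord S \<beta> \<alpha> p)"
proof
  fix \<gamma> show "covec S \<beta> p t \<gamma> = covec S \<alpha> p (t * dcoord S \<beta> \<alpha> p) \<gamma>"
    using dcoord_cocycle[of \<beta> \<alpha> \<gamma> p] assms by (auto simp: covec_def)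
qed

lemma covec_minus: "covec S \<alpha> p (- t) = (\<lambda>\<beta>. - covec S \<alpha> p t \<beta>)"
  by (auto simp: covec_def)

lemma tparam_in:
  assumes "\<alpha> \<in> Idx S" "x \<in> Coord S \<alpha> ` Nbhd S \<alpha>"
  shows "tparam S \<alpha> b (x, t) \<in> compact_cotangent_bundle S"
  using pt_in[OF assms(2)] covec_in[OF assms(1) pt_in[OF assms(2)]] assms(1)
  by (auto simp: tparam_def compact_cotangent_bundle_def cotangent_bundle_def)

lemma fst_tparam [simp]: "fst (tparam S \<alpha> b (x, t)) = pt S \<alpha> x"
  by (simp add: tparam_def)

lemma cotangent_tparam:
  assumes "\<alpha> \<in> Idx S" "p \<in> Nbhd S \<alpha>" "y \<in> cotangent_space S p"
  shows "tparam S \<alpha> False (Coord S \<alpha> p, y \<alpha>) = (p, Some y)"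
  using assms by (simp add: tparam_def pt_Coord covec_unique)

lemma infinity_tparam:
  assumes "\<alpha> \<in> Idx S" "p \<in> Nbhd S \<alpha>"
  shows "tparam S \<alpha> True (Coord S \<alpha> p, 0) = (p, None)"
  using assms by (simp add: tparam_def pt_Coord)

text \<open>The coordinate w = 1/y near infinity scales by the inverse of the factor for y.\<close>

definition tfac :: "'i \<Rightarrow> 'i \<Rightarrow> bool \<Rightarrow> complex \<Rightarrow> complex" where
  "tfac \<alpha> \<beta> b x = (if b then dcoord S \<alpha> \<beta> (pt S \<beta> x) else dcoord S \<beta> \<alpha> (pt S \<beta> x))"

lemma tparam_change:
  assumes "\<alpha> \<in> Idx S" "\<beta> \<in> Idx S" "x \<in> Coord S \<beta> ` (Nbhd S \<alpha> \<inter> Nbhd S \<beta>)"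
  shows "tparam S \<beta> b (x, t) = tparam S \<alpha> b (Coord S \<alpha> (pt S \<beta> x), t * tfac \<alpha> \<beta> b x)"
proof -
  let ?p = "pt S \<beta> x"
  have p: "?p \<in> Nbhd S \<alpha>" "?p \<in> Nbhd S \<beta>" using assms pt_Coord[OF assms(2)] by auto
  have inv: "dcoord S \<alpha> \<beta> ?p * dcoord S \<beta> \<alpha> ?p = 1" by (rule dcoord_inverse[OF assms(1,2) p])
  moreover have nz: "dcoord S \<alpha> \<beta> ?p \<noteq> 0" by (rule dcoord_nonzero[OF assms(1,2) p])
  ultimately have "dcoord S \<beta> \<alpha> ?p = 1 / dcoord S \<alpha> \<beta> ?p" by (simp add: field_simps)
  then show ?thesis
    using covec_change[OF assms(1,2) p] p assms nz
    by (auto simp: tparam_def tfac_def pt_Coord)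
qed

lemma overlap_image_open:
  "\<alpha> \<in> Idx S \<Longrightarrow> \<beta> \<in> Idx S \<Longrightarrow> open (Coord S \<beta> ` (Nbhd S \<alpha> \<inter> Nbhd S \<beta>))"
  by (rule open_Coord_image[OF _ openin_Nbhd])

lemma dcoord_diffable:
  assumes "\<alpha> \<in> Idx S" "\<beta> \<in> Idx S" "p \<in> Nbhd S \<alpha>" "p \<in> Nbhd S \<beta>"
  shows "diffable (dcoord S \<alpha> \<beta>) p"
  unfolding dcoord_def
  by (rule diffable_ddx[OF assms(2) openin_Int[OF openin_Nbhd[OF assms(1)] openin_Nbhd[OF assms(2)]]])
     (use assms diffable_Coord in auto)

lemma hol2_diffable:
  assumes "\<alpha> \<in> Idx S" "x \<in> Coord S \<alpha> ` Nbhd S \<alpha>" "diffable f (pt S \<alpha> x)"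
  shows "hol2 (\<lambda>w. f (pt S \<alpha> (fst w))) (x, t)"
proof -
  have "(f \<circ> pt S \<alpha>) field_differentiable at x"
    using assms pt_in[OF assms(2)] Coord_pt[OF assms(2)] by (force simp: diffable_def)
  then show ?thesis
    using hol2_compose1[OF hol2_fst, of "f \<circ> pt S \<alpha>" "(x, t)"] by simp
qed

definition tch :: "'i \<Rightarrow> 'i \<Rightarrow> bool \<Rightarrow> complex \<times> complex \<Rightarrow> complex \<times> complex" where
  "tch \<alpha> \<beta> b w = (Coord S \<alpha> (pt S \<beta> (fst w)), snd w * tfac \<alpha> \<beta> b (fst w))"

lemma hol2_tch:
  assumes "\<alpha> \<in> Idx S" "\<beta> \<in> Idx S" "x \<in> Coord S \<beta> ` (Nbhd S \<alpha> \<inter> Nbhd S \<beta>)"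
  shows "hol2 (\<lambda>w. fst (tch \<alpha> \<beta> b w)) (x, t)" and "hol2 (\<lambda>w. snd (tch \<alpha> \<beta> b w)) (x, t)"
proof -
  have x: "x \<in> Coord S \<beta> ` Nbhd S \<beta>" using assms by auto
  have p: "pt S \<beta> x \<in> Nbhd S \<alpha>" "pt S \<beta> x \<in> Nbhd S \<beta>" using assms pt_Coord[OF assms(2)] by auto
  show "hol2 (\<lambda>w. fst (tch \<alpha> \<beta> b w)) (x, t)"
    using hol2_diffable[OF assms(2) x diffable_Coord[OF assms(1) p(1)]] by (simp add: tch_def)
  have "hol2 (\<lambda>w. tfac \<alpha> \<beta> b (fst w)) (x, t)"
    unfolding tfac_def
    using hol2_diffable[OF assms(2) x dcoord_diffable[OF assms(1,2) p]]
      hol2_diffable[OF assms(2) x dcoord_diffable[OF assms(2,1) p(2,1)]] by (cases b) auto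
  then show "hol2 (\<lambda>w. snd (tch \<alpha> \<beta> b w)) (x, t)"
    unfolding tch_def snd_conv by (rule hol2_mult[OF hol2_snd])
qed

lemma preimage_change:
  assumes "\<alpha> \<in> Idx S" "\<beta> \<in> Idx S" and W: "\<And>Q. Q \<in> W \<Longrightarrow> fst Q \<in> Nbhd S \<alpha>"
  shows "tparam_preimage S \<beta> b W =
    {w \<in> Coord S \<beta> ` (Nbhd S \<alpha> \<inter> Nbhd S \<beta>) \<times> UNIV. tch \<alpha> \<beta> b w \<in> tparam_preimage S \<alpha> b W}"
proof (intro equalityI subsetI)
  fix w assume w: "w \<in> tparam_preimage S \<beta> b W"
  obtain x t where xt: "w = (x, t)" by (cases w)
  have x: "x \<in> Coord S \<beta> ` Nbhd S \<beta>" and Q: "tparam S \<beta> b (x, t) \<in> W"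
    using w by (auto simp: tparam_preimage_def xt)
  have p: "pt S \<beta> x \<in> Nbhd S \<alpha>" "pt S \<beta> x \<in> Nbhd S \<beta>" using W[OF Q] pt_in[OF x] by auto
  then have x': "x \<in> Coord S \<beta> ` (Nbhd S \<alpha> \<inter> Nbhd S \<beta>)" using Coord_pt[OF x] by (metis IntI imageI)
  have "tch \<alpha> \<beta> b w \<in> tparam_preimage S \<alpha> b W"
    using Q tparam_change[OF assms(1,2) x', of b t] p by (simp add: xt tparam_preimage_def tch_def)
  with x' show "w \<in> {w \<in> Coord S \<beta> ` (Nbhd S \<alpha> \<inter> Nbhd S \<beta>) \<times> UNIV. tch \<alpha> \<beta> b w \<in> tparam_preimage S \<alpha> b W}"
    by (simp add: xt)
next
  fix w assume w: "w \<in> {w \<in> Coord S \<beta> ` (Nbhd S \<alpha> \<inter> Nbhd S \<beta>) \<times> UNIV. tch \<alpha> \<beta> b w \<in> tparam_preimage S \<alpha> b W}"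
  obtain x t where xt: "w = (x, t)" by (cases w)
  have x': "x \<in> Coord S \<beta> ` (Nbhd S \<alpha> \<inter> Nbhd S \<beta>)" using w by (auto simp: xt)
  then show "w \<in> tparam_preimage S \<beta> b W"
    using w tparam_change[OF assms(1,2) x', of b t] by (auto simp: xt tparam_preimage_def tch_def)
qed

text \<open>Over U_\<alpha> the preimages in the other charts are pulled back from those in chart
  \<alpha> along the continuous transition \<open>tch\<close>, so one chart suffices.\<close>

lemma topenI:
  assumes \<alpha>: "\<alpha> \<in> Idx S" and W: "\<And>Q. Q \<in> W \<Longrightarrow> fst Q \<in> Nbhd S \<alpha>" "W \<subseteq> compact_cotangent_bundle S"
    and o: "\<And>b. open (tparam_preimage S \<alpha> b W)"
  shows "topen S W"
  unfolding topen_def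
proof (intro conjI ballI allI)
  fix \<beta> b assume \<beta>: "\<beta> \<in> Idx S"
  let ?V = "Coord S \<beta> ` (Nbhd S \<alpha> \<inter> Nbhd S \<beta>) \<times> (UNIV :: complex set)"
  have V: "open ?V" by (intro open_Times overlap_image_open \<alpha> \<beta> open_UNIV)
  have c: "continuous_on ?V (tch \<alpha> \<beta> b)"
  proof (rule continuous_at_imp_continuous_on, rule ballI)
    fix w assume "w \<in> ?V"
    then obtain x t where xt: "w = (x, t)" "x \<in> Coord S \<beta> ` (Nbhd S \<alpha> \<inter> Nbhd S \<beta>)" by blast
    have "isCont (\<lambda>w. (fst (tch \<alpha> \<beta> b w), snd (tch \<alpha> \<beta> b w))) w"
      unfolding xt(1) by (intro continuous_Pair hol2_isCont hol2_tch \<alpha> \<beta> xt(2))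
    then show "isCont (tch \<alpha> \<beta> b) w" by simp
  qed
  have "tparam_preimage S \<beta> b W = {w \<in> ?V. tch \<alpha> \<beta> b w \<in> tparam_preimage S \<alpha> b W}"
    by (rule preimage_change[OF \<alpha> \<beta>]) (rule W(1))
  then have "tparam_preimage S \<beta> b W = ?V \<inter> tch \<alpha> \<beta> b -` tparam_preimage S \<alpha> b W" by blast
  then show "open (tparam_preimage S \<beta> b W)"
    using continuous_open_preimage[OF c V o] by simp
qed (rule W(2))

lemma tholoI:
  assumes \<alpha>: "\<alpha> \<in> Idx S" and W: "\<And>Q. Q \<in> W \<Longrightarrow> fst Q \<in> Nbhd S \<alpha>" "topen S W"
    and g: "\<And>b z. z \<in> tparam_preimage S \<alpha> b W \<Longrightarrow> hol2 (g \<circ> tparam S \<alpha> b) z"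
  shows "tholo S W g"
  unfolding tholo_def holomorphic2_on_iff
proof (intro conjI ballI allI W(2))
  fix \<beta> b w assume \<beta>: "\<beta> \<in> Idx S" and w: "w \<in> tparam_preimage S \<beta> b W"
  let ?V = "Coord S \<beta> ` (Nbhd S \<alpha> \<inter> Nbhd S \<beta>) \<times> (UNIV :: complex set)"
  have V: "open ?V" by (intro open_Times overlap_image_open \<alpha> \<beta> open_UNIV)
  have "tparam_preimage S \<beta> b W = {w \<in> ?V. tch \<alpha> \<beta> b w \<in> tparam_preimage S \<alpha> b W}"
    by (rule preimage_change[OF \<alpha> \<beta>]) (rule W(1))
  with w have wV: "w \<in> ?V" and wt: "tch \<alpha> \<beta> b w \<in> tparam_preimage S \<alpha> b W" by blast+
  obtain x t where xt: "w = (x, t)" "x \<in> Coord S \<beta> ` (Nbhd S \<alpha> \<inter> Nbhd S \<beta>)" using wV by blast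
  have "hol2 (\<lambda>w. (g \<circ> tparam S \<alpha> b) (fst (tch \<alpha> \<beta> b w), snd (tch \<alpha> \<beta> b w))) w"
    by (rule hol2_compose2) (use hol2_tch[OF \<alpha> \<beta> xt(2)] g[OF wt] xt(1) in \<open>auto simp: comp_def\<close>)
  then show "hol2 (g \<circ> tparam S \<beta> b) w"
    by (rule hol2_cong[OF V wV, rotated]) (auto simp: tparam_change[OF \<alpha> \<beta>] tch_def)
qed

lemma tholo_topen: "tholo S W g \<Longrightarrow> topen S W"
  by (simp add: tholo_def)

lemma topen_Int:
  assumes "topen S W" "topen S V"
  shows "topen S (W \<inter> V)"
proof -
  have "tparam_preimage S \<alpha> b (W \<inter> V) = tparam_preimage S \<alpha> b W \<inter> tparam_preimage S \<alpha> b V" for \<alpha> b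
    by (auto simp: tparam_preimage_def)
  then show ?thesis using assms by (auto simp: topen_def)
qed

lemma tholo_subset: "tholo S W g \<Longrightarrow> topen S V \<Longrightarrow> V \<subseteq> W \<Longrightarrow> tholo S V g"
  by (auto simp: tholo_def holomorphic2_on_iff tparam_preimage_def)

lemma tholo_mult: "tholo S W f \<Longrightarrow> tholo S W g \<Longrightarrow> tholo S W (\<lambda>Q. f Q * g Q)"
  by (simp add: tholo_def holomorphic2_on_iff comp_def hol2_mult)

lemma tholo_const: "topen S W \<Longrightarrow> tholo S W (\<lambda>Q. c)"
  by (simp add: tholo_def holomorphic2_on_iff comp_def hol2_const)

lemma holo_at_const: "topen S W \<Longrightarrow> P \<in> W \<Longrightarrow> holo_at S P (\<lambda>Q. c)"
  unfolding holo_at_def using tholo_const by blast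

lemma holo_at_in: "holo_at S P g \<Longrightarrow> P \<in> compact_cotangent_bundle S"
  by (auto simp: holo_at_def tholo_def topen_def)

section \<open>Ideal stalks and divisors of zeros\<close>

lemma principal_stalk_mono:
  assumes "P \<in> W" "tholo S W e" "\<And>Q. Q \<in> W \<Longrightarrow> f Q = f' Q * e Q"
  shows "principal_stalk S f P \<subseteq> principal_stalk S f' P"
proof
  fix k assume "k \<in> principal_stalk S f P"
  then obtain V m where k: "holo_at S P k" "P \<in> V" "tholo S V m" "\<forall>Q\<in>V. k Q = f Q * m Q"
    by (auto simp: principal_stalk_def dvd_at_def)
  let ?U = "W \<inter> V"
  have U: "topen S ?U" using assms(2) k(3) by (intro topen_Int tholo_topen)
  have "tholo S ?U (\<lambda>Q. e Q * m Q)"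
    using tholo_subset[OF assms(2) U] tholo_subset[OF k(3) U] by (intro tholo_mult) auto
  moreover have "\<forall>Q\<in>?U. k Q = f' Q * (e Q * m Q)" using k(4) assms(3) by (auto simp: mult.assoc)
  ultimately have "dvd_at S P f' k" unfolding dvd_at_def using assms(1) k(2) by blast
  then show "k \<in> principal_stalk S f' P" using k(1) by (simp add: principal_stalk_def)
qed

text \<open>A unit generates the whole local ring.\<close>

lemma holo_at_stalk:
  assumes "holo_at S P k" "P \<in> W" "tholo S W e" "\<And>Q. Q \<in> W \<Longrightarrow> 1 = f Q * e Q"
  shows "k \<in> principal_stalk S f P"
proof -
  obtain V where V: "P \<in> V" "tholo S V k" using assms(1) by (auto simp: holo_at_def)
  have "dvd_at S P (\<lambda>Q. 1) k" unfolding dvd_at_def using V by (intro exI[of _ V] exI[of _ k]) auto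
  then have "k \<in> principal_stalk S (\<lambda>Q. 1) P" using assms(1) by (simp add: principal_stalk_def)
  moreover have "principal_stalk S (\<lambda>Q. 1) P \<subseteq> principal_stalk S f P"
    by (rule principal_stalk_mono[OF assms(2,3)]) (rule assms(4))
  ultimately show ?thesis by blast
qed

lemma coprime_at_one:
  "coprime_at S P f (\<lambda>Q. 1)" "coprime_at S P (\<lambda>Q. 1) f"
proof -
  have "d P \<noteq> 0" if "dvd_at S P d (\<lambda>Q. 1)" for d
  proof -
    from that[unfolded dvd_at_def] obtain W k where W: "P \<in> W" "\<forall>Q\<in>W. 1 = d Q * k Q"
      by (elim exE conjE)
    from bspec[OF W(2,1)] have "1 = d P * k P" .
    then show ?thesis by (metis mult_zero_left zero_neq_one)
  qed
  then show "coprime_at S P f (\<lambda>Q. 1)" "coprime_at S P (\<lambda>Q. 1) f"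
    by (auto simp: coprime_at_def)
qed

text \<open>The fraction f / 1 gives one inclusion. In any fraction g / d representing f the
  numerator g = d f is a multiple of f, which gives the other.\<close>

lemma zero_divisor_holomorphic:
  assumes "P \<in> W" "tholo S W f" "W \<subseteq> cotangent_bundle S"
  shows "zero_divisor S f P = principal_stalk S f P"
proof (intro equalityI subsetI)
  fix k assume "k \<in> zero_divisor S f P"
  then obtain g d V where gd: "holo_at S P d" "P \<in> V" "topen S V"
    "\<forall>Q\<in>V \<inter> cotangent_bundle S. d Q * f Q = g Q" "k \<in> principal_stalk S g P"
    unfolding zero_divisor_def by blast
  obtain U where U: "P \<in> U" "tholo S U d" using gd(1) by (auto simp: holo_at_def)
  let ?T = "U \<inter> V \<inter> W"
  have "topen S ?T" using U gd assms by (intro topen_Int) (auto simp: tholo_topen)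
  then have "tholo S ?T d" using tholo_subset[OF U(2)] by blast
  moreover have "P \<in> ?T" using U gd assms by blast
  moreover have "g Q = f Q * d Q" if "Q \<in> ?T" for Q
  proof -
    have "Q \<in> V \<inter> cotangent_bundle S" using that assms(3) by blast
    with gd(4) have "d Q * f Q = g Q" by blast
    then show ?thesis by (simp add: mult.commute)
  qed
  ultimately show "k \<in> principal_stalk S f P"
    using principal_stalk_mono[of P ?T d g f] gd(5) by blast
next
  fix k assume k: "k \<in> principal_stalk S f P"
  have "topen S W" using assms(2) by (rule tholo_topen)
  moreover have "holo_at S P f" unfolding holo_at_def using assms by blast
  moreover have "holo_at S P (\<lambda>Q. 1)" using holo_at_const[OF \<open>topen S W\<close> assms(1)] .
  ultimately show "k \<in> zero_divisor S f P"
    unfolding zero_divisor_def using k coprime_at_one(1)[of P f] assms(1)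
    by (intro CollectI exI[of _ f] exI[of _ "\<lambda>Q. 1"] conjI exI[of _ W]) auto
qed

text \<open>If d = 1/f is holomorphic, then 1/d is a fraction in lowest terms whose numerator is a
  unit. The equation is compared on the cotangent bundle only, so this applies at infinity, where d
  vanishes.\<close>

lemma zero_divisor_pole:
  assumes "P \<in> W" "tholo S W d" "\<And>Q. Q \<in> W \<inter> cotangent_bundle S \<Longrightarrow> d Q * f Q = 1"
  shows "zero_divisor S f P = {k. holo_at S P k}"
proof (intro equalityI subsetI)
  fix k assume "k \<in> zero_divisor S f P"
  then show "k \<in> {k. holo_at S P k}" by (auto simp: zero_divisor_def principal_stalk_def)
next
  fix k assume "k \<in> {k. holo_at S P k}"
  then have k: "holo_at S P k" by simp
  have W: "topen S W" using assms(2) by (rule tholo_topen)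
  have "k \<in> principal_stalk S (\<lambda>Q. 1) P"
    by (rule holo_at_stalk[OF k assms(1) tholo_const[OF W, of 1]]) simp
  moreover have "holo_at S P d" unfolding holo_at_def using assms by blast
  ultimately show "k \<in> zero_divisor S f P"
    unfolding zero_divisor_def
    using assms W coprime_at_one(2)[of P d] holo_at_const[OF W assms(1), of 1]
    by (intro CollectI exI[of _ "\<lambda>Q. 1"] exI[of _ d] conjI exI[of _ W]) auto
qed

lemma zero_divisor_cong:
  assumes "topen S W" "P \<in> W" "\<And>Q. Q \<in> W \<inter> cotangent_bundle S \<Longrightarrow> f Q = f' Q"
  shows "zero_divisor S f P = zero_divisor S f' P"
proof -
  have "zero_divisor S f P \<subseteq> zero_divisor S f' P" if "\<And>Q. Q \<in> W \<inter> cotangent_bundle S \<Longrightarrow> f Q = f' Q" for f f'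
  proof
    fix k assume "k \<in> zero_divisor S f P"
    then obtain g d V where gd: "holo_at S P g" "holo_at S P d" "coprime_at S P g d" "P \<in> V" "topen S V"
      "\<forall>Q\<in>V \<inter> cotangent_bundle S. d Q * f Q = g Q" "k \<in> principal_stalk S g P"
      unfolding zero_divisor_def by blast
    have "\<forall>Q\<in>(V \<inter> W) \<inter> cotangent_bundle S. d Q * f' Q = g Q"
    proof
      fix Q assume Q: "Q \<in> (V \<inter> W) \<inter> cotangent_bundle S"
      then have "d Q * f Q = g Q" using gd(6) by blast
      moreover have "f Q = f' Q" by (rule that) (use Q in blast)
      ultimately show "d Q * f' Q = g Q" by simp
    qed
    then show "k \<in> zero_divisor S f' P"
      unfolding zero_divisor_def using gd topen_Int[OF gd(5) assms(1)] assms(2)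
      by (intro CollectI exI[of _ g] exI[of _ d] conjI exI[of _ "V \<inter> W"]) auto
  qed
  then show ?thesis using assms(3) by (metis subset_antisym)
qed

end

section \<open>Spectral divisors of monic equations\<close>

text \<open>In Leibniz' formula at t only the n-th derivative of (s - t)^n survives.\<close>

lemma higher_deriv_zero_of_order:
  fixes F H :: "complex \<Rightarrow> complex"
  assumes U: "open U" "t \<in> U" and H: "H holomorphic_on U" and F: "\<And>s. s \<in> U \<Longrightarrow> F s = (s - t) ^ n * H s"
  shows "m < n \<Longrightarrow> (deriv ^^ m) F t = 0" and "(deriv ^^ n) F t = fact n * H t"
proof -
  have hol: "(\<lambda>s. (s - t) ^ n) holomorphic_on U" by (intro holomorphic_intros)
  have GH: "(\<lambda>s. (s - t) ^ n * H s) holomorphic_on U" by (intro holomorphic_intros H)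
  have Fh: "F holomorphic_on U" using holomorphic_cong[OF refl, of U F "\<lambda>s. (s - t) ^ n * H s"] F GH by simp
  have D: "(deriv ^^ m) F t = (\<Sum>i = 0..m. of_nat (m choose i) * (deriv ^^ i) (\<lambda>s. (s - t) ^ n) t * (deriv ^^ (m - i)) H t)" for m
    using higher_deriv_transform_within_open[OF Fh GH U(1,2) F, of m] higher_deriv_mult[OF hol H U(1,2), of m]
    by simp
  have P: "(deriv ^^ i) (\<lambda>s. (s - t) ^ n) t = (if i = n then fact n else 0)" if "i \<le> n" for i
    using that by (auto simp: higher_deriv_power pochhammer_fact)
  show "(deriv ^^ m) F t = 0" if "m < n"
    unfolding D using that by (intro sum.neutral) (auto simp: P)
  have "(\<Sum>i = 0..n. of_nat (n choose i) * (deriv ^^ i) (\<lambda>s. (s - t) ^ n) t * (deriv ^^ (n - i)) H t) =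
      (\<Sum>i = 0..n. if i = n then fact n * H t else 0)"
    by (intro sum.cong) (auto simp: P)
  then show "(deriv ^^ n) F t = fact n * H t" unfolding D by simp
qed

context projective_structure
begin

lemma cotangentE:
  assumes "P \<in> cotangent_bundle S"
  obtains p y \<alpha> where "P = (p, Some y)" "y \<in> cotangent_space S p" "\<alpha> \<in> Idx S" "p \<in> Nbhd S \<alpha>"
  using assms by (auto simp: cotangent_bundle_def)

text \<open>Open sets are tested in both parametrizations. In the one at infinity the image of
  \<open>V\<close> appears through w = 1/y, which is continuous there because finite points have w
  \<noteq> 0.\<close>

lemma finite_chart:
  assumes \<alpha>: "\<alpha> \<in> Idx S" and V: "open V" "V \<subseteq> Coord S \<alpha> ` Nbhd S \<alpha> \<times> UNIV"
  shows "topen S (tparam S \<alpha> False ` V)"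
    and "(\<And>z. z \<in> V \<Longrightarrow> hol2 (g \<circ> tparam S \<alpha> False) z) \<Longrightarrow> tholo S (tparam S \<alpha> False ` V) g"
proof -
  let ?W = "tparam S \<alpha> False ` V" and ?D = "Coord S \<alpha> ` Nbhd S \<alpha>"
  have fstW: "fst Q \<in> Nbhd S \<alpha>" if "Q \<in> ?W" for Q
    using that V(2) pt_in by fastforce
  have inj: "w = w'" if "w \<in> ?D \<times> UNIV" "w' \<in> ?D \<times> UNIV" "tparam S \<alpha> False w = tparam S \<alpha> False w'" for w w'
  proof -
    obtain x t x' t' where w: "w = (x, t)" "w' = (x', t')" by (cases w, cases w')
    have x: "x \<in> ?D" "x' \<in> ?D" using that w by auto
    have ptx: "pt S \<alpha> x = pt S \<alpha> x'" and c: "covec S \<alpha> (pt S \<alpha> x) t = covec S \<alpha> (pt S \<alpha> x') t'"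
      using that(3) by (auto simp: w tparam_def)
    have "x = x'" using arg_cong[OF ptx, of "Coord S \<alpha>"] unfolding Coord_pt[OF x(1)] Coord_pt[OF x(2)] .
    moreover have "t = t'"
      using fun_cong[OF c, of \<alpha>]
      unfolding covec_self[OF \<alpha> pt_in[OF x(1)]] covec_self[OF \<alpha> pt_in[OF x(2)]] .
    ultimately show ?thesis by (simp add: w)
  qed
  have pF: "tparam_preimage S \<alpha> False ?W = V"
  proof (intro equalityI subsetI)
    fix w assume w: "w \<in> tparam_preimage S \<alpha> False ?W"
    then obtain v where v: "v \<in> V" "tparam S \<alpha> False w = tparam S \<alpha> False v"
      unfolding tparam_preimage_def by blast
    then have "w = v" using w V(2) by (intro inj) (auto simp: tparam_preimage_def)
    then show "w \<in> V" using v by simp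
  qed (use V(2) in \<open>auto simp: tparam_preimage_def\<close>)
  define E where "E = ?D \<times> (- {0 :: complex})"
  have E: "open E" unfolding E_def by (intro open_Times open_Coord_Nbhd[OF \<alpha>]) auto
  have TF: "tparam S \<alpha> True (x, t) = tparam S \<alpha> False (x, 1 / t)" if "t \<noteq> 0" for x t
    using that by (simp add: tparam_def)
  have pT: "tparam_preimage S \<alpha> True ?W = {w \<in> E. (fst w, 1 / snd w) \<in> V}"
  proof (intro equalityI subsetI)
    fix w assume w: "w \<in> tparam_preimage S \<alpha> True ?W"
    obtain x t where xt: "w = (x, t)" by (cases w)
    have x: "x \<in> ?D" "tparam S \<alpha> True (x, t) \<in> ?W" using w by (auto simp: xt tparam_preimage_def)
    have t: "t \<noteq> 0"
    proof
      assume "t = 0"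
      then show False using x(2) by (auto simp: tparam_def)
    qed
    then have "(x, 1 / t) \<in> tparam_preimage S \<alpha> False ?W" using x TF[OF t] by (simp add: tparam_preimage_def)
    then show "w \<in> {w \<in> E. (fst w, 1 / snd w) \<in> V}" unfolding pF using x t by (simp add: xt E_def)
  next
    fix w assume w: "w \<in> {w \<in> E. (fst w, 1 / snd w) \<in> V}"
    obtain x t where xt: "w = (x, t)" by (cases w)
    show "w \<in> tparam_preimage S \<alpha> True ?W"
      using w TF[of t x] by (auto simp: xt E_def tparam_preimage_def)
  qed
  have h: "hol2 (\<lambda>w. 1 / snd w) w" if "w \<in> E" for w
  proof -
    have "snd w \<noteq> 0" using that by (auto simp: E_def)
    then show ?thesis by (rule hol2_inverse[OF hol2_snd])
  qed
  have "continuous_on E (\<lambda>w. (fst w, 1 / snd w))"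
  proof (rule continuous_at_imp_continuous_on, rule ballI)
    fix w assume "w \<in> E"
    then show "isCont (\<lambda>w. (fst w, 1 / snd w)) w"
      by (intro continuous_Pair hol2_isCont hol2_fst h)
  qed
  from continuous_open_preimage[OF this E V(1)]
  have "open (tparam_preimage S \<alpha> True ?W)"
    unfolding pT by (simp add: vimage_def Int_def)
  then have o: "open (tparam_preimage S \<alpha> b ?W)" for b using pF V(1) by (cases b) auto
  show W: "topen S ?W"
  proof (rule topenI[OF \<alpha> _ _ o])
    show "?W \<subseteq> compact_cotangent_bundle S"
    proof
      fix Q assume "Q \<in> ?W"
      then obtain x t where "(x, t) \<in> V" "Q = tparam S \<alpha> False (x, t)" by force
      then show "Q \<in> compact_cotangent_bundle S" using V(2) tparam_in[OF \<alpha>, of x False t] by blast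
    qed
  qed (rule fstW)
  assume g: "\<And>z. z \<in> V \<Longrightarrow> hol2 (g \<circ> tparam S \<alpha> False) z"
  show "tholo S ?W g"
  proof (rule tholoI[OF \<alpha> _ W])
    fix b w assume w: "w \<in> tparam_preimage S \<alpha> b ?W"
    show "hol2 (g \<circ> tparam S \<alpha> b) w"
    proof (cases b)
      case True
      then have wE: "w \<in> E" "(fst w, 1 / snd w) \<in> V" using w pT by auto
      have "hol2 (\<lambda>w. (g \<circ> tparam S \<alpha> False) (fst w, 1 / snd w)) w"
        by (rule hol2_compose2[OF hol2_fst h[OF wE(1)] g[OF wE(2)]])
      then have "hol2 (g \<circ> tparam S \<alpha> True) w"
      proof (rule hol2_cong[OF E wE(1), rotated])
        fix z assume "z \<in> E"
        then obtain x t where "z = (x, t)" "t \<noteq> 0" by (auto simp: E_def)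
        then show "(g \<circ> tparam S \<alpha> False) (fst z, 1 / snd z) = (g \<circ> tparam S \<alpha> True) z"
          using TF[of t x] by simp
      qed
      then show ?thesis using True by simp
    qed (use w pF g in auto)
  qed (rule fstW)
qed

definition Tset :: "'i \<Rightarrow> ('a, 'i) tpoint set" where
  "Tset \<alpha> = tparam S \<alpha> False ` (Coord S \<alpha> ` Nbhd S \<alpha> \<times> UNIV)"

lemma Tset_iff:
  assumes "\<alpha> \<in> Idx S"
  shows "Q \<in> Tset \<alpha> \<longleftrightarrow> Q \<in> cotangent_bundle S \<and> fst Q \<in> Nbhd S \<alpha>"
proof
  assume "Q \<in> Tset \<alpha>"
  then obtain x t where "Q = tparam S \<alpha> False (x, t)" "x \<in> Coord S \<alpha> ` Nbhd S \<alpha>" by (auto simp: Tset_def)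
  then show "Q \<in> cotangent_bundle S \<and> fst Q \<in> Nbhd S \<alpha>"
    using pt_in[of x \<alpha>] covec_in[OF assms pt_in[of x \<alpha>]] assms by (auto simp: tparam_def cotangent_bundle_def)
next
  assume Q: "Q \<in> cotangent_bundle S \<and> fst Q \<in> Nbhd S \<alpha>"
  then obtain p y where py: "Q = (p, Some y)" "y \<in> cotangent_space S p" "p \<in> Nbhd S \<alpha>"
    by (auto simp: cotangent_bundle_def)
  then show "Q \<in> Tset \<alpha>"
    using cotangent_tparam[OF assms py(3,2)] unfolding Tset_def
    by (intro image_eqI[of _ _ "(Coord S \<alpha> p, y \<alpha>)"]) auto
qed

lemma topen_Tset: "\<alpha> \<in> Idx S \<Longrightarrow> topen S (Tset \<alpha>)"
  unfolding Tset_def by (rule finite_chart(1)) (auto intro: open_Times open_Coord_Nbhd)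

lemma tholo_Tset:
  assumes \<alpha>: "\<alpha> \<in> Idx S"
    and F: "\<And>x t. x \<in> Coord S \<alpha> ` Nbhd S \<alpha> \<Longrightarrow> hol2 F (x, t)"
    and g: "\<And>x t. x \<in> Coord S \<alpha> ` Nbhd S \<alpha> \<Longrightarrow> g (tparam S \<alpha> False (x, t)) = F (x, t)"
  shows "tholo S (Tset \<alpha>) g"
proof -
  let ?V = "Coord S \<alpha> ` Nbhd S \<alpha> \<times> (UNIV :: complex set)"
  have V: "open ?V" by (intro open_Times open_Coord_Nbhd[OF \<alpha>] open_UNIV)
  show ?thesis
    unfolding Tset_def
  proof (rule finite_chart(2)[OF \<alpha> V])
    fix z assume z: "z \<in> ?V"
    show "hol2 (g \<circ> tparam S \<alpha> False) z"
      by (rule hol2_cong[OF V z, of F]) (use g F z in auto)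
  qed simp
qed

end

text \<open>Collects what is used of det(y + \<phi>): monic of degree r in y, holomorphic
  coefficients, homogeneous of weight r under a change of chart. \<open>f\<close> is constrained at
  finite points only, since \<open>char_function\<close> is unspecified at infinity.\<close>

locale monic_family = projective_structure X \<A> S
  for X :: "'a topology" and \<A> and S :: "('a, 'i) coord_system" +
  fixes r :: nat and b :: "'i \<Rightarrow> nat \<Rightarrow> 'a \<Rightarrow> complex" and f :: "'i \<Rightarrow> ('a, 'i) tpoint \<Rightarrow> complex"
    and pol :: "'i \<Rightarrow> 'a \<Rightarrow> complex \<Rightarrow> complex"
  defines "pol \<equiv> \<lambda>\<alpha> p t. t ^ r + (\<Sum>k<r. b \<alpha> k p * t ^ k)"
  assumes r_pos: "r > 0"
    and b_diffable: "\<And>\<alpha> k p. \<alpha> \<in> Idx S \<Longrightarrow> k < r \<Longrightarrow> p \<in> Nbhd S \<alpha> \<Longrightarrow> diffable (b \<alpha> k) p"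
    and f_eq: "\<And>\<alpha> p y. \<alpha> \<in> Idx S \<Longrightarrow> p \<in> Nbhd S \<alpha> \<Longrightarrow> y \<in> cotangent_space S p \<Longrightarrow>
      f \<alpha> (p, Some y) = pol \<alpha> p (y \<alpha>)"
    and compat: "\<And>\<alpha> \<beta> p t. \<alpha> \<in> Idx S \<Longrightarrow> \<beta> \<in> Idx S \<Longrightarrow> p \<in> Nbhd S \<alpha> \<Longrightarrow> p \<in> Nbhd S \<beta> \<Longrightarrow>
      pol \<beta> p (t * dcoord S \<alpha> \<beta> p) = dcoord S \<alpha> \<beta> p ^ r * pol \<alpha> p t"
begin

text \<open>The equation in the coordinate w = 1/y, cleared of its pole by w^r. Its constant term is
  the leading coefficient 1, so the curve does not meet infinity.\<close>

definition rev_pol :: "'i \<Rightarrow> 'a \<Rightarrow> complex \<Rightarrow> complex" where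
  "rev_pol \<alpha> p t = 1 + (\<Sum>k<r. b \<alpha> k p * t ^ (r - k))"

definition dpoly :: "'i \<Rightarrow> 'a \<Rightarrow> complex poly" where
  "dpoly \<alpha> p = Polynomial.monom 1 r + (\<Sum>k<r. Polynomial.monom (b \<alpha> k p) k)"

definition D :: "('a, 'i) tdivisor" where
  "D P = {k. \<exists>\<alpha> \<in> Idx S. fst P \<in> Nbhd S \<alpha> \<and> k \<in> zero_divisor S (f \<alpha>) P}"

lemma poly_dpoly: "poly (dpoly \<alpha> p) t = pol \<alpha> p t"
  by (simp add: dpoly_def pol_def poly_monom poly_sum)

lemma degree_dpoly: "degree (dpoly \<alpha> p) = r" and dpoly_nonzero: "dpoly \<alpha> p \<noteq> 0"
proof -
  have "degree (\<Sum>k<r. Polynomial.monom (b \<alpha> k p) k) < r"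
    by (rule degree_sum_less) (use r_pos degree_monom_le le_less_trans in blast)+
  then show "degree (dpoly \<alpha> p) = r"
    unfolding dpoly_def by (subst degree_add_eq_left) (simp_all add: degree_monom_eq)
  then show "dpoly \<alpha> p \<noteq> 0" using r_pos by auto
qed

lemma rev_pol: "t \<noteq> 0 \<Longrightarrow> rev_pol \<alpha> p t = t ^ r * pol \<alpha> p (1 / t)"
proof -
  assume t: "t \<noteq> 0"
  have "t ^ r * (b \<alpha> k p * (1 / t) ^ k) = b \<alpha> k p * t ^ (r - k)" if "k < r" for k
    using that t by (simp add: power_diff power_divide)
  then have "(\<Sum>k<r. t ^ r * (b \<alpha> k p * (1 / t) ^ k)) = (\<Sum>k<r. b \<alpha> k p * t ^ (r - k))"
    by (intro sum.cong) auto
  then show ?thesis using t by (simp add: rev_pol_def pol_def distrib_left sum_distrib_left power_divide)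
qed

lemma rev_pol_0: "rev_pol \<alpha> p 0 = 1"
proof -
  have "(\<Sum>k<r. b \<alpha> k p * 0 ^ (r - k)) = 0" by (intro sum.neutral) auto
  then show ?thesis by (simp add: rev_pol_def)
qed

lemma hol2_pol:
  assumes "\<alpha> \<in> Idx S" "x \<in> Coord S \<alpha> ` Nbhd S \<alpha>"
  shows "hol2 (\<lambda>w. pol \<alpha> (pt S \<alpha> (fst w)) (snd w)) (x, t)"
    and "hol2 (\<lambda>w. rev_pol \<alpha> (pt S \<alpha> (fst w)) (snd w)) (x, t)"
  unfolding pol_def rev_pol_def
  using hol2_diffable[OF assms] b_diffable[OF assms(1) _ pt_in[OF assms(2)]]
  by (auto intro!: hol2_add hol2_sum hol2_mult hol2_power hol2_snd hol2_const)

lemma f_tparam: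
  assumes "\<alpha> \<in> Idx S" "x \<in> Coord S \<alpha> ` Nbhd S \<alpha>"
  shows "f \<alpha> (tparam S \<alpha> False (x, t)) = pol \<alpha> (pt S \<alpha> x) t"
  using f_eq[OF assms(1) pt_in[OF assms(2)] covec_in[OF assms(1) pt_in[OF assms(2)]], of t]
    covec_self[OF assms(1) pt_in[OF assms(2)]]
  by (simp add: tparam_def)

lemma tholo_f: "\<alpha> \<in> Idx S \<Longrightarrow> tholo S (Tset \<alpha>) (f \<alpha>)"
  by (rule tholo_Tset[where F = "\<lambda>w. pol \<alpha> (pt S \<alpha> (fst w)) (snd w)"])
     (auto simp: f_tparam intro: hol2_pol)

text \<open>A neighborhood of the points at infinity over U_\<alpha> on which 1/f makes sense, with
  value 0 at infinity.\<close>

definition Winf :: "'i \<Rightarrow> ('a, 'i) tpoint set" where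
  "Winf \<alpha> = {(p, None) | p. p \<in> Nbhd S \<alpha>} \<union> {Q \<in> Tset \<alpha>. f \<alpha> Q \<noteq> 0}"

definition finv :: "'i \<Rightarrow> ('a, 'i) tpoint \<Rightarrow> complex" where
  "finv \<alpha> Q = (if snd Q = None then 0 else 1 / f \<alpha> Q)"

lemma fst_Winf: "\<alpha> \<in> Idx S \<Longrightarrow> Q \<in> Winf \<alpha> \<Longrightarrow> fst Q \<in> Nbhd S \<alpha>"
  by (auto simp: Winf_def Tset_iff)

lemma preimage_Winf:
  assumes \<alpha>: "\<alpha> \<in> Idx S"
  shows "tparam_preimage S \<alpha> False (Winf \<alpha>) =
      {w \<in> Coord S \<alpha> ` Nbhd S \<alpha> \<times> UNIV. pol \<alpha> (pt S \<alpha> (fst w)) (snd w) \<noteq> 0}"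
    and "tparam_preimage S \<alpha> True (Winf \<alpha>) =
      {w \<in> Coord S \<alpha> ` Nbhd S \<alpha> \<times> UNIV. rev_pol \<alpha> (pt S \<alpha> (fst w)) (snd w) \<noteq> 0}"
proof -
  have F: "tparam S \<alpha> False (x, t) \<in> Winf \<alpha> \<longleftrightarrow> pol \<alpha> (pt S \<alpha> x) t \<noteq> 0"
    if "x \<in> Coord S \<alpha> ` Nbhd S \<alpha>" for x t
  proof -
    have "tparam S \<alpha> False (x, t) \<in> Tset \<alpha>" using that by (auto simp: Tset_def)
    moreover have "tparam S \<alpha> False (x, t) \<notin> {(p, None) | p. p \<in> Nbhd S \<alpha>}" by (auto simp: tparam_def)
    ultimately have "tparam S \<alpha> False (x, t) \<in> Winf \<alpha> \<longleftrightarrow> f \<alpha> (tparam S \<alpha> False (x, t)) \<noteq> 0"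
      unfolding Winf_def by blast
    then show ?thesis unfolding f_tparam[OF \<alpha> that] .
  qed
  then show "tparam_preimage S \<alpha> False (Winf \<alpha>) =
      {w \<in> Coord S \<alpha> ` Nbhd S \<alpha> \<times> UNIV. pol \<alpha> (pt S \<alpha> (fst w)) (snd w) \<noteq> 0}"
    by (auto simp: tparam_preimage_def)
  have "tparam S \<alpha> True (x, t) \<in> Winf \<alpha> \<longleftrightarrow> rev_pol \<alpha> (pt S \<alpha> x) t \<noteq> 0"
    if x: "x \<in> Coord S \<alpha> ` Nbhd S \<alpha>" for x t
  proof (cases "t = 0")
    case True
    then show ?thesis using pt_in[OF x] rev_pol_0 by (auto simp: tparam_def Winf_def)
  next
    case False
    then have "tparam S \<alpha> True (x, t) = tparam S \<alpha> False (x, 1 / t)" by (simp add: tparam_def)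
    then show ?thesis using F[OF x, of "1 / t"] False by (simp add: rev_pol)
  qed
  then show "tparam_preimage S \<alpha> True (Winf \<alpha>) =
      {w \<in> Coord S \<alpha> ` Nbhd S \<alpha> \<times> UNIV. rev_pol \<alpha> (pt S \<alpha> (fst w)) (snd w) \<noteq> 0}"
    by (auto simp: tparam_preimage_def)
qed

text \<open>In the coordinate w = 1/y one has 1/f = w^r / \<open>rev_pol\<close>, which extends over
  w = 0 because the denominator is 1 there.\<close>

lemma tholo_finv:
  assumes \<alpha>: "\<alpha> \<in> Idx S"
  shows "tholo S (Winf \<alpha>) (finv \<alpha>)"
proof -
  let ?V = "Coord S \<alpha> ` Nbhd S \<alpha> \<times> (UNIV :: complex set)"
  have V: "open ?V" by (intro open_Times open_Coord_Nbhd[OF \<alpha>] open_UNIV)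
  have op: "open {w \<in> ?V. F w \<noteq> 0}" if F: "\<And>w. w \<in> ?V \<Longrightarrow> hol2 F w" for F
  proof -
    have "continuous_on ?V F"
      using F hol2_isCont by (intro continuous_at_imp_continuous_on) blast
    from continuous_open_preimage[OF this V, of "- {0}"] show ?thesis
      by (simp add: vimage_def Int_def open_Compl)
  qed
  have h1: "hol2 (\<lambda>w. pol \<alpha> (pt S \<alpha> (fst w)) (snd w)) w" if "w \<in> ?V" for w
    using that hol2_pol(1)[OF \<alpha>] by (cases w) auto
  have h2: "hol2 (\<lambda>w. rev_pol \<alpha> (pt S \<alpha> (fst w)) (snd w)) w" if "w \<in> ?V" for w
    using that hol2_pol(2)[OF \<alpha>] by (cases w) auto
  have o: "open (tparam_preimage S \<alpha> bb (Winf \<alpha>))" for bb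
    using op[OF h1] op[OF h2] preimage_Winf[OF \<alpha>] by (cases bb) auto
  have W: "topen S (Winf \<alpha>)"
  proof (rule topenI[OF \<alpha> _ _ o])
    show "Winf \<alpha> \<subseteq> compact_cotangent_bundle S"
      using \<alpha> by (auto simp: Winf_def Tset_iff compact_cotangent_bundle_def)
  qed (rule fst_Winf[OF \<alpha>])
  show ?thesis
  proof (rule tholoI[OF \<alpha> _ W])
    fix bb w assume w: "w \<in> tparam_preimage S \<alpha> bb (Winf \<alpha>)"
    show "hol2 (finv \<alpha> \<circ> tparam S \<alpha> bb) w"
    proof (cases bb)
      case False
      then have wV: "w \<in> ?V" "pol \<alpha> (pt S \<alpha> (fst w)) (snd w) \<noteq> 0"
        using w preimage_Winf(1)[OF \<alpha>] by auto
      have "hol2 (\<lambda>w. 1 / pol \<alpha> (pt S \<alpha> (fst w)) (snd w)) w" by (rule hol2_inverse[OF h1[OF wV(1)] wV(2)])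
      then have "hol2 (finv \<alpha> \<circ> tparam S \<alpha> False) w"
      proof (rule hol2_cong[OF V wV(1), rotated])
        fix z assume "z \<in> ?V"
        then obtain x t where z: "z = (x, t)" "x \<in> Coord S \<alpha> ` Nbhd S \<alpha>" by blast
        show "1 / pol \<alpha> (pt S \<alpha> (fst z)) (snd z) = (finv \<alpha> \<circ> tparam S \<alpha> False) z"
          using f_tparam[OF \<alpha> z(2), of t] by (simp add: z(1) finv_def tparam_def)
      qed
      then show ?thesis using False by simp
    next
      case True
      then have wV: "w \<in> ?V" "rev_pol \<alpha> (pt S \<alpha> (fst w)) (snd w) \<noteq> 0"
        using w preimage_Winf(2)[OF \<alpha>] by auto
      have "hol2 (\<lambda>w. snd w ^ r * (1 / rev_pol \<alpha> (pt S \<alpha> (fst w)) (snd w))) w"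
        by (intro hol2_mult hol2_power hol2_snd hol2_inverse[OF h2[OF wV(1)] wV(2)])
      then have "hol2 (finv \<alpha> \<circ> tparam S \<alpha> True) w"
      proof (rule hol2_cong[OF V wV(1), rotated])
        fix z assume "z \<in> ?V"
        then obtain x t where z: "z = (x, t)" "x \<in> Coord S \<alpha> ` Nbhd S \<alpha>" by blast
        show "snd z ^ r * (1 / rev_pol \<alpha> (pt S \<alpha> (fst z)) (snd z)) = (finv \<alpha> \<circ> tparam S \<alpha> True) z"
        proof (cases "t = 0")
          case True
          then show ?thesis using r_pos by (simp add: z(1) finv_def tparam_def)
        next
          case False
          then have "tparam S \<alpha> True (x, t) = tparam S \<alpha> False (x, 1 / t)" by (simp add: tparam_def)
          moreover have "snd (tparam S \<alpha> False (x, 1 / t)) = Some (covec S \<alpha> (pt S \<alpha> x) (1 / t))"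
            by (simp add: tparam_def)
          ultimately show ?thesis
            using f_tparam[OF \<alpha> z(2), of "1 / t"] False by (simp add: z(1) finv_def rev_pol)
        qed
      qed
      then show ?thesis using True by simp
    qed
  qed (rule fst_Winf[OF \<alpha>])
qed

lemma zero_divisor_finite:
  assumes "\<alpha> \<in> Idx S" "P \<in> Tset \<alpha>"
  shows "zero_divisor S (f \<alpha>) P = principal_stalk S (f \<alpha>) P"
  by (rule zero_divisor_holomorphic[OF assms(2) tholo_f[OF assms(1)]]) (use Tset_iff[OF assms(1)] in blast)

lemma zero_divisor_infinity:
  assumes "\<alpha> \<in> Idx S" "p \<in> Nbhd S \<alpha>"
  shows "zero_divisor S (f \<alpha>) (p, None) = {k. holo_at S (p, None) k}"
proof (rule zero_divisor_pole[OF _ tholo_finv[OF assms(1)]])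
  show "(p, None) \<in> Winf \<alpha>" using assms by (simp add: Winf_def)
  fix Q assume "Q \<in> Winf \<alpha> \<inter> cotangent_bundle S"
  then have "f \<alpha> Q \<noteq> 0" "snd Q \<noteq> None" by (auto simp: Winf_def cotangent_bundle_def)
  then show "finv \<alpha> Q * f \<alpha> Q = 1" by (simp add: finv_def)
qed

text \<open>The two equations differ by a power of dx_\<alpha> / dx_\<beta>, which is holomorphic on
  the overlap; exchanging the charts gives the opposite inclusion.\<close>

lemma stalk_change:
  assumes ab: "\<alpha> \<in> Idx S" "\<beta> \<in> Idx S" and P: "P \<in> Tset \<alpha>" "P \<in> Tset \<beta>"
  shows "principal_stalk S (f \<beta>) P \<subseteq> principal_stalk S (f \<alpha>) P"
proof (rule principal_stalk_mono[where W = "Tset \<alpha> \<inter> Tset \<beta>" and e = "\<lambda>Q. dcoord S \<alpha> \<beta> (fst Q) ^ r"])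
  show "P \<in> Tset \<alpha> \<inter> Tset \<beta>" using P by blast
  let ?W = "Tset \<alpha> \<inter> Tset \<beta>"
  have W: "topen S ?W" by (intro topen_Int topen_Tset ab)
  show "tholo S ?W (\<lambda>Q. dcoord S \<alpha> \<beta> (fst Q) ^ r)"
  proof (rule tholoI[OF ab(2) _ W])
    fix Q assume "Q \<in> ?W" then show "fst Q \<in> Nbhd S \<beta>" using Tset_iff[OF ab(2)] by blast
  next
    fix bb w assume w: "w \<in> tparam_preimage S \<beta> bb ?W"
    obtain x t where xt: "w = (x, t)" by (cases w)
    have x: "x \<in> Coord S \<beta> ` Nbhd S \<beta>" and Q: "tparam S \<beta> bb (x, t) \<in> ?W"
      using w by (auto simp: xt tparam_preimage_def)
    have "pt S \<beta> x \<in> Nbhd S \<alpha>" "pt S \<beta> x \<in> Nbhd S \<beta>"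
      using Q Tset_iff[OF ab(1)] Tset_iff[OF ab(2)] by auto
    from hol2_power[OF hol2_diffable[OF ab(2) x dcoord_diffable[OF ab this]], of r t]
    have "hol2 (\<lambda>w. dcoord S \<alpha> \<beta> (pt S \<beta> (fst w)) ^ r) w" by (simp add: xt)
    moreover have "(\<lambda>Q. dcoord S \<alpha> \<beta> (fst Q) ^ r) \<circ> tparam S \<beta> bb = (\<lambda>w. dcoord S \<alpha> \<beta> (pt S \<beta> (fst w)) ^ r)"
      by (auto simp: fun_eq_iff)
    ultimately show "hol2 ((\<lambda>Q. dcoord S \<alpha> \<beta> (fst Q) ^ r) \<circ> tparam S \<beta> bb) w" by simp
  qed
  fix Q assume Q: "Q \<in> ?W"
  then obtain p y where py: "Q = (p, Some y)" "y \<in> cotangent_space S p"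
    using Tset_iff[OF ab(1)] by (auto simp: cotangent_bundle_def)
  have p: "p \<in> Nbhd S \<alpha>" "p \<in> Nbhd S \<beta>" using Q py Tset_iff[OF ab(1)] Tset_iff[OF ab(2)] by auto
  have "y \<beta> = dcoord S \<alpha> \<beta> p * y \<alpha>" using py(2) p ab unfolding cotangent_space_def by blast
  then show "f \<beta> Q = f \<alpha> Q * dcoord S \<alpha> \<beta> (fst Q) ^ r"
    using compat[OF ab p, of "y \<alpha>"] f_eq[OF ab(1) p(1) py(2)] f_eq[OF ab(2) p(2) py(2)]
    by (simp add: py(1) mult.commute)
qed

lemma compactE:
  assumes "P \<in> compact_cotangent_bundle S"
  obtains "P \<in> cotangent_bundle S" | p where "P = (p, None)" "p \<in> (\<Union>\<alpha> \<in> Idx S. Nbhd S \<alpha>)"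
  using assms by (auto simp: compact_cotangent_bundle_def)

lemma D_finite:
  assumes "\<alpha> \<in> Idx S" "P \<in> Tset \<alpha>"
  shows "D P = principal_stalk S (f \<alpha>) P"
proof (intro equalityI subsetI)
  fix k assume "k \<in> D P"
  then obtain \<beta> where \<beta>: "\<beta> \<in> Idx S" "fst P \<in> Nbhd S \<beta>" "k \<in> zero_divisor S (f \<beta>) P" by (auto simp: D_def)
  have "P \<in> Tset \<beta>" using assms \<beta> Tset_iff by blast
  then show "k \<in> principal_stalk S (f \<alpha>) P"
    using \<beta> zero_divisor_finite stalk_change[OF assms(1) \<beta>(1) assms(2)] by blast
next
  fix k assume "k \<in> principal_stalk S (f \<alpha>) P"
  then show "k \<in> D P" using zero_divisor_finite[OF assms] assms Tset_iff[OF assms(1)] by (auto simp: D_def)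
qed

lemma D_infinity:
  assumes "p \<in> (\<Union>\<alpha> \<in> Idx S. Nbhd S \<alpha>)"
  shows "D (p, None) = {k. holo_at S (p, None) k}"
proof -
  obtain \<alpha> where "\<alpha> \<in> Idx S" "p \<in> Nbhd S \<alpha>" using assms by blast
  then have "{k. holo_at S (p, None) k} \<subseteq> D (p, None)"
    using zero_divisor_infinity[of \<alpha> p] by (auto simp: D_def)
  moreover have "D (p, None) \<subseteq> {k. holo_at S (p, None) k}"
    by (auto simp: D_def zero_divisor_def principal_stalk_def)
  ultimately show ?thesis by blast
qed

lemma D_eq:
  assumes "\<alpha> \<in> Idx S" "fst P \<in> Nbhd S \<alpha>" "P \<in> compact_cotangent_bundle S"
  shows "D P = zero_divisor S (f \<alpha>) P"
  using assms(3)
proof (cases rule: compactE)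
  case 1
  then have "P \<in> Tset \<alpha>" using assms Tset_iff by blast
  then show ?thesis using D_finite zero_divisor_finite assms(1) by simp
next
  case (2 p)
  then show ?thesis using D_infinity[of p] zero_divisor_infinity[of \<alpha> p] assms by simp
qed

lemma D_outside: "P \<notin> compact_cotangent_bundle S \<Longrightarrow> D P = {}"
  using holo_at_in[of P] unfolding D_def zero_divisor_def by blast

lemma tset_exists:
  assumes "P \<in> cotangent_bundle S"
  obtains \<alpha> where "\<alpha> \<in> Idx S" "P \<in> Tset \<alpha>"
  using assms by (elim cotangentE) (use Tset_iff assms in force)

lemma f_in_D: "\<alpha> \<in> Idx S \<Longrightarrow> P \<in> Tset \<alpha> \<Longrightarrow> f \<alpha> \<in> D P"
proof -
  assume \<alpha>: "\<alpha> \<in> Idx S" and P: "P \<in> Tset \<alpha>"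
  have h: "holo_at S P (f \<alpha>)" unfolding holo_at_def using P tholo_f[OF \<alpha>] by blast
  have "dvd_at S P (f \<alpha>) (f \<alpha>)"
    unfolding dvd_at_def using P tholo_const[OF topen_Tset[OF \<alpha>], of 1]
    by (intro exI[of _ "Tset \<alpha>"] exI[of _ "\<lambda>Q. 1"]) auto
  then show ?thesis using h D_finite[OF \<alpha> P] by (simp add: principal_stalk_def)
qed

lemma one_in_D: "p \<in> (\<Union>\<alpha> \<in> Idx S. Nbhd S \<alpha>) \<Longrightarrow> (\<lambda>Q. 1) \<in> D (p, None)"
proof -
  assume p: "p \<in> (\<Union>\<alpha> \<in> Idx S. Nbhd S \<alpha>)"
  then obtain \<alpha> where "\<alpha> \<in> Idx S" "p \<in> Nbhd S \<alpha>" by blast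
  then show ?thesis
    using D_infinity[OF p] holo_at_const[OF tholo_topen[OF tholo_finv, of \<alpha>], of "(p, None)" 1]
    by (auto simp: Winf_def)
qed

text \<open>Finite points have the local equation f_\<alpha>. Near infinity the constant 1 serves,
  because f_\<alpha> is a unit at the finite points of \<open>Winf\<close>.\<close>

lemma effective: "effective_divisor S D"
  unfolding effective_divisor_def
proof (intro conjI allI impI ballI)
  fix P assume "P \<notin> compact_cotangent_bundle S" then show "D P = {}" by (rule D_outside)
next
  fix P assume P: "P \<in> compact_cotangent_bundle S"
  show "\<exists>W g. P \<in> W \<and> tholo S W g \<and> (\<forall>V\<subseteq>W. topen S V \<and> V \<noteq> {} \<longrightarrow> (\<exists>Q\<in>V. g Q \<noteq> 0)) \<and>
      (\<forall>Q\<in>W. D Q = principal_stalk S g Q)"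
    using P
  proof (cases rule: compactE)
    case 1
    then obtain \<alpha> where \<alpha>: "\<alpha> \<in> Idx S" "P \<in> Tset \<alpha>" by (rule tset_exists)
    have "\<exists>Q\<in>V. f \<alpha> Q \<noteq> 0" if V: "V \<subseteq> Tset \<alpha>" "topen S V" "V \<noteq> {}" for V
    proof -
      obtain Q where Q: "Q \<in> V" using V by blast
      then obtain x t where xt: "Q = tparam S \<alpha> False (x, t)" "x \<in> Coord S \<alpha> ` Nbhd S \<alpha>"
        using V(1) by (auto simp: Tset_def)
      have "open (tparam_preimage S \<alpha> False V)" using V(2) \<alpha>(1) by (auto simp: topen_def)
      moreover have "(x, t) \<in> tparam_preimage S \<alpha> False V" using Q xt by (simp add: tparam_preimage_def)
      ultimately obtain A B where AB: "open A" "open B" "x \<in> A" "t \<in> B" "A \<times> B \<subseteq> tparam_preimage S \<alpha> False V"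
        by (elim open_prod_elim) auto
      \<comment> \<open>A nonempty open set contains a disc in some fiber, and on it a monic
        polynomial has only finitely many zeros.\<close>
      have "finite {s. poly (dpoly \<alpha> (pt S \<alpha> x)) s = 0}" by (rule poly_roots_finite[OF dpoly_nonzero])
      moreover have "infinite B" using AB(2,4) finite_imp_not_open[of B] by blast
      ultimately have "\<not> B \<subseteq> {s. poly (dpoly \<alpha> (pt S \<alpha> x)) s = 0}" using finite_subset by blast
      then obtain s where "s \<in> B" "poly (dpoly \<alpha> (pt S \<alpha> x)) s \<noteq> 0" by blast
      then have "tparam S \<alpha> False (x, s) \<in> V" "f \<alpha> (tparam S \<alpha> False (x, s)) \<noteq> 0"
        using AB f_tparam[OF \<alpha>(1) xt(2), of s] by (auto simp: poly_dpoly tparam_preimage_def)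
      then show ?thesis by blast
    qed
    then have "\<forall>V\<subseteq>Tset \<alpha>. topen S V \<and> V \<noteq> {} \<longrightarrow> (\<exists>Q\<in>V. f \<alpha> Q \<noteq> 0)" by blast
    then show ?thesis
      using \<alpha>(2) tholo_f[OF \<alpha>(1)] D_finite[OF \<alpha>(1)]
      by (intro exI[of _ "Tset \<alpha>"] exI[of _ "f \<alpha>"] conjI) blast+
  next
    case (2 p)
    then obtain \<alpha> where \<alpha>: "\<alpha> \<in> Idx S" "p \<in> Nbhd S \<alpha>" by blast
    have W: "topen S (Winf \<alpha>)" using tholo_finv[OF \<alpha>(1)] by (rule tholo_topen)
    have "D Q = principal_stalk S (\<lambda>Q. 1) Q" if Q: "Q \<in> Winf \<alpha>" for Q
    proof -
      have all: "principal_stalk S (\<lambda>Q. 1) Q = {k. holo_at S Q k}"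
        using holo_at_stalk[OF _ Q tholo_const[OF W, of 1], of _ "\<lambda>Q. 1"]
        by (auto simp: principal_stalk_def)
      show ?thesis
      proof (cases "snd Q = None")
        case True
        then have "Q = (fst Q, None)" by (cases Q) simp
        moreover have "fst Q \<in> (\<Union>\<alpha> \<in> Idx S. Nbhd S \<alpha>)" using fst_Winf[OF \<alpha>(1) Q] \<alpha>(1) by blast
        ultimately show ?thesis using D_infinity[of "fst Q"] all by simp
      next
        case False
        then have QT: "Q \<in> Tset \<alpha>" using Q by (auto simp: Winf_def)
        have V: "topen S (Winf \<alpha> \<inter> Tset \<alpha>)" by (intro topen_Int W topen_Tset \<alpha>(1))
        have th: "tholo S (Winf \<alpha> \<inter> Tset \<alpha>) (finv \<alpha>)"
          using tholo_subset[OF tholo_finv[OF \<alpha>(1)] V] by blast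
        have "1 = f \<alpha> Q' * finv \<alpha> Q'" if "Q' \<in> Winf \<alpha> \<inter> Tset \<alpha>" for Q'
        proof -
          have "snd Q' \<noteq> None" using that Tset_iff[OF \<alpha>(1)] by (auto simp: cotangent_bundle_def)
          moreover have "f \<alpha> Q' \<noteq> 0" using that calculation by (auto simp: Winf_def)
          ultimately show ?thesis by (simp add: finv_def)
        qed
        then have "k \<in> principal_stalk S (f \<alpha>) Q" if "holo_at S Q k" for k
          using holo_at_stalk[OF that _ th, of "f \<alpha>"] Q QT by blast
        then have "principal_stalk S (f \<alpha>) Q = {k. holo_at S Q k}"
          by (auto simp: principal_stalk_def)
        then show ?thesis using D_finite[OF \<alpha>(1) QT] all by simp
      qed
    qed
    moreover have "P \<in> Winf \<alpha>" using 2 \<alpha> by (simp add: Winf_def)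
    ultimately show ?thesis
      using tholo_const[OF W, of 1] by (intro exI[of _ "Winf \<alpha>"] exI[of _ "\<lambda>Q. 1"]) auto
  qed
qed

lemma support_D: "support S D \<subseteq> cotangent_bundle S"
proof
  fix P assume P: "P \<in> support S D"
  then have "P \<in> compact_cotangent_bundle S" by (simp add: support_def)
  then show "P \<in> cotangent_bundle S"
  proof (cases rule: compactE)
    case (2 p)
    then show ?thesis using P one_in_D[of p] by (auto simp: support_def)
  qed
qed

lemma support_iff:
  assumes "\<alpha> \<in> Idx S" "P \<in> Tset \<alpha>"
  shows "P \<in> support S D \<longleftrightarrow> f \<alpha> P = 0"
proof
  assume "P \<in> support S D"
  then show "f \<alpha> P = 0" using f_in_D[OF assms] by (simp add: support_def)
next
  assume z: "f \<alpha> P = 0"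
  have "k P = 0" if k: "k \<in> D P" for k
  proof -
    have "dvd_at S P (f \<alpha>) k" using k D_finite[OF assms] by (simp add: principal_stalk_def)
    then show ?thesis using z by (auto simp: dvd_at_def)
  qed
  moreover have "P \<in> compact_cotangent_bundle S"
    using assms Tset_iff by (auto simp: compact_cotangent_bundle_def)
  ultimately show "P \<in> support S D" by (simp add: support_def)
qed

section \<open>Multiplicities along the fibers\<close>

lemma dpoly_factor:
  obtains s where "\<And>z. pol \<alpha> p z = (z - t) ^ Polynomial.order t (dpoly \<alpha> p) * poly s z" "poly s t \<noteq> 0"
proof -
  obtain s where s: "dpoly \<alpha> p = [:- t, 1:] ^ Polynomial.order t (dpoly \<alpha> p) * s" "\<not> [:- t, 1:] dvd s"
    using order_decomp[OF dpoly_nonzero] by blast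
  have "pol \<alpha> p z = (z - t) ^ Polynomial.order t (dpoly \<alpha> p) * poly s z" for z
  proof -
    have "pol \<alpha> p z = poly ([:- t, 1:] ^ Polynomial.order t (dpoly \<alpha> p) * s) z" using s(1) poly_dpoly by metis
    then show ?thesis by (simp add: poly_power)
  qed
  moreover have "poly s t \<noteq> 0" using s(2) by (simp add: poly_eq_0_iff_dvd)
  ultimately show ?thesis by (rule that)
qed

text \<open>The germ f_\<alpha> itself vanishes to no higher order than that of the root.\<close>

lemma fiber_nonvanishing_order:
  assumes \<alpha>: "\<alpha> \<in> Idx S" "p \<in> Nbhd S \<alpha>" and y: "y \<in> cotangent_space S p"
  shows "fiber_nonvanishing S D (p, Some y) (Polynomial.order (y \<alpha>) (dpoly \<alpha> p))"
proof -
  let ?x = "Coord S \<alpha> p" and ?t = "y \<alpha>"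
  have P: "(p, Some y) = tparam S \<alpha> False (?x, ?t)" by (rule cotangent_tparam[OF \<alpha> y, symmetric])
  have x: "?x \<in> Coord S \<alpha> ` Nbhd S \<alpha>" using \<alpha> by blast
  have PT: "(p, Some y) \<in> Tset \<alpha>" unfolding P Tset_def using x by blast
  obtain s where s: "\<And>z. pol \<alpha> p z = (z - ?t) ^ Polynomial.order ?t (dpoly \<alpha> p) * poly s z" "poly s ?t \<noteq> 0"
    by (rule dpoly_factor[of \<alpha> p ?t]) blast
  have "(\<lambda>z. f \<alpha> (tparam S \<alpha> False (?x, z))) = (\<lambda>z. pol \<alpha> p z)"
    using f_tparam[OF \<alpha>(1) x] pt_Coord[OF \<alpha>] by simp
  moreover have "(deriv ^^ Polynomial.order ?t (dpoly \<alpha> p)) (\<lambda>z. pol \<alpha> p z) ?t = fact (Polynomial.order ?t (dpoly \<alpha> p)) * poly s ?t"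
    by (rule higher_deriv_zero_of_order(2)[of UNIV]) (use s(1) in \<open>auto intro: holomorphic_intros\<close>)
  ultimately have "(deriv ^^ Polynomial.order ?t (dpoly \<alpha> p)) (\<lambda>z. f \<alpha> (tparam S \<alpha> False (?x, z))) ?t \<noteq> 0"
    using s(2) by simp
  then show ?thesis
    unfolding fiber_nonvanishing_def using f_in_D[OF \<alpha>(1) PT] \<alpha>(1) x P by blast
qed

text \<open>\<open>fiber_nonvanishing\<close> allows every chart and both parametrizations, so the
  fiber coordinate s there is compared with y_\<alpha> = \<mu>(s). As \<mu>(s) - \<mu>(t) = (s - t)
  \<nu>(s), every germ f_\<alpha> m of the ideal is divisible by (s - t)^N in any of them.\<close>

lemma fiber_vanishing:
  assumes \<alpha>: "\<alpha> \<in> Idx S" "p \<in> Nbhd S \<alpha>" and y: "y \<in> cotangent_space S p"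
    and n: "n < Polynomial.order (y \<alpha>) (dpoly \<alpha> p)"
  shows "\<not> fiber_nonvanishing S D (p, Some y) n"
proof
  let ?P = "(p, Some y)" and ?N = "Polynomial.order (y \<alpha>) (dpoly \<alpha> p)"
  assume "fiber_nonvanishing S D ?P n"
  then obtain k \<beta> bb x t where k: "k \<in> D ?P" and \<beta>: "\<beta> \<in> Idx S" and x: "x \<in> Coord S \<beta> ` Nbhd S \<beta>"
    and P: "?P = tparam S \<beta> bb (x, t)"
    and nz: "(deriv ^^ n) (\<lambda>s. k (tparam S \<beta> bb (x, s))) t \<noteq> 0"
    unfolding fiber_nonvanishing_def by blast
  have p: "p = pt S \<beta> x" using P by (simp add: tparam_def)
  have p\<beta>: "p \<in> Nbhd S \<beta>" using pt_in[OF x] p by simp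
  have PT: "?P \<in> Tset \<alpha>" using Tset_iff[OF \<alpha>(1)] \<alpha> y by (auto simp: cotangent_bundle_def)
  obtain W m where W: "?P \<in> W" "tholo S W m" "\<forall>Q\<in>W. k Q = f \<alpha> Q * m Q"
    using k D_finite[OF \<alpha>(1) PT] by (auto simp: principal_stalk_def dvd_at_def)
  obtain s where s: "\<And>z. pol \<alpha> p z = (z - y \<alpha>) ^ ?N * poly s z" "poly s (y \<alpha>) \<noteq> 0"
    by (rule dpoly_factor[of \<alpha> p "y \<alpha>"]) blast
  let ?e = "dcoord S \<beta> \<alpha> p"
  define \<mu> where "\<mu> s = (if bb then ?e / s else ?e * s)" for s
  \<comment> \<open>For the coordinate at infinity this is e/s - e/t = (s - t)(-e / (s t)).\<close>
  define \<nu> where "\<nu> s = (if bb then - ?e / (s * t) else ?e)" for s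
  have tnz: "bb \<Longrightarrow> t \<noteq> 0" using P by (auto simp: tparam_def)
  have snd_eq: "tparam S \<beta> bb (x, s) = (p, Some (covec S \<alpha> p (\<mu> s)))" if "bb \<Longrightarrow> s \<noteq> 0" for s
    using that covec_change[OF \<alpha>(1) \<beta> \<alpha>(2) p\<beta>] by (cases bb) (simp_all add: tparam_def p[symmetric] \<mu>_def mult.commute)
  have \<mu>t: "\<mu> t = y \<alpha>"
    using snd_eq[of t] tnz P covec_self[OF \<alpha>, of "\<mu> t"] by simp
  have \<mu>\<nu>: "\<mu> s - y \<alpha> = (s - t) * \<nu> s" if "bb \<Longrightarrow> s \<noteq> 0" for s
    unfolding \<mu>t[symmetric] using that tnz by (auto simp: \<mu>_def \<nu>_def field_simps)
  have "open (tparam_preimage S \<beta> bb W)" using W(2) \<beta> by (auto simp: tholo_def topen_def)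
  moreover have "(x, t) \<in> tparam_preimage S \<beta> bb W" using W(1) P x by (simp add: tparam_preimage_def)
  ultimately obtain A B where AB: "open A" "open B" "x \<in> A" "t \<in> B" "A \<times> B \<subseteq> tparam_preimage S \<beta> bb W"
    by (elim open_prod_elim) auto
  \<comment> \<open>Keeps away from w = 0, where the parametrization leaves the cotangent
    space.\<close>
  define U where "U = (if bb then B - {0} else B)"
  have U: "open U" "t \<in> U" using AB tnz by (auto simp: U_def)
  have Unz: "bb \<Longrightarrow> s \<noteq> 0" if "s \<in> U" for s using that by (auto simp: U_def)
  have UB: "(x, s) \<in> tparam_preimage S \<beta> bb W" if "s \<in> U" for s
    using that AB by (auto simp: U_def split: if_splits)
  have mh: "(\<lambda>s. m (tparam S \<beta> bb (x, s))) holomorphic_on U"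
    unfolding holomorphic_on_open[OF U(1)]
  proof
    fix s assume "s \<in> U"
    then have "hol2 (m \<circ> tparam S \<beta> bb) (x, s)"
      using W(2) UB \<beta> by (auto simp: tholo_def holomorphic2_on_iff)
    from hol2_slice[OF this] show "\<exists>f'. ((\<lambda>s. m (tparam S \<beta> bb (x, s))) has_field_derivative f') (at s)"
      by (simp add: field_differentiable_def)
  qed
  have \<mu>h: "\<mu> holomorphic_on U"
    using Unz by (cases bb) (auto simp: \<mu>_def[abs_def] intro!: holomorphic_intros)
  have \<nu>h: "\<nu> holomorphic_on U"
    using Unz tnz by (cases bb) (auto simp: \<nu>_def[abs_def] intro!: holomorphic_intros)
  have sh: "(\<lambda>u. poly s (\<mu> u)) holomorphic_on U"
    using holomorphic_on_compose_gen[OF \<mu>h, of "poly s" UNIV] by (simp add: comp_def holomorphic_intros)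
  define Hf where "Hf u = \<nu> u ^ ?N * (poly s (\<mu> u) * m (tparam S \<beta> bb (x, u)))" for u
  have Hh: "Hf holomorphic_on U" unfolding Hf_def[abs_def] by (intro holomorphic_intros \<nu>h sh mh)
  have "k (tparam S \<beta> bb (x, u)) = (u - t) ^ ?N * Hf u" if u: "u \<in> U" for u
  proof -
    have e: "tparam S \<beta> bb (x, u) = (p, Some (covec S \<alpha> p (\<mu> u)))" by (rule snd_eq) (rule Unz[OF u])
    have "f \<alpha> (tparam S \<beta> bb (x, u)) = pol \<alpha> p (\<mu> u)"
      unfolding e f_eq[OF \<alpha> covec_in[OF \<alpha>]] covec_self[OF \<alpha>] ..
    also have "\<dots> = ((u - t) * \<nu> u) ^ ?N * poly s (\<mu> u)"
      unfolding s(1) using \<mu>\<nu>[of u] Unz[OF u] by simp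
    finally have "f \<alpha> (tparam S \<beta> bb (x, u)) = (u - t) ^ ?N * (\<nu> u ^ ?N * poly s (\<mu> u))"
      by (simp add: power_mult_distrib mult.assoc)
    moreover have "tparam S \<beta> bb (x, u) \<in> W" using UB[OF u] by (simp add: tparam_preimage_def)
    ultimately show ?thesis using W(3) by (simp add: Hf_def mult.assoc)
  qed
  from higher_deriv_zero_of_order(1)[OF U Hh this n] nz show False by simp
qed

lemma fiber_multiplicity_eq:
  assumes "\<alpha> \<in> Idx S" "p \<in> Nbhd S \<alpha>" "y \<in> cotangent_space S p"
  shows "fiber_multiplicity S D (p, Some y) = Polynomial.order (y \<alpha>) (dpoly \<alpha> p)"
  unfolding fiber_multiplicity_def
  by (rule Least_equality[where P = "fiber_nonvanishing S D (p, Some y)"])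
     (use fiber_nonvanishing_order[OF assms] fiber_vanishing[OF assms] not_le in blast)+

text \<open>Over p the support consists of the roots of the fiber polynomial, counted with their
  orders, and over the complex numbers these add up to its degree r.\<close>

lemma spectral: "spectral_curve S r D"
  unfolding spectral_curve_def
proof (intro conjI ballI effective)
  fix P assume P: "P \<in> compact_cotangent_bundle S"
  show "\<exists>n. fiber_nonvanishing S D P n"
    using P
  proof (cases rule: compactE)
    case 1
    then obtain p y \<alpha> where "P = (p, Some y)" "y \<in> cotangent_space S p" "\<alpha> \<in> Idx S" "p \<in> Nbhd S \<alpha>"
      by (rule cotangentE)
    then show ?thesis using fiber_nonvanishing_order by blast
  next
    case (2 p)
    then obtain \<alpha> where \<alpha>: "\<alpha> \<in> Idx S" "p \<in> Nbhd S \<alpha>" by blast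
    have "(deriv ^^ 0) (\<lambda>s. (\<lambda>Q. 1) (tparam S \<alpha> True (Coord S \<alpha> p, s))) 0 \<noteq> (0 :: complex)" by simp
    then have "fiber_nonvanishing S D P 0"
      unfolding fiber_nonvanishing_def 2(1)
      using one_in_D[OF 2(2)] \<alpha> infinity_tparam[OF \<alpha>, symmetric]
      by (intro bexI[of _ "\<lambda>Q. 1"] bexI[of _ \<alpha>] exI[of _ True] bexI[of _ "Coord S \<alpha> p"] exI[of _ 0]) auto
    then show ?thesis ..
  qed
next
  fix p assume "p \<in> (\<Union>\<alpha> \<in> Idx S. Nbhd S \<alpha>)"
  then obtain \<alpha> where \<alpha>: "\<alpha> \<in> Idx S" "p \<in> Nbhd S \<alpha>" by blast
  let ?R = "{t. poly (dpoly \<alpha> p) t = 0}" and ?c = "\<lambda>t. (p, Some (covec S \<alpha> p t))"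
  have c: "covec S \<alpha> p t \<in> cotangent_space S p" for t by (rule covec_in[OF \<alpha>])
  have T: "?c t \<in> Tset \<alpha>" for t using c \<alpha> by (auto simp: Tset_iff cotangent_bundle_def)
  have fc: "f \<alpha> (?c t) = poly (dpoly \<alpha> p) t" for t
    using f_eq[OF \<alpha> c] covec_self[OF \<alpha>] by (simp add: poly_dpoly)
  have S: "{P \<in> support S D. fst P = p} = ?c ` ?R"
  proof (intro equalityI subsetI)
    fix P assume P: "P \<in> {P \<in> support S D. fst P = p}"
    then obtain y where y: "P = (p, Some y)" "y \<in> cotangent_space S p"
      using support_D by (auto simp: cotangent_bundle_def)
    have "P = ?c (y \<alpha>)" using y covec_unique[OF \<alpha> y(2)] by simp
    moreover have "y \<alpha> \<in> ?R" using P support_iff[OF \<alpha>(1) T] fc calculation by simp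
    ultimately show "P \<in> ?c ` ?R" by blast
  next
    fix P assume "P \<in> ?c ` ?R"
    then show "P \<in> {P \<in> support S D. fst P = p}" using support_iff[OF \<alpha>(1) T] fc by auto
  qed
  have inj: "inj_on ?c ?R"
    using covec_self[OF \<alpha>] by (intro inj_onI) (metis Pair_inject option.inject)
  show "finite {P \<in> support S D. fst P = p}"
    unfolding S by (intro finite_imageI poly_roots_finite dpoly_nonzero)
  have "(\<Sum>P\<in>{P \<in> support S D. fst P = p}. fiber_multiplicity S D P) = (\<Sum>t\<in>?R. Polynomial.order t (dpoly \<alpha> p))"
    unfolding S sum.reindex[OF inj] using fiber_multiplicity_eq[OF \<alpha> c] covec_self[OF \<alpha>] by simp
  also have "\<dots> = size (proots (dpoly \<alpha> p))"
    by (simp add: size_multiset_overloaded_eq dpoly_nonzero)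
  also have "\<dots> = r" by (simp add: size_proots_complex degree_dpoly)
  finally show "(\<Sum>P\<in>{P \<in> support S D. fst P = p}. fiber_multiplicity S D P) = r" .
qed

end

section \<open>The semi-classical limit\<close>

context projective_structure
begin

lemma neg_neg [simp]: "fiber_neg (fiber_neg P) = P"
  by (cases P; cases "snd P") (auto simp: fiber_neg_def)

lemma fst_neg [simp]: "fst (fiber_neg P) = fst P"
  by (cases P) (simp add: fiber_neg_def)

lemma neg_tparam: "fiber_neg (tparam S \<alpha> b (x, t)) = tparam S \<alpha> b (x, - t)"
  using covec_minus[of \<alpha> "pt S \<alpha> x" t] covec_minus[of \<alpha> "pt S \<alpha> x" "1 / t"]
  by (auto simp: fiber_neg_def tparam_def)

lemma neg_image: "fiber_neg ` W = {Q. fiber_neg Q \<in> W}"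
proof (intro equalityI subsetI)
  fix Q assume "Q \<in> {Q. fiber_neg Q \<in> W}"
  then have "fiber_neg (fiber_neg Q) \<in> fiber_neg ` W" by blast
  then show "Q \<in> fiber_neg ` W" by simp
qed auto

lemma neg_cotangent: "P \<in> cotangent_bundle S \<Longrightarrow> fiber_neg P \<in> cotangent_bundle S"
proof -
  assume "P \<in> cotangent_bundle S"
  then obtain p y where P: "P = (p, Some y)" "p \<in> (\<Union>\<alpha> \<in> Idx S. Nbhd S \<alpha>)" and y: "y \<in> cotangent_space S p"
    unfolding cotangent_bundle_def by blast
  obtain \<alpha> where \<alpha>: "\<alpha> \<in> Idx S" "p \<in> Nbhd S \<alpha>" using P(2) by blast
  have "(\<lambda>\<beta>. - y \<beta>) = covec S \<alpha> p (- y \<alpha>)" unfolding covec_minus covec_unique[OF \<alpha> y] ..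
  then have "(\<lambda>\<beta>. - y \<beta>) \<in> cotangent_space S p" using covec_in[OF \<alpha>] by simp
  then show ?thesis using P unfolding cotangent_bundle_def by (simp add: fiber_neg_def)
qed

lemma neg_compact: "P \<in> compact_cotangent_bundle S \<Longrightarrow> fiber_neg P \<in> compact_cotangent_bundle S"
  using neg_cotangent[of P] by (auto simp: compact_cotangent_bundle_def fiber_neg_def)

lemma neg_preimage:
  "tparam_preimage S \<alpha> b (fiber_neg ` W) = (\<lambda>w. (fst w, - snd w)) -` tparam_preimage S \<alpha> b W"
  by (auto simp: tparam_preimage_def neg_image neg_tparam)

lemma topen_neg:
  assumes "topen S W"
  shows "topen S (fiber_neg ` W)"
  unfolding topen_def
proof (intro conjI ballI allI)
  show "fiber_neg ` W \<subseteq> compact_cotangent_bundle S"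
    using assms neg_compact by (auto simp: topen_def)
  fix \<alpha> b assume "\<alpha> \<in> Idx S"
  then have "open (tparam_preimage S \<alpha> b W)" using assms by (simp add: topen_def)
  then show "open (tparam_preimage S \<alpha> b (fiber_neg ` W))"
    unfolding neg_preimage by (rule open_vimage) (intro continuous_intros)
qed

lemma tholo_neg:
  assumes "tholo S W g"
  shows "tholo S (fiber_neg ` W) (g \<circ> fiber_neg)"
  unfolding tholo_def holomorphic2_on_iff
proof (intro conjI ballI allI topen_neg tholo_topen[OF assms])
  fix \<alpha> b w assume \<alpha>: "\<alpha> \<in> Idx S" and w: "w \<in> tparam_preimage S \<alpha> b (fiber_neg ` W)"
  have m: "hol2 (\<lambda>w. - snd w) w" using hol2_mult[OF hol2_const[of "-1"] hol2_snd[of w]] by simp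
  have "hol2 (g \<circ> tparam S \<alpha> b) (fst w, - snd w)"
    using w assms \<alpha> unfolding neg_preimage by (auto simp: tholo_def holomorphic2_on_iff)
  from hol2_compose2[OF hol2_fst m this]
  have "hol2 (\<lambda>w. (g \<circ> tparam S \<alpha> b) (fst w, - snd w)) w" .
  moreover have "(g \<circ> fiber_neg) \<circ> tparam S \<alpha> b = (\<lambda>w. (g \<circ> tparam S \<alpha> b) (fst w, - snd w))"
    by (auto simp: fun_eq_iff neg_tparam)
  ultimately show "hol2 ((g \<circ> fiber_neg) \<circ> tparam S \<alpha> b) w" by simp
qed

lemma holo_at_neg: "holo_at S P g \<Longrightarrow> holo_at S (fiber_neg P) (g \<circ> fiber_neg)"
  unfolding holo_at_def using tholo_neg by blast

lemma dvd_at_neg: "dvd_at S P f g \<Longrightarrow> dvd_at S (fiber_neg P) (f \<circ> fiber_neg) (g \<circ> fiber_neg)"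
proof -
  assume "dvd_at S P f g"
  then obtain W k where W: "P \<in> W" "tholo S W k" "\<forall>Q\<in>W. g Q = f Q * k Q"
    unfolding dvd_at_def by blast
  have "\<forall>Q\<in>fiber_neg ` W. (g \<circ> fiber_neg) Q = (f \<circ> fiber_neg) Q * (k \<circ> fiber_neg) Q"
    using W(3) by auto
  then show ?thesis unfolding dvd_at_def using W(1) tholo_neg[OF W(2)] by blast
qed

lemma neg_comp [simp]: "(g \<circ> fiber_neg) \<circ> fiber_neg = g"
  by (simp add: fun_eq_iff)

lemma coprime_at_neg:
  assumes "coprime_at S P f g"
  shows "coprime_at S (fiber_neg P) (f \<circ> fiber_neg) (g \<circ> fiber_neg)"
  unfolding coprime_at_def
proof (intro allI impI)
  fix d assume d: "holo_at S (fiber_neg P) d \<and> dvd_at S (fiber_neg P) d (f \<circ> fiber_neg) \<and>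
    dvd_at S (fiber_neg P) d (g \<circ> fiber_neg)"
  then have "holo_at S P (d \<circ> fiber_neg)" "dvd_at S P (d \<circ> fiber_neg) f" "dvd_at S P (d \<circ> fiber_neg) g"
    using holo_at_neg[of "fiber_neg P" d] dvd_at_neg[of "fiber_neg P" d "f \<circ> fiber_neg"]
      dvd_at_neg[of "fiber_neg P" d "g \<circ> fiber_neg"] by (simp_all only: neg_neg neg_comp)
  then have "(d \<circ> fiber_neg) P \<noteq> 0" using assms unfolding coprime_at_def by blast
  then show "d (fiber_neg P) \<noteq> 0" by simp
qed

lemma zero_divisor_neg:
  assumes "k \<in> zero_divisor S f P"
  shows "k \<circ> fiber_neg \<in> zero_divisor S (f \<circ> fiber_neg) (fiber_neg P)"
proof -
  obtain g d W where gd: "holo_at S P g" "holo_at S P d" "coprime_at S P g d" "P \<in> W" "topen S W"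
    "\<forall>Q\<in>W \<inter> cotangent_bundle S. d Q * f Q = g Q" "k \<in> principal_stalk S g P"
    using assms unfolding zero_divisor_def by blast
  have "\<forall>Q\<in>fiber_neg ` W \<inter> cotangent_bundle S. (d \<circ> fiber_neg) Q * (f \<circ> fiber_neg) Q = (g \<circ> fiber_neg) Q"
  proof
    fix Q assume "Q \<in> fiber_neg ` W \<inter> cotangent_bundle S"
    then have "fiber_neg Q \<in> W \<inter> cotangent_bundle S" using neg_cotangent[of Q] by (auto simp: neg_image)
    then show "(d \<circ> fiber_neg) Q * (f \<circ> fiber_neg) Q = (g \<circ> fiber_neg) Q" using gd(6) by simp
  qed
  moreover have "k \<circ> fiber_neg \<in> principal_stalk S (g \<circ> fiber_neg) (fiber_neg P)"
    using gd(7) holo_at_neg dvd_at_neg by (simp add: principal_stalk_def)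
  moreover have "fiber_neg P \<in> fiber_neg ` W" using gd(4) by blast
  ultimately show ?thesis
    unfolding zero_divisor_def
    using holo_at_neg[OF gd(1)] holo_at_neg[OF gd(2)] coprime_at_neg[OF gd(3)] topen_neg[OF gd(5)] by blast
qed

text \<open>The involution is its own inverse, so the one-sided transport used twice gives the
  equivalence.\<close>

lemma zero_divisor_neg_iff:
  "k \<circ> fiber_neg \<in> zero_divisor S f (fiber_neg P) \<longleftrightarrow> k \<in> zero_divisor S (f \<circ> fiber_neg) P"
  using zero_divisor_neg[of k "f \<circ> fiber_neg" P] zero_divisor_neg[of "k \<circ> fiber_neg" f "fiber_neg P"]
  by (simp only: neg_neg neg_comp) blast

text \<open>The constant is moved into the denominator, so the numerator and the ideal that it
  generates stay the same.\<close>

lemma zero_divisor_scale: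
  assumes "c \<noteq> 0" "\<And>Q. Q \<in> cotangent_bundle S \<Longrightarrow> f' Q = c * f Q"
  shows "zero_divisor S f P \<subseteq> zero_divisor S f' P"
proof
  fix k assume "k \<in> zero_divisor S f P"
  then obtain g d W where gd: "holo_at S P g" "holo_at S P d" "coprime_at S P g d" "P \<in> W" "topen S W"
    "\<forall>Q\<in>W \<inter> cotangent_bundle S. d Q * f Q = g Q" "k \<in> principal_stalk S g P"
    unfolding zero_divisor_def by blast
  let ?d = "\<lambda>Q. d Q * (1 / c)"
  have "holo_at S P ?d"
    using gd(2) tholo_mult tholo_const[OF tholo_topen, of _ _ "1 / c"] unfolding holo_at_def by blast
  moreover have "coprime_at S P g ?d"
    unfolding coprime_at_def
  proof (intro allI impI)
    fix e assume e: "holo_at S P e \<and> dvd_at S P e g \<and> dvd_at S P e ?d"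
    then obtain V m where V: "P \<in> V" "tholo S V m" "\<forall>Q\<in>V. d Q * (1 / c) = e Q * m Q"
      unfolding dvd_at_def by blast
    have "tholo S V (\<lambda>Q. m Q * c)" using tholo_mult[OF V(2) tholo_const[OF tholo_topen[OF V(2)]]] .
    moreover have "\<forall>Q\<in>V. d Q = e Q * (m Q * c)" using V(3) assms(1) by (auto simp: field_simps)
    ultimately have "dvd_at S P e d" unfolding dvd_at_def using V(1) by blast
    then show "e P \<noteq> 0" using gd(3) e unfolding coprime_at_def by blast
  qed
  moreover have "\<forall>Q\<in>W \<inter> cotangent_bundle S. ?d Q * f' Q = g Q"
    using gd(6) assms by auto
  ultimately show "k \<in> zero_divisor S f' P"
    unfolding zero_divisor_def using gd
    by (intro CollectI exI[of _ g] exI[of _ ?d] conjI exI[of _ W]) blast+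
qed

end

context monic_family
begin

text \<open>Divisors of zeros compare functions on the cotangent bundle only; this bridges the
  unspecified values of \<open>symbol_function\<close> and \<open>char_function\<close> at
  infinity.\<close>

lemma zero_divisor_eqI:
  assumes \<alpha>: "\<alpha> \<in> Idx S" "fst P \<in> Nbhd S \<alpha>" and P: "P \<in> compact_cotangent_bundle S"
    and g: "\<And>Q. Q \<in> Tset \<alpha> \<Longrightarrow> g Q = f \<alpha> Q"
  shows "zero_divisor S g P = zero_divisor S (f \<alpha>) P"
  using P
proof (cases rule: compactE)
  case 1
  then have "P \<in> Tset \<alpha>" using \<alpha> Tset_iff by blast
  then show ?thesis by (rule zero_divisor_cong[OF topen_Tset[OF \<alpha>(1)]]) (rule g, blast)
next
  case (2 p)
  then have "P \<in> Winf \<alpha>" using \<alpha> by (simp add: Winf_def)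
  then show ?thesis
  proof (rule zero_divisor_cong[OF tholo_topen[OF tholo_finv[OF \<alpha>(1)]]])
    fix Q assume "Q \<in> Winf \<alpha> \<inter> cotangent_bundle S"
    then have "Q \<in> Tset \<alpha>" using fst_Winf[OF \<alpha>(1)] Tset_iff[OF \<alpha>(1)] by blast
    then show "g Q = f \<alpha> Q" by (rule g)
  qed
qed

end

text \<open>Conjugation by diag(c^i) multiplies X_- by c and X_+^(l-1) by c^(1-l); with the factor
  c^l of q_l every term of \<phi> scales by c. With c = dx_\<alpha> / dx_\<beta> this is the change
  of chart for the characteristic equation.\<close>

lemma det_higgs_scale:
  assumes c: "c \<noteq> 0" and q: "\<And>l. l \<in> {2..r} \<Longrightarrow> q l \<beta> p = c ^ l * q l \<alpha> p"
  shows "Determinant.det ((t * c) \<cdot>\<^sub>m 1\<^sub>m r + higgs_field r q \<beta> p) =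
    c ^ r * Determinant.det (t \<cdot>\<^sub>m 1\<^sub>m r + higgs_field r q \<alpha> p)"
proof -
  define G where "G = Matrix.mat r r (\<lambda>(i, j). if i = j then c ^ i else 0)"
  let ?A = "t \<cdot>\<^sub>m 1\<^sub>m r + higgs_field r q \<alpha> p" and ?B = "(t * c) \<cdot>\<^sub>m 1\<^sub>m r + higgs_field r q \<beta> p"
  have G: "G \<in> carrier_mat r r" by (simp add: G_def)
  have A: "c \<cdot>\<^sub>m ?A \<in> carrier_mat r r" and B: "?B \<in> carrier_mat r r" by simp_all
  have "upper_triangular G" by (auto simp: G_def)
  then have "Determinant.det G = (\<Prod>i<r. G $$ (i, i))"
    using det_upper_triangular[OF _ G] G by (simp add: prod_list_diag)
  also have "\<dots> \<noteq> 0" using c by (simp add: G_def)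
  finally have detG: "Determinant.det G \<noteq> 0" .
  have entry: "c ^ i * higgs_field r q \<beta> p $$ (i, j) = c * higgs_field r q \<alpha> p $$ (i, j) * c ^ j"
    if ij: "i < r" "j < r" for i j
  proof -
    have "c ^ i * (q l \<beta> p * (if j = i + (l - 1) then wt r i j else 0)) =
        c * (q l \<alpha> p * (if j = i + (l - 1) then wt r i j else 0)) * c ^ j" if l: "l \<in> {2..r}" for l
    proof (cases "j = i + (l - 1)")
      case True
      have "c ^ i * c ^ l = c * c ^ j"
        using True l by (simp add: power_add[symmetric] power_Suc[symmetric] del: power_Suc)
      then show ?thesis using True q[OF l] by (simp add: mult_ac)
    qed simp
    then have "(\<Sum>l\<in>{2..r}. c ^ i * (q l \<beta> p * (if j = i + (l - 1) then wt r i j else 0))) =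
        (\<Sum>l\<in>{2..r}. c * (q l \<alpha> p * (if j = i + (l - 1) then wt r i j else 0)) * c ^ j)"
      by (intro sum.cong) auto
    moreover have "c ^ i * (if i = Suc j then sq r i else 0) = c * (if i = Suc j then sq r i else 0) * c ^ j"
      by simp
    ultimately show ?thesis
      unfolding higgs_entry[OF ij] distrib_left distrib_right sum_distrib_left sum_distrib_right by simp
  qed
  have "G * ?B = (c \<cdot>\<^sub>m ?A) * G"
  proof (rule eq_matI)
    fix i j assume "i < dim_row ((c \<cdot>\<^sub>m ?A) * G)" "j < dim_col ((c \<cdot>\<^sub>m ?A) * G)"
    then have ij: "i < r" "j < r" using G by auto
    have "(G * ?B) $$ (i, j) = (\<Sum>k<r. G $$ (i, k) * ?B $$ (k, j))" by (rule mult_entry[OF G B ij])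
    also have "\<dots> = (\<Sum>k<r. if k = i then c ^ i * ?B $$ (i, j) else 0)"
      using ij by (intro sum.cong) (auto simp: G_def)
    also have "\<dots> = c ^ i * ?B $$ (i, j)" using ij by simp
    finally have L: "(G * ?B) $$ (i, j) = c ^ i * ?B $$ (i, j)" .
    have "((c \<cdot>\<^sub>m ?A) * G) $$ (i, j) = (\<Sum>k<r. (c \<cdot>\<^sub>m ?A) $$ (i, k) * G $$ (k, j))"
      by (rule mult_entry[OF A G ij])
    also have "\<dots> = (\<Sum>k<r. if k = j then (c \<cdot>\<^sub>m ?A) $$ (i, j) * c ^ j else 0)"
      using ij by (intro sum.cong) (auto simp: G_def)
    also have "\<dots> = c * ?A $$ (i, j) * c ^ j" using ij by simp
    also have "\<dots> = c ^ i * ?B $$ (i, j)"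
      using entry[OF ij] ij by (auto simp: algebra_simps)
    finally show "(G * ?B) $$ (i, j) = ((c \<cdot>\<^sub>m ?A) * G) $$ (i, j)" using L by simp
  qed (use G in auto)
  then have "Determinant.det G * Determinant.det ?B = Determinant.det (c \<cdot>\<^sub>m ?A) * Determinant.det G"
    using det_mult[OF G B] det_mult[OF A G] by metis
  then have "Determinant.det ?B = Determinant.det (c \<cdot>\<^sub>m ?A)" using detG by simp
  then show ?thesis by simp
qed

lemma char_function_neg:
  "char_function r (\<lambda>\<alpha> p. - \<phi> \<alpha> p) \<alpha> (p, Some y) = Determinant.det (y \<alpha> \<cdot>\<^sub>m 1\<^sub>m r + \<phi> \<alpha> p)"
  if "\<phi> \<alpha> p \<in> carrier_mat r r"
proof -
  have "y \<alpha> \<cdot>\<^sub>m 1\<^sub>m r - (- \<phi> \<alpha> p) = y \<alpha> \<cdot>\<^sub>m 1\<^sub>m r + \<phi> \<alpha> p"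
    using that by (intro eq_matI) auto
  then show ?thesis by (simp add: char_function_def)
qed

lemma char_function_fiber_neg:
  assumes "\<phi> \<alpha> p \<in> carrier_mat r r"
  shows "char_function r \<phi> \<alpha> (fiber_neg (p, Some y)) =
    (- 1) ^ r * char_function r (\<lambda>\<alpha> p. - \<phi> \<alpha> p) \<alpha> (p, Some y)"
proof -
  have "(- y \<alpha>) \<cdot>\<^sub>m 1\<^sub>m r - \<phi> \<alpha> p = (- 1) \<cdot>\<^sub>m (y \<alpha> \<cdot>\<^sub>m 1\<^sub>m r + \<phi> \<alpha> p)"
    using assms by (intro eq_matI) auto
  moreover have "dim_col (\<phi> \<alpha> p) = r" using assms by simp
  ultimately have "char_function r \<phi> \<alpha> (fiber_neg (p, Some y)) =
      (- 1) ^ r * Determinant.det (y \<alpha> \<cdot>\<^sub>m 1\<^sub>m r + \<phi> \<alpha> p)"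
    by (simp add: char_function_def fiber_neg_def)
  then show ?thesis using char_function_neg[of \<phi> \<alpha> p r y] assms by simp
qed

context oper_patch
begin

text \<open>Carries the results for a fixed chart out of the locale, so that equations for all
  charts can be chosen together.\<close>

lemma local_equation:
  "\<exists>a. (\<forall>l\<le>r. a l \<in> \<O>) \<and>
     left_module_iso (rees_ring S \<alpha>) (left_quotient (rees_ring S \<alpha>) (rees_op S \<alpha> r a))
       (rees_module S r (oper_bundle S \<xi> r) (oper_hbar_connection r q) \<alpha>) \<and>
     (\<forall>p\<in>N. a 0 p 0 = 1) \<and>
     (\<forall>p\<in>N. \<forall>y. (\<Sum>l\<le>r. a l p 0 * y ^ (r - l)) = Determinant.det (y \<cdot>\<^sub>m 1\<^sub>m r + higgs_field r q \<alpha> p))"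
proof -
  obtain P where P: "is_eqn P" using eqn_exists by blast
  have "P k \<in> \<O>" for k using P dr.coefs_in by (auto simp: is_eqn_def)
  moreover have "\<forall>p\<in>N. P (r - 0) p 0 = 1" using P by (simp add: is_eqn_def)
  ultimately show ?thesis
    using rees_module_iso[OF P] symbol_eq_det[OF P] by (intro exI[of _ "\<lambda>l. P (r - l)"]) blast
qed

end

theorem theorem3p11:
  fixes X :: "'a topology"
    and \<A> :: "('a set \<times> ('a \<Rightarrow> complex)) set"
    and S :: "('a, 'i) coord_system"
    and \<xi> :: "'i \<Rightarrow> 'i \<Rightarrow> 'a \<Rightarrow> complex"
    and g r :: nat
    and q :: "nat \<Rightarrow> 'i \<Rightarrow> 'a \<Rightarrow> complex"
    and E0 :: "('a, 'i) transition"
    and \<phi> :: "('a, 'i) matrix_form"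
    and \<Sigma> :: "('a, 'i) tdivisor"
    and \<E> :: "'i \<Rightarrow> ('a hbar_op, ('a, 'i) covector) module"
  assumes "compact_riemann_surface X \<A>"
    and "has_genus X g" and "g \<ge> 2"
    and "projective_coord_system X \<A> S"
    and "theta_characteristic S \<xi>"
    and "r \<ge> 2"
    and "\<forall>l\<in>{2..r}. q l \<in> pluricanonical S l"
    and "(E0, \<phi>) = hitchin_section \<xi> r q"
    and "\<E> = rees_module S r (oper_bundle S \<xi> r) (oper_hbar_connection r q)"
    and "\<Sigma> = spectral_divisor S r (E0, \<phi>)"
  shows "is_semiclassical_limit S r \<E> (neg_pullback \<Sigma>) \<and>
         neg_pullback \<Sigma> = spectral_divisor S r (E0, \<lambda>\<alpha> p. - \<phi> \<alpha> p) \<and>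
         support S (neg_pullback \<Sigma>) \<subseteq> cotangent_bundle S"
proof -
  interpret projective_structure X \<A> S by unfold_locales (rule assms(4))
  have \<phi>: "\<phi> = higgs_field r q" using assms(8) by (simp add: hitchin_section_def)
  have \<phi>c: "\<phi> \<alpha> p \<in> carrier_mat r r" for \<alpha> p by (simp add: \<phi>)
  \<comment> \<open>Bundles the local statement so that a single application of choice yields the
    equations of all charts.\<close>
  define eqs where "eqs \<alpha> a \<longleftrightarrow> (\<forall>l\<le>r. a l \<in> holfun_hbar S (Nbhd S \<alpha>)) \<and>
     left_module_iso (rees_ring S \<alpha>) (left_quotient (rees_ring S \<alpha>) (rees_op S \<alpha> r a)) (\<E> \<alpha>) \<and>
     (\<forall>p\<in>Nbhd S \<alpha>. a 0 p 0 = 1) \<and>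
     (\<forall>p\<in>Nbhd S \<alpha>. \<forall>y. (\<Sum>l\<le>r. a l p 0 * y ^ (r - l)) = Determinant.det (y \<cdot>\<^sub>m 1\<^sub>m r + \<phi> \<alpha> p))"
    for \<alpha> a
  have "\<exists>a. eqs \<alpha> a" if "\<alpha> \<in> Idx S" for \<alpha>
  proof -
    interpret oper_patch X \<A> S \<xi> \<alpha> r q
      by unfold_locales (use assms that in auto)
    show ?thesis unfolding eqs_def \<phi> assms(9) by (rule local_equation)
  qed
  then have "\<forall>\<alpha>. \<exists>a. \<alpha> \<in> Idx S \<longrightarrow> eqs \<alpha> a" by blast
  from choice[OF this] obtain a where a: "\<And>\<alpha>. \<alpha> \<in> Idx S \<Longrightarrow> eqs \<alpha> (a \<alpha>)" by blast
  have a_in: "a \<alpha> l \<in> holfun_hbar S (Nbhd S \<alpha>)" if "\<alpha> \<in> Idx S" "l \<le> r" for \<alpha> l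
    using a[OF that(1)] that(2) by (simp add: eqs_def)
  have a_iso: "left_module_iso (rees_ring S \<alpha>)
      (left_quotient (rees_ring S \<alpha>) (rees_op S \<alpha> r (a \<alpha>))) (\<E> \<alpha>)" if "\<alpha> \<in> Idx S" for \<alpha>
    using a[OF that] by (simp add: eqs_def)
  have a_one: "a \<alpha> 0 p 0 = 1" if "\<alpha> \<in> Idx S" "p \<in> Nbhd S \<alpha>" for \<alpha> p
    using a[OF that(1)] that(2) by (simp add: eqs_def)
  have a_det: "(\<Sum>l\<le>r. a \<alpha> l p 0 * y ^ (r - l)) = Determinant.det (y \<cdot>\<^sub>m 1\<^sub>m r + \<phi> \<alpha> p)"
    if "\<alpha> \<in> Idx S" "p \<in> Nbhd S \<alpha>" for \<alpha> p y
    using a[OF that(1)] that(2) by (simp add: eqs_def)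
  \<comment> \<open>The coefficients of the symbol in ascending order, at hbar = 0.\<close>
  define b where "b \<alpha> k p = a \<alpha> (r - k) p 0" for \<alpha> k p
  define F where "F = char_function r (\<lambda>\<alpha> p. - \<phi> \<alpha> p)"
  have F: "F \<alpha> (p, Some y) = Determinant.det (y \<alpha> \<cdot>\<^sub>m 1\<^sub>m r + \<phi> \<alpha> p)" for \<alpha> p y
    unfolding F_def by (rule char_function_neg[where \<phi> = \<phi>, OF \<phi>c])
  have pol: "t ^ r + (\<Sum>k<r. b \<alpha> k p * t ^ k) = Determinant.det (t \<cdot>\<^sub>m 1\<^sub>m r + \<phi> \<alpha> p)"
    if \<alpha>: "\<alpha> \<in> Idx S" "p \<in> Nbhd S \<alpha>" for \<alpha> p t
  proof -
    have "(\<Sum>l\<le>r. a \<alpha> l p 0 * t ^ (r - l)) = (\<Sum>k<Suc r. b \<alpha> k p * t ^ k)"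
      using sum.nat_diff_reindex[of "\<lambda>k. b \<alpha> k p * t ^ k" "Suc r"]
      by (simp add: b_def lessThan_Suc_atMost)
    also have "\<dots> = t ^ r + (\<Sum>k<r. b \<alpha> k p * t ^ k)" using a_one[OF \<alpha>] by (simp add: b_def)
    finally show ?thesis using a_det[OF \<alpha>, of t] by simp
  qed
  \<comment> \<open>The symbol supplies the monic form and the holomorphic coefficients, its
    equality with det(y + \<phi>) the function \<open>F\<close>, and \<open>det_higgs_scale\<close>
    the change of chart.\<close>
  interpret mf: monic_family X \<A> S r b F "\<lambda>\<alpha> p t. t ^ r + (\<Sum>k<r. b \<alpha> k p * t ^ k)"
  proof (unfold_locales, goal_cases)
    case 1 show ?case using assms(6) by simp
  next
    case (2 \<alpha> k p)
    show ?case
      unfolding b_def[abs_def]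
      by (rule holfun_diffable[OF openin_Nbhd[OF 2(1)] hbar_slice[OF openin_Nbhd[OF 2(1)] a_in[OF 2(1)]] 2(3)]) simp
  next
    case (3 \<alpha> p y)
    then show ?case using F pol by simp
  next
    case (4 \<alpha> \<beta> p t)
    have "q l \<beta> p = dcoord S \<alpha> \<beta> p ^ l * q l \<alpha> p" if "l \<in> {2..r}" for l
      using assms(7) that 4 unfolding pluricanonical_def by blast
    from det_higgs_scale[where q = q and \<alpha> = \<alpha> and \<beta> = \<beta> and p = p, OF dcoord_nonzero[OF 4] this]
    show ?case unfolding pol[OF 4(2,4)] pol[OF 4(1,3)] \<phi> .
  qed
  have D: "spectral_divisor S r (E0, \<lambda>\<alpha> p. - \<phi> \<alpha> p) = mf.D"
    by (rule ext) (simp only: spectral_divisor_def prod.case F_def[symmetric] mf.D_def)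
  have neg: "neg_pullback \<Sigma> = spectral_divisor S r (E0, \<lambda>\<alpha> p. - \<phi> \<alpha> p)"
  proof (rule ext)
    fix P
    \<comment> \<open>The pullback of det(y - \<phi>) is (-1)^r det(y + \<phi>); this constant is
      its own inverse, so the scaling lemma applies in both directions.\<close>
    have "zero_divisor S (char_function r \<phi> \<alpha> \<circ> fiber_neg) P = zero_divisor S (F \<alpha>) P" for \<alpha>
    proof -
      have s: "(char_function r \<phi> \<alpha> \<circ> fiber_neg) Q = (- 1) ^ r * F \<alpha> Q" if "Q \<in> cotangent_bundle S" for Q
        using that char_function_fiber_neg[of \<phi> \<alpha> _ r, OF \<phi>c] by (auto simp: cotangent_bundle_def F_def)
      have "F \<alpha> Q = (- 1) ^ r * (char_function r \<phi> \<alpha> \<circ> fiber_neg) Q" if "Q \<in> cotangent_bundle S" for Q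
        unfolding s[OF that] by (simp add: power_mult_distrib[symmetric] mult.assoc[symmetric])
      with s show ?thesis
        by (intro equalityI zero_divisor_scale[where c = "(- 1) ^ r"]) simp_all
    qed
    then show "neg_pullback \<Sigma> P = spectral_divisor S r (E0, \<lambda>\<alpha> p. - \<phi> \<alpha> p) P"
      by (simp add: neg_pullback_def assms(10) spectral_divisor_def zero_divisor_neg_iff F_def)
  qed
  have "is_semiclassical_limit S r \<E> mf.D"
    unfolding is_semiclassical_limit_def
  proof (intro conjI exI[of _ a] ballI allI impI)
    show "spectral_curve S r mf.D" by (rule mf.spectral)
    fix \<alpha> assume \<alpha>: "\<alpha> \<in> Idx S"
    show "a \<alpha> l \<in> holfun_hbar S (Nbhd S \<alpha>)" if "l \<le> r" for l by (rule a_in[OF \<alpha> that])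
    show "left_module_iso (rees_ring S \<alpha>)
        (left_quotient (rees_ring S \<alpha>) (rees_op S \<alpha> r (a \<alpha>))) (\<E> \<alpha>)" by (rule a_iso[OF \<alpha>])
    fix P assume P: "P \<in> compact_cotangent_bundle S" "fst P \<in> Nbhd S \<alpha>"
    have "symbol_function r (a \<alpha>) \<alpha> Q = F \<alpha> Q" if Q: "Q \<in> Tset \<alpha>" for Q
    proof -
      obtain p y where "Q = (p, Some y)" "p \<in> Nbhd S \<alpha>"
        using Q Tset_iff[OF \<alpha>, of Q] unfolding cotangent_bundle_def by auto
      then show ?thesis using F a_det[OF \<alpha>] by (simp add: symbol_function_def)
    qed
    from mf.zero_divisor_eqI[OF \<alpha> P(2,1) this] mf.D_eq[OF \<alpha> P(2,1)]
    show "mf.D P = zero_divisor S (symbol_function r (a \<alpha>) \<alpha>) P" by simp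
  qed
  then show ?thesis using neg D mf.support_D by simp
qed

end
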